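(* Let $W$ be a vector space and let $r,N$ be positive integers. Let $V$ be a closed graded local subspace of $\mathcal{E}(W,r;N)$. Then $(V,Y_{\mathcal{E}},1_W)$ carries the structure of an $(r+1)$-toroidal vertex algebra (with vertex operator map $Y_{\mathcal{E}}$ and vacuum vector $1_W$), with (the restriction to $V$ of) $\sigma$ as an automorphism which has $N$ as a period, and $W$ is a faithful $\sigma$-twisted $V$-module with $$Y_W(a(x_0,\mathbf{x});z_0,\mathbf{z})=a(z_0,\mathbf{z})\quad\text{for } a(x_0,\mathbf{x})\in V.$$
   Context: Conventions. All vector spaces are over $\mathbb{C}$; $\mathbb{N}$ is the set of nonnegative integers; $r$ is a fixed positive integer. $\mathbf{x}=(x_1,\dots,x_r)$ (similarly $\mathbf{y},\mathbf{z}$) are commuting formal variables, $\mathbf{x}^{\mathbf{m}}=x_1^{m_1}\cdots x_r^{m_r}$ for $\mathbf{m}\in\mathbb{Z}^r$, and $\mathbf{z}\mathbf{y}=(z_1y_1,\dots,z_ry_r)$. $\delta(z)=\sum_{n\in\mathbb{Z}}z^n$, and $(x_0\pm y_0)^{\alpha}$ ($\alpha\in\mathbb{C}$) is expanded in nonnegative integer powers of the second variable $y_0$. $\omega_N=\exp(2\pi\sqrt{-1}/N)$. $\mathrm{Res}_{x_0}$ is the coefficient of $x_0^{-1}$. For a vector space $W$ and a positive integer $N$, $$\mathcal{E}(W,r;N)=\mathrm{Hom}\big(W,W[[x_1^{\pm1},\dots,x_r^{\pm1}]]((x_0^{1/N}))\big),\qquad \mathcal{E}(W,r)=\mathcal{E}(W,r;1).$$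 Toroidal vertex algebra. An $(r+1)$-toroidal vertex algebra is a vector space $V$ with a linear map $Y(\cdot;x_0,\mathbf{x}):V\to\mathcal{E}(V,r)$, $v\mapsto Y(v;x_0,\mathbf{x})=\sum_{(m_0,\mathbf{m})\in\mathbb{Z}\times\mathbb{Z}^r}v_{m_0,\mathbf{m}}x_0^{-m_0-1}\mathbf{x}^{-\mathbf{m}}$, and a distinguished vector $\mathbf{1}\in V$, such that $Y(\mathbf{1};x_0,\mathbf{x})v=v$ and $Y(v;x_0,\mathbf{x})\mathbf{1}\in V[[x_0,x_1^{\pm1},\dots,x_r^{\pm1}]]$ for $v\in V$, and for $u,v\in V$ $$z_0^{-1}\delta\Big(\frac{x_0-y_0}{z_0}\Big)Y(u;x_0,\mathbf{z}\mathbf{y})Y(v;y_0,\mathbf{y})-z_0^{-1}\delta\Big(\frac{y_0-x_0}{-z_0}\Big)Y(v;y_0,\mathbf{y})Y(u;x_0,\mathbf{z}\mathbf{y})=y_0^{-1}\delta\Big(\frac{x_0-z_0}{y_0}\Big)Y(Y(u;z_0,\mathbf{z})v;y_0,\mathbf{y}).$$ An automorphism of $V$ is a linear bijection $\sigma$ with $\sigma(\mathbf{1})=\mathbf{1}$ and $\sigma(Y(u;x_0,\mathbf{x})v)=Y(\sigma(u);x_0,\mathbf{x})\sigma(v)$. It has period $N$ if $\sigma^N=1$ ($N$ need not be the order). Twisted module. Let $\sigma$ be an automorphism of $V$ with period $N$. A $\sigma$-twisted $V$-module is a vector space $W$ with a linear map $Y_W(\cdot;x_0,\mathbf{x}):V\to\mathcal{E}(W,r;N)$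 such that $Y_W(\mathbf{1};x_0,\mathbf{x})=1_W$ and for $u,v\in V$ $$z_0^{-1}\delta\Big(\frac{x_0-y_0}{z_0}\Big)Y_W(u;x_0,\mathbf{z}\mathbf{y})Y_W(v;y_0,\mathbf{y})-z_0^{-1}\delta\Big(\frac{y_0-x_0}{-z_0}\Big)Y_W(v;y_0,\mathbf{y})Y_W(u;x_0,\mathbf{z}\mathbf{y})=\frac1N\sum_{j=0}^{N-1}y_0^{-1}\delta\Big(\omega_N^j\Big(\frac{x_0-z_0}{y_0}\Big)^{1/N}\Big)Y_W(Y(\sigma^ju;z_0,\mathbf{z})v;y_0,\mathbf{y}).$$ It is faithful if $Y_W$ is injective. Grading, locality, $Y_{\mathcal{E}}$, closedness. For $j\in\mathbb{Z}$ put $\mathcal{E}(W,r;N)_j=x_0^{-j/N}\mathcal{E}(W,r)$ (depends only on $j$ mod $N$); $\mathcal{E}(W,r;N)=\bigoplus_{j=0}^{N-1}\mathcal{E}(W,r;N)_j$. $\sigma$ is the linear automorphism of $\mathcal{E}(W,r;N)$ acting on $\mathcal{E}(W,r;N)_j$ as the scalar $\omega_N^j$. A subspace is graded if it is the direct sum of its intersections with the $\mathcal{E}(W,r;N)_j$. Elements $a(x_0,\mathbf{x}),b(x_0,\mathbf{x})\in\mathcal{E}(W,r;N)$ are mutually local if $(x_0-y_0)^k[a(x_0,\mathbf{x}),b(y_0,\mathbf{y})]=0$ for some $k\in\mathbb{N}$; a subset $U$ is local if any $a,b\in U$ (including $a=b$) are mutually local. For mutually local $a(x_0,\mathbf{x})\in\mathcal{E}(W,r;N)_j$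 ($0\le j<N$) and $b(x_0,\mathbf{x})\in\mathcal{E}(W,r;N)$, define $a(y_0,\mathbf{y})_{m_0,\mathbf{m}}b(y_0,\mathbf{y})\in\mathcal{E}(W,r;N)$ for $(m_0,\mathbf{m})\in\mathbb{Z}\times\mathbb{Z}^r$ by $$Y_{\mathcal{E}}(a(y_0,\mathbf{y});z_0,\mathbf{z})b(y_0,\mathbf{y})=\sum_{m_0,\mathbf{m}}a(y_0,\mathbf{y})_{m_0,\mathbf{m}}b(y_0,\mathbf{y})z_0^{-m_0-1}\mathbf{z}^{-\mathbf{m}}=\mathrm{Res}_{x_0}\Big(\frac{x_0-z_0}{y_0}\Big)^{j/N}X,$$ $$X=z_0^{-1}\delta\Big(\frac{x_0-y_0}{z_0}\Big)a(x_0,\mathbf{z}\mathbf{y})b(y_0,\mathbf{y})-z_0^{-1}\delta\Big(\frac{y_0-x_0}{-z_0}\Big)b(y_0,\mathbf{y})a(x_0,\mathbf{z}\mathbf{y}).$$ On a graded local subspace this is extended linearly to arbitrary $a$. A graded local subspace $U$ is closed if $1_W\in U$ and $a(x_0,\mathbf{x})_{m_0,\mathbf{m}}b(x_0,\mathbf{x})\in U$ for all $a,b\in U$, $(m_0,\mathbf{m})\in\mathbb{Z}\times\mathbb{Z}^r$. *)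

theory Defs
  imports
    "HOL-Analysis.Analysis"
    "HOL-Library.Function_Algebras"
    "HOL-Library.Product_Plus"
    "HOL-Library.Groups_Big_Fun"
begin

section \<open>Formal series with operator coefficients\<close>

text \<open>
  The integer r is the cardinality of the finite index type 'r, and the group of
  exponents of the multivariable x is int ^ 'r.  A series in fractional powers of
  x0 and in x is given by its coefficients: a q m is the coefficient of
  x0^q x^m, where q is rational.
\<close>

type_synonym ('r, 'w) op_series = "rat \<Rightarrow> int ^ 'r \<Rightarrow> 'w \<Rightarrow> 'w"

text \<open>
  Series in the variables (z0, x0, y0), in this order, and in the multivariables z and y,
  again in this order: F (c, p, q) m l is the coefficient of z0^c x0^p y0^q z^m y^l.
  Series in fewer variables are regarded as series of this kind.
  For locality, m and l are the exponents of x and y instead.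
\<close>

type_synonym ('r, 'w) op_series3 =
  "rat \<times> rat \<times> rat \<Rightarrow> int ^ 'r \<Rightarrow> int ^ 'r \<Rightarrow> 'w \<Rightarrow> 'w"

type_synonym scalar_series3 = "rat \<times> rat \<times> rat \<Rightarrow> complex"

text \<open>
  The Cauchy product of a scalar series in (z0, x0, y0) and an operator valued one.
  It is used only where, after application to a vector w, every coefficient is a finite sum.
\<close>

definition series_mult ::
  "(complex \<Rightarrow> 'w \<Rightarrow> 'w) \<Rightarrow> scalar_series3 \<Rightarrow> ('r, 'w::ab_group_add) op_series3
    \<Rightarrow> ('r, 'w) op_series3" where
  "series_mult s f F = (\<lambda>e m l w. Sum_any (\<lambda>d. s (f d) (F (e - d) m l w)))"

definition op_scale ::
  "(complex \<Rightarrow> 'w \<Rightarrow> 'w) \<Rightarrow> complex \<Rightarrow> ('r, 'w) op_series \<Rightarrow> ('r, 'w) op_series" where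
  "op_scale s c a = (\<lambda>q m w. s c (a q m w))"

definition one_series :: "('r::finite, 'w::zero) op_series" where
  "one_series = (\<lambda>q m w. if q = 0 \<and> m = 0 then w else 0)"

text \<open>
  The coefficient of x^p y^q in (x - y)^alpha, expanded in nonnegative powers of y.  Here
  and in the delta functions, the sum ranges over at most one index: it extracts the
  coefficient of the given monomial from a formal sum.
\<close>

definition binom_exp :: "rat \<Rightarrow> rat \<Rightarrow> rat \<Rightarrow> complex" where
  "binom_exp \<alpha> p q =
    (\<Sum>i::nat | p = \<alpha> - of_nat i \<and> q = of_nat i. (-1) ^ i * (of_rat \<alpha> gchoose i))"

definition omega :: "nat \<Rightarrow> complex" where
  "omega N = exp (2 * of_real pi * \<i> / of_nat N)"

text \<open>z0^(-1) delta((x0 - y0)/z0), the sum over n of z0^(-n-1) (x0 - y0)^n\<close>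

definition delta_xy :: scalar_series3 where
  "delta_xy = (\<lambda>(c, p, q).
    \<Sum>n::int | c = - of_int n - 1. binom_exp (of_int n) p q)"

text \<open>z0^(-1) delta((y0 - x0)/(-z0)), the sum over n of (-1)^n z0^(-n-1) (y0 - x0)^n\<close>

definition delta_yx :: scalar_series3 where
  "delta_yx = (\<lambda>(c, p, q).
    \<Sum>n::int | c = - of_int n - 1. (-1) powi n * binom_exp (of_int n) q p)"

text \<open>y0^(-1) delta((x0 - z0)/y0), the sum over n of y0^(-n-1) (x0 - z0)^n\<close>

definition delta_xz :: scalar_series3 where
  "delta_xz = (\<lambda>(c, p, q).
    \<Sum>n::int | q = - of_int n - 1. binom_exp (of_int n) p c)"

text \<open>
  y0^(-1) delta(omega^j ((x0 - z0)/y0)^(1/N)), the sum over n of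
  omega^(j n) y0^(-n/N-1) (x0 - z0)^(n/N)
\<close>

definition delta_xz_root :: "nat \<Rightarrow> nat \<Rightarrow> scalar_series3" where
  "delta_xz_root N j = (\<lambda>(c, p, q).
    \<Sum>n::int | q = - (of_int n / of_nat N) - 1.
      (omega N ^ j) powi n * binom_exp (of_int n / of_nat N) p c)"

text \<open>((x0 - z0)/y0)^alpha\<close>

definition ratio_power :: "rat \<Rightarrow> scalar_series3" where
  "ratio_power \<alpha> = (\<lambda>(c, p, q). if q = - \<alpha> then binom_exp \<alpha> p c else 0)"

text \<open>(x0 - y0)^k\<close>

definition diff_power :: "nat \<Rightarrow> scalar_series3" where
  "diff_power k = (\<lambda>(c, p, q). if c = 0 then binom_exp (of_nat k) p q else 0)"

text \<open>The commutator of a(x0, x) and b(y0, y).\<close>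

definition commutator_series ::
  "('r, 'w::ab_group_add) op_series \<Rightarrow> ('r, 'w) op_series \<Rightarrow> ('r, 'w) op_series3" where
  "commutator_series a b = (\<lambda>(c, p, q) m l w.
    if c = 0 then a p m (b q l w) - b q l (a p m w) else 0)"

text \<open>
  The products a(x0, zy) b(y0, y) and b(y0, y) a(x0, zy).  Since (zy)^m = z^m y^m, the
  coefficient of z^m y^l pairs the exponent m in a with the exponent l - m in b.
\<close>

definition prod_series ::
  "('r::finite, 'w::ab_group_add) op_series \<Rightarrow> ('r, 'w) op_series \<Rightarrow> ('r, 'w) op_series3" where
  "prod_series a b = (\<lambda>(c, p, q) m l w. if c = 0 then a p m (b q (l - m) w) else 0)"

definition prod_series_op ::
  "('r::finite, 'w::ab_group_add) op_series \<Rightarrow> ('r, 'w) op_series \<Rightarrow> ('r, 'w) op_series3" where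
  "prod_series_op a b = (\<lambda>(c, p, q) m l w. if c = 0 then b q (l - m) (a p m w) else 0)"

text \<open>
  The common left-hand side of the Jacobi identities, which is also the series X in the
  definition of the vertex operator map on fields.
\<close>

definition jacobi_lhs ::
  "(complex \<Rightarrow> 'w \<Rightarrow> 'w) \<Rightarrow> ('r::finite, 'w::ab_group_add) op_series \<Rightarrow> ('r, 'w) op_series
    \<Rightarrow> ('r, 'w) op_series3" where
  "jacobi_lhs s a b = (\<lambda>e m l w.
    series_mult s delta_xy (prod_series a b) e m l w
    - series_mult s delta_yx (prod_series_op a b) e m l w)"

text \<open>
  Y'(Y(u; z0, z) v; y0, y), where Yuv c m is the coefficient of z0^c z^m in Y(u; z0, z) v.
\<close>

definition iterate_series ::
  "('v \<Rightarrow> ('r, 'w::zero) op_series) \<Rightarrow> (rat \<Rightarrow> int ^ 'r \<Rightarrow> 'v) \<Rightarrow> ('r, 'w) op_series3" where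
  "iterate_series Y' Yuv = (\<lambda>(c, p, q) m l w. if p = 0 then Y' (Yuv c m) q l w else 0)"

section \<open>The spaces E(W, r; N)\<close>

definition linear_map_on ::
  "(complex \<Rightarrow> 'a::plus \<Rightarrow> 'a) \<Rightarrow> 'a set \<Rightarrow> (complex \<Rightarrow> 'b::plus \<Rightarrow> 'b) \<Rightarrow> ('a \<Rightarrow> 'b) \<Rightarrow> bool" where
  "linear_map_on s A t f \<longleftrightarrow>
    (\<forall>x\<in>A. \<forall>y\<in>A. f (x + y) = f x + f y) \<and> (\<forall>c. \<forall>x\<in>A. f (s c x) = t c (f x))"

text \<open>
  E(C, r; N) for a subspace C of the ambient type: all coefficients are linear
  endomorphisms of C, the exponents of x0 lie in (1/N)Z, and for each vector w they are
  bounded below uniformly in the exponents of x.  Values outside C are irrelevant.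
\<close>

definition field_space ::
  "(complex \<Rightarrow> 'w \<Rightarrow> 'w) \<Rightarrow> 'w::ab_group_add set \<Rightarrow> nat \<Rightarrow> ('r, 'w) op_series set" where
  "field_space s C N = {a.
    (\<forall>q m. a q m ` C \<subseteq> C \<and> linear_map_on s C s (a q m)) \<and>
    (\<forall>q. of_nat N * q \<notin> \<int> \<longrightarrow> (\<forall>m. \<forall>w\<in>C. a q m w = 0)) \<and>
    (\<forall>w\<in>C. \<exists>K. \<forall>q<K. \<forall>m. a q m w = 0)}"

text \<open>
  x0^(-j/N) E(W, r).  As this depends on j only modulo N, it suffices to consider
  natural numbers j.
\<close>

definition grade ::
  "(complex \<Rightarrow> 'w \<Rightarrow> 'w) \<Rightarrow> nat \<Rightarrow> nat \<Rightarrow> ('r, 'w::ab_group_add) op_series set" where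
  "grade s N j = {(\<lambda>q m. a (q + of_nat j / of_nat N) m) | a. a \<in> field_space s UNIV 1}"

text \<open>The component of a in x0^(-j/N) E(W, r), see the lemmas below.\<close>

definition grade_part :: "nat \<Rightarrow> nat \<Rightarrow> ('r, 'w::zero) op_series \<Rightarrow> ('r, 'w) op_series" where
  "grade_part N j a = (\<lambda>q m w. if q + of_nat j / of_nat N \<in> \<int> then a q m w else 0)"

definition sigma_map ::
  "(complex \<Rightarrow> 'w \<Rightarrow> 'w) \<Rightarrow> nat \<Rightarrow> ('r, 'w::ab_group_add) op_series \<Rightarrow> ('r, 'w) op_series" where
  "sigma_map s N a = (\<Sum>j<N. op_scale s (omega N ^ j) (grade_part N j a))"

definition graded_subspace ::
  "(complex \<Rightarrow> 'w \<Rightarrow> 'w) \<Rightarrow> nat \<Rightarrow> ('r, 'w::ab_group_add) op_series set \<Rightarrow> bool" where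
  "graded_subspace s N U \<longleftrightarrow>
    U \<subseteq> field_space s UNIV N \<and> module.subspace (op_scale s) U \<and>
    (\<forall>a\<in>U. \<exists>!f. f \<in> (\<Pi>\<^sub>E j\<in>{..<N}. U \<inter> grade s N j) \<and> a = (\<Sum>j<N. f j))"

definition mutually_local ::
  "(complex \<Rightarrow> 'w \<Rightarrow> 'w) \<Rightarrow> ('r, 'w::ab_group_add) op_series \<Rightarrow> ('r, 'w) op_series \<Rightarrow> bool" where
  "mutually_local s a b \<longleftrightarrow>
    (\<exists>k::nat. series_mult s (diff_power k) (commutator_series a b) = (\<lambda>e m l w. 0))"

definition local_set ::
  "(complex \<Rightarrow> 'w \<Rightarrow> 'w) \<Rightarrow> ('r, 'w::ab_group_add) op_series set \<Rightarrow> bool" where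
  "local_set s U \<longleftrightarrow> (\<forall>a\<in>U. \<forall>b\<in>U. mutually_local s a b)"

text \<open>
  For a of degree j, the coefficient of z0^c z^m in the residue with respect to x0 of
  ((x0 - z0)/y0)^(j/N) X.  It is a series in y0 and y with exponents t and l.
\<close>

definition Y_E_homogeneous ::
  "(complex \<Rightarrow> 'w \<Rightarrow> 'w) \<Rightarrow> nat \<Rightarrow> nat \<Rightarrow> ('r::finite, 'w::ab_group_add) op_series
    \<Rightarrow> ('r, ('r, 'w) op_series) op_series" where
  "Y_E_homogeneous s N j a = (\<lambda>c m b t l w.
    series_mult s (ratio_power (of_nat j / of_nat N)) (jacobi_lhs s a b) (c, -1, t) m l w)"

definition Y_E ::
  "(complex \<Rightarrow> 'w \<Rightarrow> 'w) \<Rightarrow> nat \<Rightarrow> ('r::finite, 'w::ab_group_add) op_series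
    \<Rightarrow> ('r, ('r, 'w) op_series) op_series" where
  "Y_E s N a = (\<lambda>c m b. \<Sum>j<N. Y_E_homogeneous s N j (grade_part N j a) c m b)"

text \<open>
  The mode with index (m0, m) of a vertex operator map is the coefficient of
  x0^(-m0-1) x^(-m).
\<close>

definition mode ::
  "('v \<Rightarrow> ('r::finite, 'w) op_series) \<Rightarrow> 'v \<Rightarrow> int \<Rightarrow> int ^ 'r \<Rightarrow> 'w \<Rightarrow> 'w" where
  "mode Y v m0 m = Y v (of_int (- m0 - 1)) (- m)"

definition closed_subspace ::
  "(complex \<Rightarrow> 'w \<Rightarrow> 'w) \<Rightarrow> nat \<Rightarrow> ('r::finite, 'w::ab_group_add) op_series set \<Rightarrow> bool" where
  "closed_subspace s N U \<longleftrightarrow>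
    one_series \<in> U \<and> (\<forall>a\<in>U. \<forall>b\<in>U. \<forall>m0 m. mode (Y_E s N) a m0 m b \<in> U)"

section \<open>Toroidal vertex algebras, automorphisms and twisted modules\<close>

text \<open>
  The underlying vector space is a subspace V of an ambient type.  Operators on V are only
  compared on V.
\<close>

locale toroidal_vertex_algebra = vector_space s
  for s :: "complex \<Rightarrow> 'v::ab_group_add \<Rightarrow> 'v" +
  fixes V :: "'v set"
    and Y :: "'v \<Rightarrow> ('r::finite, 'v) op_series"
    and vac :: 'v
  assumes subspace_V: "subspace V"
    and Y_field: "v \<in> V \<Longrightarrow> Y v \<in> field_space s V 1"
    and Y_linear: "w \<in> V \<Longrightarrow> linear_map_on s V s (\<lambda>v. Y v q m w)"
    and vac_in: "vac \<in> V"
    and vacuum: "v \<in> V \<Longrightarrow> Y vac q m v = one_series q m v"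
    and creation: "\<lbrakk>v \<in> V; q < 0\<rbrakk> \<Longrightarrow> Y v q m vac = 0"
    and jacobi: "\<lbrakk>u \<in> V; v \<in> V; w \<in> V\<rbrakk> \<Longrightarrow>
      jacobi_lhs s (Y u) (Y v) e m l w
      = series_mult s delta_xz (iterate_series Y (\<lambda>c m. Y u c m v)) e m l w"

locale tva_automorphism = toroidal_vertex_algebra s V Y vac
  for s :: "complex \<Rightarrow> 'v::ab_group_add \<Rightarrow> 'v"
    and V :: "'v set"
    and Y :: "'v \<Rightarrow> ('r::finite, 'v) op_series"
    and vac :: 'v +
  fixes \<sigma> :: "'v \<Rightarrow> 'v"
  assumes aut_bij: "bij_betw \<sigma> V V"
    and aut_linear: "linear_map_on s V s \<sigma>"
    and aut_vac: "\<sigma> vac = vac"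
    and aut_Y: "\<lbrakk>u \<in> V; v \<in> V\<rbrakk> \<Longrightarrow> \<sigma> (Y u q m v) = Y (\<sigma> u) q m (\<sigma> v)"

definition has_period :: "'v set \<Rightarrow> ('v \<Rightarrow> 'v) \<Rightarrow> nat \<Rightarrow> bool" where
  "has_period V \<sigma> N \<longleftrightarrow> N > 0 \<and> (\<forall>v\<in>V. (\<sigma> ^^ N) v = v)"

locale twisted_module = tva_automorphism s V Y vac \<sigma> + W: vector_space t
  for s :: "complex \<Rightarrow> 'v::ab_group_add \<Rightarrow> 'v"
    and V :: "'v set"
    and Y :: "'v \<Rightarrow> ('r::finite, 'v) op_series"
    and vac :: 'v
    and \<sigma> :: "'v \<Rightarrow> 'v"
    and t :: "complex \<Rightarrow> 'w::ab_group_add \<Rightarrow> 'w" +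
  fixes N :: nat
    and YW :: "'v \<Rightarrow> ('r, 'w) op_series"
  assumes period: "has_period V \<sigma> N"
    and YW_field: "v \<in> V \<Longrightarrow> YW v \<in> field_space t UNIV N"
    and YW_linear: "linear_map_on s V (op_scale t) YW"
    and YW_vac: "YW vac = one_series"
    and twisted_jacobi: "\<lbrakk>u \<in> V; v \<in> V\<rbrakk> \<Longrightarrow>
      jacobi_lhs t (YW u) (YW v) e m l w
      = t (1 / of_nat N) (\<Sum>j<N. series_mult t (delta_xz_root N j)
          (iterate_series YW (\<lambda>c m. Y ((\<sigma> ^^ j) u) c m v)) e m l w)"

locale faithful_twisted_module = twisted_module +
  assumes faithful: "inj_on YW V"

section \<open>The grading\<close>

lemma vector_space_op_scale:
  assumes "vector_space s"
  shows "vector_space (op_scale s)"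
proof -
  interpret vector_space s by fact
  show ?thesis
    by unfold_locales
      (auto simp: op_scale_def fun_eq_iff scale_right_distrib scale_left_distrib)
qed

lemma mem_grade_iff:
  "a \<in> grade s N j \<longleftrightarrow> (\<lambda>q. a (q - of_nat j / of_nat N)) \<in> field_space s UNIV 1"
proof
  assume "a \<in> grade s N j"
  then show "(\<lambda>q. a (q - of_nat j / of_nat N)) \<in> field_space s UNIV 1"
    by (auto simp: grade_def)
next
  assume "(\<lambda>q. a (q - of_nat j / of_nat N)) \<in> field_space s UNIV 1"
  then show "a \<in> grade s N j"
    unfolding grade_def
    by (intro CollectI exI[of _ "\<lambda>q. a (q - of_nat j / of_nat N)"]) simp
qed

lemma grade_part_in_grade:
  assumes "vector_space s" and "a \<in> field_space s UNIV N"
  shows "grade_part N j a \<in> grade s N j"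
proof -
  interpret vector_space s by fact
  have lin: "linear_map_on s UNIV s (a q m)" for q m
    using assms(2) by (auto simp: field_space_def)
  have "\<exists>K. \<forall>q<K. \<forall>m. grade_part N j a (q - of_nat j / of_nat N) m w = 0" for w
  proof -
    have "\<exists>K. \<forall>q<K. \<forall>m. a q m w = 0"
      using assms(2) by (simp add: field_space_def)
    then obtain K where "\<forall>q<K. \<forall>m. a q m w = 0" ..
    then show ?thesis
      by (intro exI[of _ "K + of_nat j / of_nat N"]) (auto simp: grade_part_def)
  qed
  then show ?thesis
    using lin
    by (auto simp: mem_grade_iff field_space_def linear_map_on_def grade_part_def)
qed

lemma sum_grade_part:
  fixes a :: "('a, 'b::ab_group_add) op_series"
  assumes "N > 0" and "a \<in> field_space s UNIV N"
  shows "(\<Sum>j<N. grade_part N j a) = a"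
proof (intro ext)
  fix q m w
  have "(\<Sum>j\<in>J. f j) q m w = (\<Sum>j\<in>J. f j q m w)"
    if "finite J" for J and f :: "nat \<Rightarrow> ('a, 'b) op_series"
    using that by (induction J rule: finite_induct) auto
  then have "(\<Sum>j<N. grade_part N j a) q m w = (\<Sum>j<N. grade_part N j a q m w)"
    by simp
  also have "\<dots> = a q m w"
  proof (cases "of_nat N * q \<in> \<int>")
    case False
    then have "a q m w = 0"
      using assms(2) by (auto simp: field_space_def)
    then show ?thesis
      by (simp add: grade_part_def cong: if_cong)
  next
    case True
    then obtain n where n: "of_nat N * q = of_int n"
      by (elim Ints_cases)
    define j0 where "j0 = nat ((- n) mod int N)"
    have j0: "j0 < N" "int j0 = (- n) mod int N"
      using assms(1) by (auto simp: j0_def nat_less_iff)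
    have "q + of_nat j / of_nat N \<in> \<int> \<longleftrightarrow> j = j0" if "j < N" for j
    proof -
      have eq: "q + of_nat j / of_nat N = of_int (n + int j) / of_nat N"
        using assms(1) n by (simp add: field_simps)
      have "q + of_nat j / of_nat N \<in> \<int> \<longleftrightarrow> int N dvd n + int j"
      proof
        assume "q + of_nat j / of_nat N \<in> \<int>"
        then obtain k where "q + of_nat j / of_nat N = of_int k"
          by (elim Ints_cases)
        then have "(of_int (n + int j) :: rat) = of_int (k * int N)"
          using assms(1) eq by (simp add: field_simps)
        then have "n + int j = k * int N"
          by (simp only: of_int_eq_iff)
        then show "int N dvd n + int j"
          by simp
      next
        assume "int N dvd n + int j"
        then obtain k where "n + int j = int N * k" ..
        then have "q + of_nat j / of_nat N = of_int k"
          using assms(1) unfolding eq by simp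
        then show "q + of_nat j / of_nat N \<in> \<int>"
          by simp
      qed
      also have "\<dots> \<longleftrightarrow> int j mod int N = (- n) mod int N"
        by (simp add: mod_eq_dvd_iff add.commute)
      also have "\<dots> \<longleftrightarrow> j = j0"
        using that j0 by auto
      finally show ?thesis .
    qed
    then have "(\<Sum>j<N. grade_part N j a q m w) = (\<Sum>j<N. if j = j0 then a q m w else 0)"
      by (intro sum.cong) (auto simp: grade_part_def)
    then show ?thesis
      using j0(1) by simp
  qed
  finally show "(\<Sum>j<N. grade_part N j a) q m w = a q m w" .
qed

lemma grade_part_grade:
  assumes "N > 0" and "i < N" and "j < N" and "a \<in> grade s N i"
  shows "grade_part N j a = (if i = j then a else (\<lambda>q m w. 0))"
proof -
  have zero: "a q m w = 0" if "q + of_nat i / of_nat N \<notin> \<int>" for q m w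
  proof -
    have "(\<lambda>q. a (q - of_nat i / of_nat N)) \<in> field_space s UNIV 1"
      using assms(4) by (simp add: mem_grade_iff)
    then have "\<forall>q. q \<notin> \<int> \<longrightarrow> (\<forall>m w. a (q - of_nat i / of_nat N) m w = 0)"
      by (simp add: field_space_def)
    from this[rule_format, OF that] show ?thesis
      by simp
  qed
  have "i = j" if "q + of_nat i / of_nat N \<in> \<int>" "q + of_nat j / of_nat N \<in> \<int>" for q :: rat
  proof -
    have "(q + of_nat i / of_nat N) - (q + of_nat j / of_nat N) \<in> \<int>"
      using that by (rule Ints_diff)
    then obtain k where "(q + of_nat i / of_nat N) - (q + of_nat j / of_nat N) = of_int k"
      by (elim Ints_cases)
    then have "(of_nat i - of_nat j) / of_nat N = (of_int k :: rat)"
      by (simp add: diff_divide_distrib)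
    then have "(of_nat i - of_nat j :: rat) = of_int k * of_nat N"
      using assms(1) by (simp add: divide_eq_eq)
    then have "(of_int (int i - int j) :: rat) = of_int (k * int N)"
      by simp
    then have "int i - int j = k * int N"
      by (simp only: of_int_eq_iff)
    then have "int i mod int N = int j mod int N"
      by (simp add: mod_eq_dvd_iff)
    then show "i = j"
      using assms(2,3) by simp
  qed
  then show ?thesis
    using zero by (auto simp: grade_part_def fun_eq_iff)
qed

lemma sigma_map_grade:
  assumes "vector_space s" and "N > 0" and "j < N" and "a \<in> grade s N j"
  shows "sigma_map s N a = op_scale s (omega N ^ j) a"
proof -
  interpret op: vector_space "op_scale s"
    by (rule vector_space_op_scale) fact
  have "sigma_map s N a = (\<Sum>i<N. if i = j then op_scale s (omega N ^ j) a else 0)"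
    unfolding sigma_map_def
  proof (intro sum.cong refl)
    fix i assume "i \<in> {..<N}"
    then have "grade_part N i a = (if j = i then a else 0)"
      using grade_part_grade[OF assms(2,3) _ assms(4), of i]
      by (auto simp: zero_fun_def)
    then show "op_scale s (omega N ^ i) (grade_part N i a)
        = (if i = j then op_scale s (omega N ^ j) a else 0)"
      by simp
  qed
  then show ?thesis
    using assms(3) by simp
qed

end

theory Submission
  imports Defs
begin

text \<open>
  The toroidal exponents only label fields: the modes of the products of a and b involve one
  component of each at a time, so everything reduces to fields in one variable.  For three mutually
  local fields A(x), B(y), C(t) with integral exponents and f = (x - t)^p (y - t)^q (x - y)^n,
  the operator identity [[A, B], C] = [A, [B, C]] - [B, [A, C]] holds after multiplication by f
  and taking residues in x and y, with f expanded in each product according to the order of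
  the operators.  Its three terms are the three terms of the Jacobi identity: they satisfy the
  same recursions in (p, q, n), coming from x - t = (y - t) + (x - y), agree when one exponent is 0,
  and vanish by locality when another exponent is large, which determines them.

  For A of degree j the untwisted products of x^(j/N) A(x), multiplied by
  (1 + z/y)^(-j/N) y^(-j/N), are the twisted ones, and binomial identities carry over the Jacobi
  identity.  In the twisted module identity the sum over the powers of the automorphism is a sum
  over roots of unity, which selects the exponents occurring in a homogeneous field.
\<close>

section \<open>Binomial sums\<close>

text \<open>The operator orders in a double commutator expand the same negative power of a
  difference in different regions, so such a factor can neither be cancelled nor moved between
  terms. Only linear factors move freely, and this is exactly what the recursions use. The
  right-nested commutator vanishes for large q, where B and C commute, and is determined by its
  values at n = 0, the iterated products \<open>nprod p A (nprod q B C)\<close>; the left-nested one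
  vanishes for large n, where A and B commute, and is determined by its values at p = 0, the
  products \<open>nprod q (nprod n A B) C\<close>. Solving the recursions gives the binomial sums of
  the Jacobi identity.

  A second obstacle is that degrees are reduced modulo N: the exponent \<delta> attached to a
  product differs from \<alpha> + \<beta> by an integer. The discrepancy is an integral power of the
  variable, which is expanded around t; locality of \<open>nprod n A B\<close> with C keeps this
  expansion finite.

  Sums are taken by \<open>Sum_any\<close>, which is 0 on infinite support, so interchanging them
  requires finiteness conditions.\<close>

lemma finite2_bound:
  assumes "finite {(i::nat, j::nat). G i j \<noteq> 0}"
  obtains M where "\<And>i j. M \<le> i \<Longrightarrow> G i j = 0" "\<And>i j. M \<le> j \<Longrightarrow> G i j = 0"
proof -
  let ?A = "{(i, j). G i j \<noteq> 0}"
  have "finite (fst ` ?A \<union> snd ` ?A)"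
    using assms by simp
  then obtain M where M: "\<And>x. x \<in> fst ` ?A \<union> snd ` ?A \<Longrightarrow> x < M"
    by (meson finite_nat_set_iff_bounded)
  show ?thesis
  proof (rule that[of M])
    fix i j
    show "G i j = 0" if "M \<le> i"
      using M[of i] that by force
    show "G i j = 0" if "M \<le> j"
      using M[of j] that by force
  qed
qed

lemma finite1_bound:
  assumes "finite {i::nat. G i \<noteq> 0}"
  obtains M where "\<And>i. M \<le> i \<Longrightarrow> G i = 0"
  using assms by (metis (mono_tags, lifting) finite_nat_set_iff_bounded mem_Collect_eq not_less)

lemma finite_support_bound:
  assumes "\<And>i::nat. M \<le> i \<Longrightarrow> G i = 0"
  shows "finite {i. G i \<noteq> 0}"
  by (rule finite_subset[of _ "{..<M}"]) (use assms not_le in auto)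

lemma finite2_row:
  assumes "finite {(i::nat, j::nat). G i j \<noteq> 0}"
  shows "finite {j. G i j \<noteq> 0}"
  by (metis (no_types) assms finite2_bound finite_support_bound)

lemma finite2_flip:
  assumes "finite {(i, j). G i j \<noteq> 0}"
  shows "finite {(j, i). G i j \<noteq> 0}"
proof -
  have "{(j, i). G i j \<noteq> 0} = prod.swap ` {(i, j). G i j \<noteq> 0}"
    by force
  then show ?thesis
    using assms by simp
qed

lemma finite2_bounded_rows:
  assumes "\<And>i j. M \<le> i \<Longrightarrow> G i j = 0" and "\<And>i. finite {j::nat. G i j \<noteq> 0}"
  shows "finite {(i::nat, j). G i j \<noteq> 0}"
proof -
  have "{(i, j). G i j \<noteq> 0} \<subseteq> Sigma {..<M} (\<lambda>i. {j. G i j \<noteq> 0})"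
    using assms(1) not_le by blast
  then show ?thesis
    by (rule finite_subset) (use assms(2) in auto)
qed

lemma finite_shift:
  assumes "finite {i::nat. G i \<noteq> 0}"
  shows "finite {i. G (Suc i) \<noteq> 0}"
  using finite_vimageI[OF assms, of Suc] by (simp add: vimage_def)

text \<open>The coefficient of T^m in (1 - T/(1 + T))^a = (1 + T)^(-a).\<close>

lemma gbinomial_neg_sum:
  fixes a :: "'a::field_char_0"
  shows "(\<Sum>i\<le>m. (-1) ^ i * (a gchoose i) * (- of_nat i gchoose (m - i))) = (- a gchoose m)"
proof -
  have "(-1) ^ i * (a gchoose i) * (- of_nat i gchoose (m - i))
      = (-1) ^ m * ((a gchoose i) * ((of_nat m - 1) gchoose (m - i)))" if "i \<le> m" for i
    using that by (simp add: gbinomial_minus of_nat_diff power_add[symmetric])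
  then have "(\<Sum>i\<le>m. (-1) ^ i * (a gchoose i) * (- of_nat i gchoose (m - i)))
      = (-1) ^ m * (\<Sum>i\<le>m. (a gchoose i) * ((of_nat m - 1) gchoose (m - i)))"
    unfolding sum_distrib_left by (intro sum.cong refl) simp
  also have "\<dots> = (-1) ^ m * ((a + of_nat m - 1) gchoose m)"
    using gbinomial_Vandermonde[of a "of_nat m - 1" m] by (simp add: atLeast0AtMost algebra_simps)
  finally show ?thesis
    by (simp add: gbinomial_minus)
qed

locale complex_space = vector_space s
  for s :: "complex \<Rightarrow> 'w::ab_group_add \<Rightarrow> 'w"
begin

text \<open>With T the index shift, this is (1 + T)^a G evaluated at 0; the main lemmas on
  \<open>bsum\<close> are identities between power series in T. The exponent is complex because the
  twisted products involve fractional powers.\<close>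

definition bsum :: "complex \<Rightarrow> (nat \<Rightarrow> 'w) \<Rightarrow> 'w" where
  "bsum a G = Sum_any (\<lambda>i. s (a gchoose i) (G i))"

text \<open>The sign (-1)^n as a parity test, so that sign computations become case distinctions
  without scalars.\<close>

definition alt :: "int \<Rightarrow> 'w \<Rightarrow> 'w" where
  "alt n x = (if even n then x else - x)"

lemma alt_scale: "alt n x = s ((-1) powi n) x"
  by (simp add: alt_def power_int_minus_left)

lemma alt_0 [simp]: "alt n 0 = 0" "alt 0 x = x"
  by (simp_all add: alt_def)

lemma alt_alt: "alt m (alt n x) = alt (m + n) x"
  by (simp add: alt_def)

lemma alt_same [simp]: "alt n (alt n x) = x"
  by (simp add: alt_def)

lemma alt_eq_0_iff [simp]: "alt n x = 0 \<longleftrightarrow> x = 0"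
  by (simp add: alt_def)

lemma alt_add: "alt n (x + y) = alt n x + alt n y"
  and alt_diff: "alt n (x - y) = alt n x - alt n y"
  and alt_minus: "alt n (- x) = - alt n x"
  by (simp_all add: alt_def)

lemma alt_add1: "alt (n + 1) x = - alt n x" "alt (1 + n) x = - alt n x" "alt (n - 1) x = - alt n x"
  by (simp_all add: alt_def)

lemma alt_scale_commute: "alt n (s c x) = s c (alt n x)"
  by (simp add: alt_def)

lemma bsum_cong: "(\<And>i. G i = H i) \<Longrightarrow> bsum a G = bsum a H"
  by (simp add: bsum_def)

lemma bsum_eq_sum:
  assumes "\<And>i. M \<le> i \<Longrightarrow> G i = 0"
  shows "bsum a G = (\<Sum>i<M. s (a gchoose i) (G i))"
  unfolding bsum_def
  by (rule Sum_any.expand_superset) (use assms not_le in \<open>auto simp: not_less[symmetric]\<close>)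

lemma bsum_zero [simp]: "bsum a (\<lambda>i. 0) = 0"
  by (simp add: bsum_def)

lemma bsum_0 [simp]: "bsum 0 G = G 0"
proof -
  have "bsum 0 G = Sum_any (\<lambda>i. if i = 0 then G i else 0)"
    unfolding bsum_def by (rule Sum_any.cong) (simp add: gbinomial_0_left)
  then show ?thesis
    by (simp only: Sum_any.delta)
qed

lemma bsum_of_nat: "bsum (of_nat n) G = (\<Sum>i\<le>n. s (of_nat (n choose i)) (G i))"
  unfolding bsum_def
  by (subst Sum_any.expand_superset[of "{..n}"])
    (auto simp: binomial_gbinomial[symmetric] intro: ccontr[of "_ \<le> n"] simp: binomial_eq_0)

lemma bsum_nonneg:
  assumes "0 \<le> n"
  shows "bsum (of_int n) G = (\<Sum>i\<le>nat n. s (of_nat (nat n choose i)) (G i))"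
  using bsum_of_nat[of "nat n" G] assms by simp

lemma bsum_scale: 
  assumes "finite {i. G i \<noteq> 0}"
  shows "s c (bsum a G) = bsum a (\<lambda>i. s c (G i))"
proof -
  obtain M where M: "\<And>i. M \<le> i \<Longrightarrow> G i = 0" using finite1_bound[OF assms] by metis
  show ?thesis
    by (simp add: bsum_eq_sum[of M] M scale_sum_right mult.commute)
qed

lemma bsum_map:
  assumes "finite {i. G i \<noteq> 0}" and "\<And>x y. f (x + y) = f x + f y" and "\<And>c x. f (s c x) = s c (f x)"
  shows "f (bsum a G) = bsum a (\<lambda>i. f (G i))"
proof -
  obtain M where M: "\<And>i. M \<le> i \<Longrightarrow> G i = 0" using finite1_bound[OF assms(1)] by metis
  have f0: "f 0 = 0"
    using assms(2)[of 0 0] by simp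
  have "f (\<Sum>i<M. g i) = (\<Sum>i<M. f (g i))" for g
    by (induction M) (simp_all add: f0 assms(2))
  then show ?thesis
    by (simp add: bsum_eq_sum[of M] M f0 assms(3))
qed

lemma bsum_add:
  assumes "finite {i. G i \<noteq> 0}" and "finite {i. H i \<noteq> 0}"
  shows "bsum a (\<lambda>i. G i + H i) = bsum a G + bsum a H"
proof -
  obtain M where M: "\<And>i. M \<le> i \<Longrightarrow> G i = 0" using finite1_bound[OF assms(1)] by metis
  obtain K where K: "\<And>i. K \<le> i \<Longrightarrow> H i = 0" using finite1_bound[OF assms(2)] by metis
  show ?thesis
    by (simp add: bsum_eq_sum[of "max M K"] M K sum.distrib scale_right_distrib)
qed

lemma bsum_minus: "bsum a (\<lambda>i. - G i) = - bsum a G"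
proof (cases "finite {i. s (a gchoose i) (G i) \<noteq> 0}")
  case True
  obtain M where M: "\<And>i. M \<le> i \<Longrightarrow> s (a gchoose i) (G i) = 0" using finite1_bound[OF True] by metis
  have "{i. s (a gchoose i) (G i) \<noteq> 0} \<subseteq> {..<M}"
    using M not_le by auto
  then show ?thesis
    unfolding bsum_def by (simp add: Sum_any.expand_superset[of "{..<M}"] sum_negf)
next
  case False
  then show ?thesis
    unfolding bsum_def by simp
qed

lemma bsum_diff:
  assumes "finite {i. G i \<noteq> 0}" and "finite {i. H i \<noteq> 0}"
  shows "bsum a (\<lambda>i. G i - H i) = bsum a G - bsum a H"
  using bsum_add[of G "\<lambda>i. - H i"] assms by (simp add: bsum_minus)

lemma bsum_alt: "bsum a (\<lambda>i. alt n (G i)) = alt n (bsum a G)"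
  by (simp add: alt_def bsum_minus)

text \<open>(1 + T)^(a + 1) = (1 + T)^a (1 + T).\<close>

lemma bsum_pascal:
  assumes "finite {i. G i \<noteq> 0}"
  shows "bsum (a + 1) G = bsum a (\<lambda>i. G i + G (Suc i))"
proof -
  obtain M where M: "\<And>i. M \<le> i \<Longrightarrow> G i = 0" using finite1_bound[OF assms] by metis
  have "bsum (a + 1) G = (\<Sum>i<Suc M. s (a + 1 gchoose i) (G i))"
    by (rule bsum_eq_sum) (simp add: M)
  also have "\<dots> = G 0 + (\<Sum>i<M. s (a gchoose i) (G (Suc i)) + s (a gchoose Suc i) (G (Suc i)))"
    by (simp only: sum.lessThan_Suc_shift gbinomial_Suc_Suc) (simp add: scale_left_distrib)
  also have "\<dots> = (\<Sum>i<M. s (a gchoose i) (G (Suc i))) + (\<Sum>i<Suc M. s (a gchoose i) (G i))"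
    by (simp only: sum.lessThan_Suc_shift sum.distrib) (simp add: algebra_simps)
  also have "\<dots> = bsum a (\<lambda>i. G (Suc i)) + bsum a G"
    by (subst (1 2) bsum_eq_sum[of M]) (auto simp: M)
  finally show ?thesis
    by (simp add: bsum_add assms finite_shift add.commute)
qed

lemma bsum_swap:
  assumes "finite {(i, j). G i j \<noteq> 0}"
  shows "bsum a (\<lambda>i. bsum b (G i)) = bsum b (\<lambda>j. bsum a (\<lambda>i. G i j))"
proof -
  obtain M where M: "\<And>i j. M \<le> i \<Longrightarrow> G i j = 0" "\<And>i j. M \<le> j \<Longrightarrow> G i j = 0"
    using finite2_bound[OF assms] by metis
  have "(\<Sum>i<M. \<Sum>j<M. s (a gchoose i) (s (b gchoose j) (G i j)))
      = (\<Sum>j<M. \<Sum>i<M. s (b gchoose j) (s (a gchoose i) (G i j)))"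
    by (subst sum.swap) (simp add: mult.commute)
  then show ?thesis
    by (simp add: bsum_eq_sum[of M] M scale_sum_right)
qed

text \<open>(1 + T)^a (1 + T)^b = (1 + T)^(a + b). The sequence depends on m + l only, so the square
  of summation is cut down to a triangle and resummed along the antidiagonals.\<close>

lemma bsum_vandermonde:
  assumes "finite {j. Q j \<noteq> 0}"
  shows "bsum a (\<lambda>m. bsum b (\<lambda>l. Q (m + l))) = bsum (a + b) Q"
proof -
  obtain M where M: "\<And>i. M \<le> i \<Longrightarrow> Q i = 0" using finite1_bound[OF assms] by metis
  let ?g = "\<lambda>m l. s ((a gchoose m) * (b gchoose l)) (Q (m + l))"
  have "bsum a (\<lambda>m. bsum b (\<lambda>l. Q (m + l))) = (\<Sum>m<M. \<Sum>l<M. ?g m l)"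
    by (simp add: bsum_eq_sum[of M] M scale_sum_right)
  also have "\<dots> = (\<Sum>(m, l)\<in>{..<M} \<times> {..<M}. ?g m l)"
    by (simp add: sum.cartesian_product)
  also have "\<dots> = (\<Sum>(m, l)\<in>{(m, l). m + l < M}. ?g m l)"
    by (rule sum.mono_neutral_right) (auto, metis M not_le)
  also have "\<dots> = (\<Sum>k<M. \<Sum>i\<le>k. ?g i (k - i))"
    by (rule sum.triangle_reindex)
  also have "\<dots> = (\<Sum>k<M. s (\<Sum>i\<le>k. (a gchoose i) * (b gchoose (k - i))) (Q k))"
    by (intro sum.cong refl) (simp add: scale_sum_left)
  also have "\<dots> = bsum (a + b) Q"
    by (simp add: bsum_eq_sum[of M] M gbinomial_Vandermonde atLeast0AtMost[symmetric])
  finally show ?thesis .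
qed

text \<open>With S and T the shifts of the two indices, both sides expand (1 + S + T)^a: in powers
  of S + T on the left, in powers of S with coefficients (1 + T)^(a - e) on the right.
  Coefficientwise this is trinomial revision.\<close>

lemma bsum_trinomial:
  assumes "finite {(i, j). Q i j \<noteq> 0}"
  shows "bsum a (\<lambda>m. bsum (of_nat m) (\<lambda>i. Q i (m - i)))
    = bsum a (\<lambda>e. bsum (a - of_nat e) (Q e))"
proof -
  obtain M where M: "\<And>i j. M \<le> i \<Longrightarrow> Q i j = 0" "\<And>i j. M \<le> j \<Longrightarrow> Q i j = 0"
    using finite2_bound[OF assms] by metis
  let ?g = "\<lambda>m i. s ((a gchoose m) * (of_nat m gchoose i)) (Q i (m - i))"
  let ?h = "\<lambda>e j. s ((a gchoose e) * (a - of_nat e gchoose j)) (Q e j)"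
  have "Q i (m - i) = 0" if "2 * M \<le> m" for m i
    using that by (cases "M \<le> i") (auto simp: M)
  then have "bsum a (\<lambda>m. bsum (of_nat m) (\<lambda>i. Q i (m - i))) = (\<Sum>m<2*M. \<Sum>i\<le>m. ?g m i)"
    by (simp add: bsum_eq_sum[of "2 * M"] bsum_of_nat scale_sum_right binomial_gbinomial)
  also have "\<dots> = (\<Sum>m<2*M. \<Sum>i\<le>m. ?h i (m - i))"
    by (intro sum.cong refl) (simp add: gbinomial_trinomial_revision)
  also have "\<dots> = (\<Sum>(e, j)\<in>{(e, j). e + j < 2 * M}. ?h e j)"
    by (rule sum.triangle_reindex[symmetric])
  also have "\<dots> = (\<Sum>(e, j)\<in>{..<M} \<times> {..<M}. ?h e j)"
  proof (rule sum.mono_neutral_right)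
    have "{(e, j). e + j < 2 * M} \<subseteq> {..<2*M} \<times> {..<2*M}"
      by auto
    then show "finite {(e, j). e + j < 2 * M}"
      by (rule finite_subset) auto
  qed (auto, (metis M not_le)+)
  also have "\<dots> = bsum a (\<lambda>e. bsum (a - of_nat e) (Q e))"
    by (simp add: bsum_eq_sum[of M] M scale_sum_right sum.cartesian_product)
  finally show ?thesis .
qed

text \<open>(1 - T (1 + T)^(-1))^a = (1 + T)^(-a).\<close>

lemma bsum_neg:
  assumes "finite {j. Q j \<noteq> 0}"
  shows "bsum a (\<lambda>i. alt (int i) (bsum (- of_nat i) (\<lambda>j. Q (i + j)))) = bsum (- a) Q"
proof -
  obtain M where M: "\<And>i. M \<le> i \<Longrightarrow> Q i = 0" using finite1_bound[OF assms] by metis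
  let ?g = "\<lambda>m l. s ((-1) ^ m * (a gchoose m) * (- of_nat m gchoose l)) (Q (m + l))"
  have "bsum a (\<lambda>i. alt (int i) (bsum (- of_nat i) (\<lambda>j. Q (i + j)))) = (\<Sum>m<M. \<Sum>l<M. ?g m l)"
    by (simp add: bsum_eq_sum[of M] M scale_sum_right alt_scale mult_ac)
  also have "\<dots> = (\<Sum>(m, l)\<in>{..<M} \<times> {..<M}. ?g m l)"
    by (simp add: sum.cartesian_product)
  also have "\<dots> = (\<Sum>(m, l)\<in>{(m, l). m + l < M}. ?g m l)"
    by (rule sum.mono_neutral_right) (auto, metis M not_le)
  also have "\<dots> = (\<Sum>k<M. \<Sum>i\<le>k. ?g i (k - i))"
    by (rule sum.triangle_reindex)
  also have "\<dots> = (\<Sum>k<M. s (\<Sum>i\<le>k. (-1) ^ i * (a gchoose i) * (- of_nat i gchoose (k - i))) (Q k))"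
    by (intro sum.cong refl) (simp add: scale_sum_left)
  also have "\<dots> = bsum (- a) Q"
    by (simp add: bsum_eq_sum[of M] M gbinomial_neg_sum)
  finally show ?thesis .
qed


text \<open>
  For a two variable series S, the coefficient of x^a y^b in (x - y)^n S is
  dsum n (\<lambda>i. S (a - n + i) (b - i)).
\<close>

definition dsum :: "int \<Rightarrow> (nat \<Rightarrow> 'w) \<Rightarrow> 'w" where
  "dsum n G = bsum (of_int n) (\<lambda>i. alt (int i) (G i))"

lemma dsum_cong: "(\<And>i. G i = H i) \<Longrightarrow> dsum n G = dsum n H"
  by (simp add: dsum_def)

lemma dsum_zero [simp]: "dsum n (\<lambda>i. 0) = 0"
  by (simp add: dsum_def)

lemma dsum_0 [simp]: "dsum 0 G = G 0"
  by (simp add: dsum_def)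

lemma dsum_nonzero: "dsum n G \<noteq> 0 \<Longrightarrow> \<exists>i. G i \<noteq> 0"
  using dsum_zero[of n] by (metis dsum_cong)

lemma dsum_add:
  assumes "finite {i. G i \<noteq> 0}" and "finite {i. H i \<noteq> 0}"
  shows "dsum n (\<lambda>i. G i + H i) = dsum n G + dsum n H"
  using assms by (simp add: dsum_def alt_add bsum_add)

lemma dsum_minus: "dsum n (\<lambda>i. - G i) = - dsum n G"
  by (simp add: dsum_def alt_minus bsum_minus)

lemma dsum_diff:
  assumes "finite {i. G i \<noteq> 0}" and "finite {i. H i \<noteq> 0}"
  shows "dsum n (\<lambda>i. G i - H i) = dsum n G - dsum n H"
  using assms by (simp add: dsum_def alt_diff bsum_diff)

lemma dsum_alt: "dsum n (\<lambda>i. alt m (G i)) = alt m (dsum n G)"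
  by (simp add: alt_def dsum_minus)

lemma dsum_scale:
  assumes "finite {i. G i \<noteq> 0}"
  shows "dsum n (\<lambda>i. s c (G i)) = s c (dsum n G)"
  using assms by (simp add: dsum_def bsum_scale alt_scale_commute)

lemma dsum_pascal:
  assumes "finite {i. G i \<noteq> 0}"
  shows "dsum (n + 1) G = dsum n (\<lambda>i. G i - G (Suc i))"
  using bsum_pascal[of "\<lambda>i. alt (int i) (G i)" "of_int n"] assms
  by (simp add: dsum_def alt_add1 alt_diff)

lemma dsum_swap:
  assumes "finite {(i, j). G i j \<noteq> 0}"
  shows "dsum m (\<lambda>i. dsum n (G i)) = dsum n (\<lambda>j. dsum m (\<lambda>i. G i j))"
proof -
  have "finite {(i, j). alt (int i) (alt (int j) (G i j)) \<noteq> 0}"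
    using assms by simp
  from bsum_swap[OF this, of "of_int m" "of_int n"] show ?thesis
    by (simp add: dsum_def bsum_alt[symmetric] alt_alt add.commute)
qed

lemma dsum_bsum_swap:
  assumes "finite {(i, j). G i j \<noteq> 0}"
  shows "dsum m (\<lambda>i. bsum b (G i)) = bsum b (\<lambda>j. dsum m (\<lambda>i. G i j))"
proof -
  have "finite {(i, j). alt (int i) (G i j) \<noteq> 0}"
    using assms by simp
  from bsum_swap[OF this, of "of_int m" b] show ?thesis
    by (simp add: dsum_def bsum_alt)
qed

lemma finite_dsum_rows:
  assumes "finite {(i, j). G i j \<noteq> 0}"
  shows "finite {i. dsum n (G i) \<noteq> 0}"
proof (rule finite_subset)
  show "{i. dsum n (G i) \<noteq> 0} \<subseteq> fst ` {(i, j). G i j \<noteq> 0}"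
    using dsum_nonzero by force
qed (use assms in simp)

lemma finite_bsum_rows:
  assumes "finite {(i, j). G i j \<noteq> 0}"
  shows "finite {i. bsum (n i) (G i) \<noteq> 0}"
proof (rule finite_subset)
  have "\<exists>j. G i j \<noteq> 0" if "bsum (n i) (G i) \<noteq> 0" for i
    using that bsum_zero by (metis bsum_cong)
  then show "{i. bsum (n i) (G i) \<noteq> 0} \<subseteq> fst ` {(i, j). G i j \<noteq> 0}"
    by force
qed (use assms in simp)

section \<open>Residues of triple products\<close>

text \<open>
  In the region |x1| > |x2| > |x3|, res3 S l p q is the residue in all three variables of
  (x1 - x2)^l (x1 - x3)^p (x2 - x3)^q S(x1, x2, x3); tame S makes all sums involved finite.
\<close>

definition tame :: "(rat \<Rightarrow> rat \<Rightarrow> rat \<Rightarrow> 'w) \<Rightarrow> bool" where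
  "tame S \<longleftrightarrow> (\<forall>a b c. finite {(i, j, k).
    S (a + of_nat i + of_nat j) (b - of_nat i + of_nat k) (c - of_nat j - of_nat k) \<noteq> 0})"

definition res3 :: "(rat \<Rightarrow> rat \<Rightarrow> rat \<Rightarrow> 'w) \<Rightarrow> int \<Rightarrow> int \<Rightarrow> int \<Rightarrow> 'w" where
  "res3 S l p q = dsum l (\<lambda>i. dsum p (\<lambda>j. dsum q (\<lambda>k.
    S (-1 - of_int l - of_int p + of_nat i + of_nat j)
      (-1 - of_int q - of_nat i + of_nat k) (-1 - of_nat j - of_nat k))))"

lemma tame_finite:
  assumes "tame S"
  shows "finite {(i, j, k). S (a + of_nat i + of_nat j) (b - of_nat i + of_nat k)
    (c - of_nat j - of_nat k) \<noteq> 0}"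
  using assms by (simp add: tame_def)

lemma tame_finite2:
  assumes "tame S"
  shows "finite {(j, k). S (a + of_nat j) (b + of_nat k) (c - of_nat j - of_nat k) \<noteq> 0}"
    and "finite {(i, k). S (a + of_nat i) (b - of_nat i + of_nat k) (c - of_nat k) \<noteq> 0}"
    and "finite {(i, j). S (a + of_nat i + of_nat j) (b - of_nat i) (c - of_nat j) \<noteq> 0}"
  using finite_vimageI[OF tame_finite[OF assms, of a b c], of "\<lambda>(j, k). (0, j, k)"]
    finite_vimageI[OF tame_finite[OF assms, of a b c], of "\<lambda>(i, k). (i, 0, k)"]
    finite_vimageI[OF tame_finite[OF assms, of a b c], of "\<lambda>(i, j). (i, j, 0)"]
  by (simp_all add: inj_on_def vimage_def split_def)

lemma finite3_rows:
  assumes "finite {(i, j, k). H i j k \<noteq> 0}"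
  shows "finite {(i, j). dsum q (H i j) \<noteq> 0}"
proof (rule finite_subset)
  show "{(i, j). dsum q (H i j) \<noteq> 0} \<subseteq> (\<lambda>(i, j, k). (i, j)) ` {(i, j, k). H i j k \<noteq> 0}"
    using dsum_nonzero by force
qed (use assms in simp)

lemma finite3_slice:
  assumes "finite {(i, j, k). H i j k \<noteq> 0}"
  shows "finite {(j, k). H i j k \<noteq> 0}"
  using finite_vimageI[OF assms, of "\<lambda>(j, k). (i, j, k)"]
  by (simp add: inj_on_def vimage_def split_def)

lemma finite3_last:
  assumes "finite {(i, j, k). H i j k \<noteq> 0}"
  shows "finite {k. H i j k \<noteq> 0}"
  using finite_vimageI[OF assms, of "\<lambda>k. (i, j, k)"]
  by (simp add: inj_on_def vimage_def split_def)

lemma dsum3_swap12: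
  assumes "finite {(i, j, k). H i j k \<noteq> 0}"
  shows "dsum l (\<lambda>i. dsum p (\<lambda>j. dsum q (H i j))) = dsum p (\<lambda>j. dsum l (\<lambda>i. dsum q (H i j)))"
  by (rule dsum_swap) (rule finite3_rows[OF assms])

lemma dsum3_swap23:
  assumes "finite {(i, j, k). H i j k \<noteq> 0}"
  shows "dsum l (\<lambda>i. dsum p (\<lambda>j. dsum q (H i j)))
    = dsum l (\<lambda>i. dsum q (\<lambda>k. dsum p (\<lambda>j. H i j k)))"
  by (rule dsum_cong, rule dsum_swap) (rule finite3_slice[OF assms])

lemma finite3_swap23:
  assumes "finite {(i, j, k). H i j k \<noteq> 0}"
  shows "finite {(i, k, j). H i j k \<noteq> 0}"
proof -
  have "{(i, k, j). H i j k \<noteq> 0} = (\<lambda>(i, j, k). (i, k, j)) ` {(i, j, k). H i j k \<noteq> 0}"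
    by force
  then show ?thesis
    using assms by simp
qed

lemma dsum3_rotate:
  assumes "finite {(i, j, k). H i j k \<noteq> 0}"
  shows "dsum l (\<lambda>i. dsum p (\<lambda>j. dsum q (\<lambda>k. H i j k)))
    = dsum p (\<lambda>j. dsum q (\<lambda>k. dsum l (\<lambda>i. H i j k)))"
  unfolding dsum3_swap12[OF assms]
  by (rule dsum_cong, rule dsum_swap)
    (use finite_vimageI[OF assms, of "\<lambda>(i, k). (i, _, k)"] in
      \<open>simp add: inj_on_def vimage_def split_def\<close>)

text \<open>One factor x1 - x2 is absorbed into the series: replacing S by
  \<open>\<lambda>a b c. S (a - 1) b c\<close> multiplies it by x1. The next two lemmas do the same
  for x1 - x3 and x2 - x3.\<close>

lemma res3_step1:
  assumes "tame S"
  shows "res3 S (l + 1) p q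
    = res3 (\<lambda>a b c. S (a - 1) b c) l p q - res3 (\<lambda>a b c. S a (b - 1) c) l p q"
proof -
  define H where "H i j k = S (-1 - of_int (l + 1) - of_int p + of_nat i + of_nat j)
      (-1 - of_int q - of_nat i + of_nat k) (-1 - of_nat j - of_nat k)" for i j k :: nat
  have fin: "finite {(i, j, k). H i j k \<noteq> 0}"
    unfolding H_def by (rule tame_finite[OF assms])
  have fin1: "finite {i. dsum p (\<lambda>j. dsum q (H i j)) \<noteq> 0}"
    by (intro finite_dsum_rows finite3_rows fin)
  note fin2 = finite_shift[OF fin1]
  have "res3 S (l + 1) p q = dsum (l + 1) (\<lambda>i. dsum p (\<lambda>j. dsum q (H i j)))"
    by (simp only: res3_def H_def[abs_def])
  also have "\<dots> = dsum l (\<lambda>i. dsum p (\<lambda>j. dsum q (H i j)))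
      - dsum l (\<lambda>i. dsum p (\<lambda>j. dsum q (H (Suc i) j)))"
    by (simp only: dsum_pascal[OF fin1] dsum_diff[OF fin1 fin2])
  finally show ?thesis
    unfolding res3_def H_def[abs_def] by (simp add: algebra_simps)
qed

lemma res3_step2:
  assumes "tame S"
  shows "res3 S l (p + 1) q
    = res3 (\<lambda>a b c. S (a - 1) b c) l p q - res3 (\<lambda>a b c. S a b (c - 1)) l p q"
proof -
  define H where "H i j k = S (-1 - of_int l - of_int (p + 1) + of_nat i + of_nat j)
      (-1 - of_int q - of_nat i + of_nat k) (-1 - of_nat j - of_nat k)" for i j k :: nat
  have fin: "finite {(i, j, k). H i j k \<noteq> 0}"
    unfolding H_def by (rule tame_finite[OF assms])
  have fin1: "finite {j. dsum q (H i j) \<noteq> 0}" for i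
    by (intro finite_dsum_rows finite3_slice fin)
  note fin2 = finite_shift[OF fin1]
  have fin': "finite {(i, j, k). H i (Suc j) k \<noteq> 0}"
    using finite_vimageI[OF fin, of "\<lambda>(i, j, k). (i, Suc j, k)"]
    by (simp add: inj_on_def vimage_def split_def)
  have "res3 S l (p + 1) q = dsum l (\<lambda>i. dsum (p + 1) (\<lambda>j. dsum q (H i j)))"
    by (simp only: res3_def H_def[abs_def])
  also have "\<dots> = dsum l (\<lambda>i. dsum p (\<lambda>j. dsum q (H i j)) - dsum p (\<lambda>j. dsum q (H i (Suc j))))"
    by (simp only: dsum_pascal[OF fin1] dsum_diff[OF fin1 fin2])
  also have "\<dots> = dsum l (\<lambda>i. dsum p (\<lambda>j. dsum q (H i j)))
      - dsum l (\<lambda>i. dsum p (\<lambda>j. dsum q (H i (Suc j))))"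
    by (intro dsum_diff finite_dsum_rows finite3_rows fin fin')
  finally show ?thesis
    unfolding res3_def H_def[abs_def] by (simp add: algebra_simps)
qed

lemma res3_step3:
  assumes "tame S"
  shows "res3 S l p (q + 1)
    = res3 (\<lambda>a b c. S a (b - 1) c) l p q - res3 (\<lambda>a b c. S a b (c - 1)) l p q"
proof -
  define H where "H i j k = S (-1 - of_int l - of_int p + of_nat i + of_nat j)
      (-1 - of_int (q + 1) - of_nat i + of_nat k) (-1 - of_nat j - of_nat k)" for i j k :: nat
  have fin: "finite {(i, j, k). H i j k \<noteq> 0}"
    unfolding H_def by (rule tame_finite[OF assms])
  have fin1: "finite {k. H i j k \<noteq> 0}" for i j
    by (rule finite3_last[OF fin])
  note fin2 = finite_shift[OF fin1]
  have fin': "finite {(i, j, k). H i j (Suc k) \<noteq> 0}"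
    using finite_vimageI[OF fin, of "\<lambda>(i, j, k). (i, j, Suc k)"]
    by (simp add: inj_on_def vimage_def split_def)
  have "res3 S l p (q + 1) = dsum l (\<lambda>i. dsum p (\<lambda>j. dsum (q + 1) (H i j)))"
    by (simp only: res3_def H_def[abs_def])
  also have "\<dots> = dsum l (\<lambda>i. dsum p (\<lambda>j. dsum q (H i j) - dsum q (\<lambda>k. H i j (Suc k))))"
    by (simp only: dsum_pascal[OF fin1] dsum_diff[OF fin1 fin2])
  also have "\<dots> = dsum l (\<lambda>i. dsum p (\<lambda>j. dsum q (H i j)) - dsum p (\<lambda>j. dsum q (\<lambda>k. H i j (Suc k))))"
    by (intro dsum_cong dsum_diff finite_dsum_rows finite3_slice fin fin')
  also have "\<dots> = dsum l (\<lambda>i. dsum p (\<lambda>j. dsum q (H i j)))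
      - dsum l (\<lambda>i. dsum p (\<lambda>j. dsum q (\<lambda>k. H i j (Suc k))))"
    by (intro dsum_diff finite_dsum_rows finite3_rows fin fin')
  finally show ?thesis
    unfolding res3_def H_def[abs_def] by (simp add: algebra_simps)
qed

text \<open>Once the linear factors are inside the series, (x1 - x3) S = (x1 - x2) S + (x2 - x3) S,
  with the remaining powers expanded in the same way in all three terms.\<close>

lemma res3_rec:
  assumes "tame S"
  shows "res3 S l (p + 1) q = res3 S (l + 1) p q + res3 S l p (q + 1)"
  by (simp add: res3_step1 res3_step2 res3_step3 assms)

text \<open>Exchanging the first two variables changes only the expansion of (x1 - x2)^l: the powers
  of x1 - x3 and x2 - x3 are expanded in x3 on both sides. The last hypothesis says that (x1 - x2)^l
  S and (x1 - x2)^l S' agree, each in its own expansion.\<close>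

lemma res3_swap12:
  assumes "tame S" and "tame S'"
    and "\<And>a b c. dsum l (\<lambda>i. S (a - of_int l + of_nat i) (b - of_nat i) c)
      = alt l (dsum l (\<lambda>i. S' (b - of_int l + of_nat i) (a - of_nat i) c))"
  shows "res3 S l p q = alt l (res3 S' l q p)"
proof -
  \<comment> \<open>The sum for x1 - x2 is moved innermost, so that the hypothesis applies with the
    other two indices fixed.\<close>
  have "res3 S l p q = dsum p (\<lambda>j. dsum q (\<lambda>k. dsum l (\<lambda>i.
    S (-1 - of_int l - of_int p + of_nat i + of_nat j)
      (-1 - of_int q - of_nat i + of_nat k) (-1 - of_nat j - of_nat k))))"
    unfolding res3_def by (rule dsum3_rotate, rule tame_finite[OF assms(1)])
  also have "\<dots> = dsum p (\<lambda>j. dsum q (\<lambda>k. dsum l (\<lambda>i.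
    S ((-1 - of_int p + of_nat j) - of_int l + of_nat i)
      ((-1 - of_int q + of_nat k) - of_nat i) (-1 - of_nat j - of_nat k))))"
    by (simp add: algebra_simps)
  also have "\<dots> = alt l (dsum p (\<lambda>j. dsum q (\<lambda>k. dsum l (\<lambda>i.
    S' ((-1 - of_int q + of_nat k) - of_int l + of_nat i)
      ((-1 - of_int p + of_nat j) - of_nat i) (-1 - of_nat j - of_nat k)))))"
    by (simp only: assms(3) dsum_alt)
  also have "dsum p (\<lambda>j. dsum q (\<lambda>k. dsum l (\<lambda>i.
    S' ((-1 - of_int q + of_nat k) - of_int l + of_nat i)
      ((-1 - of_int p + of_nat j) - of_nat i) (-1 - of_nat j - of_nat k))))
    = dsum p (\<lambda>j. dsum q (\<lambda>k. dsum l (\<lambda>i.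
    S' (-1 - of_int l - of_int q + of_nat i + of_nat k)
      (-1 - of_int p - of_nat i + of_nat j) (-1 - of_nat k - of_nat j))))"
    by (simp add: algebra_simps)
  also have "\<dots> = dsum l (\<lambda>i. dsum p (\<lambda>j. dsum q (\<lambda>k. 
    S' (-1 - of_int l - of_int q + of_nat i + of_nat k)
      (-1 - of_int p - of_nat i + of_nat j) (-1 - of_nat k - of_nat j))))"
    by (rule dsum3_rotate[symmetric])
      (rule finite3_swap23, rule tame_finite[OF assms(2)])
  also have "\<dots> = res3 S' l q p"
    unfolding res3_def
    by (rule dsum3_swap23)
      (rule finite3_swap23, rule tame_finite[OF assms(2)])
  finally show ?thesis .
qed

text \<open>Here the powers of x1 - x2 and x1 - x3 keep their expansions and trade places, and only
  (x2 - x3)^q is expanded anew. Its sum is already innermost.\<close>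

lemma res3_swap23:
  assumes "tame S" and "tame S'"
    and "\<And>a b c. dsum q (\<lambda>k. S a (b - of_int q + of_nat k) (c - of_nat k))
      = alt q (dsum q (\<lambda>k. S' a (c - of_int q + of_nat k) (b - of_nat k)))"
  shows "res3 S l p q = alt q (res3 S' p l q)"
proof -
  have "res3 S l p q = dsum l (\<lambda>i. dsum p (\<lambda>j. dsum q (\<lambda>k.
    S (-1 - of_int l - of_int p + of_nat i + of_nat j)
      ((-1 - of_nat i) - of_int q + of_nat k) ((-1 - of_nat j) - of_nat k))))"
    by (simp add: res3_def algebra_simps)
  also have "\<dots> = alt q (dsum l (\<lambda>i. dsum p (\<lambda>j. dsum q (\<lambda>k.
    S' (-1 - of_int l - of_int p + of_nat i + of_nat j)
      ((-1 - of_nat j) - of_int q + of_nat k) ((-1 - of_nat i) - of_nat k)))))"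
    by (simp only: assms(3) dsum_alt)
  also have "dsum l (\<lambda>i. dsum p (\<lambda>j. dsum q (\<lambda>k.
    S' (-1 - of_int l - of_int p + of_nat i + of_nat j)
      ((-1 - of_nat j) - of_int q + of_nat k) ((-1 - of_nat i) - of_nat k))))
    = dsum l (\<lambda>i. dsum p (\<lambda>j. dsum q (\<lambda>k.
    S' (-1 - of_int p - of_int l + of_nat j + of_nat i)
      (-1 - of_int q - of_nat j + of_nat k) (-1 - of_nat i - of_nat k))))"
    by (simp add: algebra_simps)
  also have "\<dots> = res3 S' p l q"
    unfolding res3_def
    by (rule dsum3_swap12[symmetric], rule tame_finite[OF assms(2)])
  finally show ?thesis .
qed

end

section \<open>Three-term recursions\<close>

text \<open>Levels n > 0 follow from level 0. If level n + 1 vanishes, level n is constant along the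
  lines p + q = const, on which q can be raised to k; this reaches all negative levels.\<close>

lemma recursion_unique:
  fixes E :: "int \<Rightarrow> int \<Rightarrow> int \<Rightarrow> 'a::ab_group_add"
  assumes rec: "\<And>p q n. E p q (n + 1) = E (p + 1) q n - E p (q + 1) n"
    and base: "\<And>p q. E p q 0 = 0"
    and vanish: "\<And>p q n. q \<ge> k \<Longrightarrow> E p q n = 0"
  shows "E p q n = 0"
proof -
  have up: "E p q (int n) = 0" for p q n
    by (induction n arbitrary: p q) (simp_all add: base rec add.commute[of 1])
  have down: "E p q (- int n) = 0" for p q n
  proof (induction n arbitrary: p q)
    case 0
    then show ?case
      by (simp add: base)
  next
    case (Suc n)
    have "E (p + 1) q (- int (Suc n)) = E p (q + 1) (- int (Suc n))" for p q
      using rec[of p q "- int (Suc n)"] Suc by simp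
    from this[of "_ - 1"] have move: "E p q (- int (Suc n)) = E (p - 1) (q + 1) (- int (Suc n))" for p q
      by simp
    have "E p q (- int (Suc n)) = E (p - int m) (q + int m) (- int (Suc n))" for m
    proof (induction m)
      case (Suc m)
      then show ?case
        using move[of "p - int m" "q + int m"] by (simp add: algebra_simps)
    qed simp
    from this[of "nat (k - q)"] show ?case
      by (simp add: vanish)
  qed
  show ?thesis
    using up[of p q "nat n"] down[of p q "nat (- n)"] by (cases "n \<ge> 0") auto
qed

text \<open>Each use of the recursion lowers x by 1 and raises y or z by 1. Starting from x this
  large, either z reaches k, or y does so while x is still at least k. The recursion is assumed for
  vanishing only, so that it fits both commutators after a permutation of the exponents.\<close>

lemma recursion_vanish:
  fixes F :: "int \<Rightarrow> int \<Rightarrow> int \<Rightarrow> 'a::zero"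
  assumes rec: "\<And>x y z. F x (y + 1) z = 0 \<Longrightarrow> F x y (z + 1) = 0 \<Longrightarrow> F (x + 1) y z = 0"
    and z: "\<And>x y z. z \<ge> k \<Longrightarrow> F x y z = 0"
    and xy: "\<And>x y z. x \<ge> k \<Longrightarrow> y \<ge> k \<Longrightarrow> F x y z = 0"
    and x: "x \<ge> k + \<bar>k - y\<bar> + \<bar>k - z\<bar>"
  shows "F x y z = 0"
proof -
  have "nat (k - y) + nat (k - z) \<le> d \<Longrightarrow> F (k + int d) y z = 0" for d y z
  proof (induction d arbitrary: y z)
    case 0
    then show ?case
      by (simp add: xy)
  next
    case (Suc d)
    show ?case
    proof (cases "z \<ge> k \<or> y \<ge> k")
      case True
      then show ?thesis
        using z xy by auto
    next
      case False
      then have "nat (k - (y + 1)) + nat (k - z) \<le> d" "nat (k - y) + nat (k - (z + 1)) \<le> d"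
        using Suc.prems by auto
      then have "F (k + int d) (y + 1) z = 0" "F (k + int d) y (z + 1) = 0"
        using Suc.IH by blast+
      from rec[OF this] show ?thesis
        by (simp add: algebra_simps)
    qed
  qed
  moreover have "nat (k - y) + nat (k - z) \<le> nat (x - k)" and "k + int (nat (x - k)) = x"
    using x by linarith+
  ultimately show ?thesis
    by metis
qed

context complex_space
begin

text \<open>The recursion is solved by (x - y)^n = ((x - t) - (y - t))^n, expanded in nonnegative
  powers of y - t; vanishing for large q makes the expansion finite for negative n as well.\<close>

lemma dsum_unique:
  assumes H: "\<And>p q. q \<ge> k \<Longrightarrow> H p q = 0"
    and rec: "\<And>p q n. E (p + 1) q n = E p (q + 1) n + E p q (n + 1)"
    and vanish: "\<And>p q n. q \<ge> k \<Longrightarrow> E p q n = 0"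
    and base: "\<And>p q. E p q 0 = H p q"
  shows "dsum n (\<lambda>i. H (p + n - int i) (q + int i)) = E p q n"
proof -
  define D where "D p q n = dsum n (\<lambda>i. H (p + n - int i) (q + int i)) - E p q n" for p q n
  have "D p q n = 0"
  proof (rule recursion_unique[where E = D])
    fix p q n
    have "finite {i. H (p + (n + 1) - int i) (q + int i) \<noteq> 0}" for p q n
      by (rule finite_support_bound[of "nat (k - q)"]) (use H in auto)
    note fin = this finite_shift[OF this]
    have "dsum (n + 1) (\<lambda>i. H (p + (n + 1) - int i) (q + int i))
      = dsum n (\<lambda>i. H (p + (n + 1) - int i) (q + int i))
        - dsum n (\<lambda>i. H (p + (n + 1) - int (Suc i)) (q + int (Suc i)))"
      by (simp only: dsum_pascal[OF fin(1)] dsum_diff[OF fin])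
    then show "D p q (n + 1) = D (p + 1) q n - D p (q + 1) n"
      using rec[of p q n] by (simp add: D_def algebra_simps)
  next
    fix p q n assume "q \<ge> k"
    then show "D p q n = 0"
      by (simp add: D_def H vanish)
  qed (simp add: D_def base)
  then show ?thesis
    by (simp add: D_def)
qed

text \<open>The counterpart for (x - t)^p = ((y - t) + (x - y))^p, expanded in nonnegative powers of
  x - y.\<close>

lemma bsum_unique:
  assumes H: "\<And>n q. n \<ge> k \<Longrightarrow> H n q = 0"
    and rec: "\<And>p q n. E (p + 1) q n = E p (q + 1) n + E p q (n + 1)"
    and vanish: "\<And>p q n. n \<ge> k \<Longrightarrow> E p q n = 0"
    and base: "\<And>q n. E 0 q n = H n q"
  shows "bsum (of_int p) (\<lambda>i. H (n + int i) (q + p - int i)) = E p q n"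
proof -
  \<comment> \<open>The sign turns the sum in the recursion into the difference required by
    \<open>recursion_unique\<close>; the arguments are permuted so that p is the exponent with known
    values at 0.\<close>
  define D where "D q n p = alt n (bsum (of_int p) (\<lambda>i. H (n + int i) (q + p - int i)) - E p q n)"
    for p q n
  have "D q n p = 0"
  proof (rule recursion_unique[where E = D])
    fix q n p
    have "finite {i. H (n + int i) (q + (p + 1) - int i) \<noteq> 0}" for p q n
      by (rule finite_support_bound[of "nat (k - n)"]) (use H in auto)
    note fin = this finite_shift[OF this]
    have "bsum (of_int p + 1) (\<lambda>i. H (n + int i) (q + (p + 1) - int i))
      = bsum (of_int p) (\<lambda>i. H (n + int i) (q + (p + 1) - int i))
        + bsum (of_int p) (\<lambda>i. H (n + int (Suc i)) (q + (p + 1) - int (Suc i)))"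
      by (simp only: bsum_pascal[OF fin(1)] bsum_add[OF fin])
    then show "D q n (p + 1) = D (q + 1) n p - D q (n + 1) p"
      using rec[of p q n] by (simp add: D_def alt_add1 alt_add alt_diff algebra_simps)
  next
    fix q n p assume "n \<ge> k"
    then show "D q n p = 0"
      by (simp add: D_def H vanish)
  qed (simp add: D_def base)
  then show ?thesis
    by (simp add: D_def)
qed

section \<open>Fields in one variable and their products\<close>

definition is_field :: "(rat \<Rightarrow> 'w \<Rightarrow> 'w) \<Rightarrow> bool" where
  "is_field A \<longleftrightarrow> (\<forall>a x y. A a (x + y) = A a x + A a y) \<and> (\<forall>a c x. A a (s c x) = s c (A a x))
    \<and> (\<forall>w. \<exists>K. \<forall>a<K. A a w = 0)"

text \<open>
  A field A(x) is given by its coefficients, A a being the coefficient of x^a.  Then shift e A is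
  x^e A(x), and nprod n A B is the residue in x of (x - t)^n A(x) B(t) - (-t + x)^n B(t) A(x).
  Only the integral powers in A(x) contribute to it.
\<close>

definition shift :: "rat \<Rightarrow> (rat \<Rightarrow> 'w \<Rightarrow> 'w) \<Rightarrow> rat \<Rightarrow> 'w \<Rightarrow> 'w" where
  "shift e A = (\<lambda>a. A (a - e))"

definition nprod :: "int \<Rightarrow> (rat \<Rightarrow> 'w \<Rightarrow> 'w) \<Rightarrow> (rat \<Rightarrow> 'w \<Rightarrow> 'w) \<Rightarrow> rat \<Rightarrow> 'w \<Rightarrow> 'w" where
  "nprod n A B c w = dsum n (\<lambda>i. A (-1 - of_int n + of_nat i) (B (c - of_nat i) w))
    - alt n (dsum n (\<lambda>i. B (c - of_int n + of_nat i) (A (-1 - of_nat i) w)))"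

text \<open>For n \<ge> 0, \<open>nprod n\<close> is the residue of (x - t)^n [A(x), B(t)]. Letting
  the shift e range over all rationals turns the residue in x into every coefficient, so this is the
  usual locality.\<close>

definition local_fields :: "int \<Rightarrow> (rat \<Rightarrow> 'w \<Rightarrow> 'w) \<Rightarrow> (rat \<Rightarrow> 'w \<Rightarrow> 'w) \<Rightarrow> bool" where
  "local_fields k A B \<longleftrightarrow> (\<forall>n\<ge>k. \<forall>e c w. nprod n (shift e A) B c w = 0)"

lemma field_add: "is_field A \<Longrightarrow> A a (x + y) = A a x + A a y"
  and field_scale: "is_field A \<Longrightarrow> A a (s c x) = s c (A a x)"
  by (simp_all add: is_field_def)

lemma field_0: "is_field A \<Longrightarrow> A a 0 = 0"
  using field_scale[of A a 0 0] by simp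

lemma field_minus: "is_field A \<Longrightarrow> A a (- x) = - A a x"
  using field_scale[of A a "-1" x] by simp

lemma field_diff: "is_field A \<Longrightarrow> A a (x - y) = A a x - A a y"
  using field_add[of A a x "- y"] by (simp add: field_minus)

lemma field_alt: "is_field A \<Longrightarrow> A a (alt n x) = alt n (A a x)"
  by (simp add: alt_def field_minus)

lemma field_bound:
  assumes "is_field A"
  obtains M where "\<And>i. M \<le> i \<Longrightarrow> A (c - of_nat i) w = 0"
proof -
  obtain K where K: "\<And>a. a < K \<Longrightarrow> A a w = 0"
    using assms unfolding is_field_def by blast
  obtain M where "of_nat M > c - K"
    using reals_Archimedean2[of "c - K"] by blast
  have "A (c - of_nat i) w = 0" if "M \<le> i" for i
  proof (rule K)
    have "(of_nat M :: rat) \<le> of_nat i"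
      using that by simp
    then show "c - of_nat i < K"
      using \<open>of_nat M > c - K\<close> by linarith
  qed
  then show ?thesis
    using that by blast
qed

lemma field_finite:
  assumes "is_field A"
  shows "finite {i. A (c - of_nat i) w \<noteq> 0}"
proof -
  obtain M where "\<And>i. M \<le> i \<Longrightarrow> A (c - of_nat i) w = 0"
    using field_bound[OF assms] by blast
  then show ?thesis
    by (rule finite_support_bound)
qed

lemma field_finite':
  assumes "is_field A" and "is_field B"
  shows "finite {i. B (b i) (A (c - of_nat i) w) \<noteq> 0}"
  by (rule finite_subset[OF _ field_finite[OF assms(1), of c w]]) (use field_0[OF assms(2)] in auto)

lemma field_dsum:
  assumes "is_field A" and "finite {i. G i \<noteq> 0}"
  shows "A a (dsum n G) = dsum n (\<lambda>i. A a (G i))"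
  unfolding dsum_def using assms
  by (subst bsum_map) (auto simp: field_add field_scale field_alt)

lemma field_bsum:
  assumes "is_field A" and "finite {i. G i \<noteq> 0}"
  shows "A a (bsum n G) = bsum n (\<lambda>i. A a (G i))"
  using assms by (subst bsum_map) (auto simp: field_add field_scale)

lemma is_field_shift: "is_field A \<Longrightarrow> is_field (shift e A)"
  unfolding is_field_def shift_def by (meson diff_less_eq)

lemma shift_shift: "shift d (shift e A) = shift (d + e) A"
  by (simp add: shift_def algebra_simps)

lemma shift_apply: "shift e A a = A (a - e)"
  by (simp add: shift_def)

lemma shift_0 [simp]: "shift 0 A = A"
  by (simp add: shift_def)

lemma nprod_shift: "nprod n A (shift e B) c = nprod n A B (c - e)"
  by (simp add: nprod_def shift_def fun_eq_iff algebra_simps)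

lemma shift_nprod: "shift e (nprod n A B) = nprod n A (shift e B)"
  by (simp add: nprod_shift fun_eq_iff) (simp add: shift_def)

lemma local_shift:
  assumes "local_fields k A B"
  shows "local_fields k (shift e A) B" and "local_fields k A (shift e B)"
  using assms by (simp_all add: local_fields_def shift_shift nprod_shift)

lemma local_mono: "local_fields k A B \<Longrightarrow> k \<le> k' \<Longrightarrow> local_fields k' A B"
  by (simp add: local_fields_def)

lemma local_nprod:
  assumes "local_fields k A B" and "k \<le> n"
  shows "nprod n A B c w = 0"
  using assms unfolding local_fields_def by (metis shift_0)

lemma local_commute:
  assumes "local_fields k A B" and "n \<ge> k"
  shows "dsum n (\<lambda>i. A (a - of_int n + of_nat i) (B (b - of_nat i) w))
    = alt n (dsum n (\<lambda>i. B (b - of_int n + of_nat i) (A (a - of_nat i) w)))"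
proof -
  \<comment> \<open>The power x^(-1 - a) moves the coefficient of x^a into the residue.\<close>
  have "nprod n (shift (-1 - a) A) B b w = 0"
    using assms by (simp add: local_fields_def)
  then show ?thesis
    by (simp add: nprod_def shift_def algebra_simps)
qed

lemma finite_nprod:
  assumes "is_field A" "is_field B"
  shows "finite {i. A (a + of_nat i) (B (c - of_nat i) w) \<noteq> 0}"
    and "finite {i. B (a + of_nat i) (A (c - of_nat i) w) \<noteq> 0}"
  by (rule field_finite'[OF assms(2,1)], rule field_finite'[OF assms])

lemma is_field_nprod:
  assumes "is_field A" "is_field B"
  shows "is_field (nprod n A B)"
  unfolding is_field_def
proof (intro conjI allI)
  note fin = finite_nprod[OF assms, of "-1 - of_int n"] finite_nprod[OF assms, of "c - of_int n" for c]
  fix a x y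
  show "nprod n A B a (x + y) = nprod n A B a x + nprod n A B a y"
    unfolding nprod_def field_add[OF assms(1)] field_add[OF assms(2)]
    by (simp only: dsum_add[OF fin(1) fin(1)] dsum_add[OF fin(4) fin(4)] alt_add add_diff_add)
next
  note fin = finite_nprod[OF assms, of "-1 - of_int n"] finite_nprod[OF assms, of "c - of_int n" for c]
  fix a c x
  show "nprod n A B a (s c x) = s c (nprod n A B a x)"
    unfolding nprod_def field_scale[OF assms(1)] field_scale[OF assms(2)]
    by (simp only: dsum_scale[OF fin(1)] dsum_scale[OF fin(4)] alt_scale_commute scale_right_diff_distrib)
next
  fix w
  obtain K where K: "\<And>a. a < K \<Longrightarrow> B a w = 0"
    using assms(2) unfolding is_field_def by blast
  obtain M where M: "\<And>i. M \<le> i \<Longrightarrow> A (-1 - of_nat i) w = 0"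
    using field_bound[OF assms(1), of "-1" w] by blast
  have "\<forall>i. \<exists>L. \<forall>a<L. B a (A (-1 - of_nat i) w) = 0"
    using assms(2) by (simp add: is_field_def)
  then obtain l where l: "\<forall>i. \<forall>a<l i. B a (A (-1 - of_nat i) w) = 0"
    by (rule choice[THEN exE])
  \<comment> \<open>Only finitely many of the vectors A (-1 - i) w are nonzero, so the lower bounds
    for B on them have a minimum; the inserted 0 keeps the set nonempty when M = 0.\<close>
  define L where "L = Min (insert 0 (l ` {..<M}))"
  have L: "B a (A (-1 - of_nat i) w) = 0" if "a < L" for i a
  proof (cases "i < M")
    case True
    then have "L \<le> l i"
      unfolding L_def by (intro Min_le) auto
    then show ?thesis
      using l that by auto
  next
    case False
    then show ?thesis
      using M[of i] by (simp add: field_0 assms)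
  qed
  have "nprod n A B c w = 0" if "c < K" and c: "c < L + of_int n - of_nat M" for c
  proof -
    have "B (c - of_nat i) w = 0" for i
    proof (rule K)
      have "(0::rat) \<le> of_nat i"
        by simp
      then show "c - of_nat i < K"
        using \<open>c < K\<close> by linarith
    qed
    moreover have "B (c - of_int n + of_nat i) (A (-1 - of_nat i) w) = 0" for i
    proof (cases "i < M")
      case True
      then have "(of_nat i :: rat) < of_nat M"
        by simp
      then show ?thesis
        using c by (intro L) linarith
    next
      case False
      then show ?thesis
        using M[of i] by (simp add: field_0 assms)
    qed
    ultimately show ?thesis
      by (simp add: nprod_def field_0 assms)
  qed
  then show "\<exists>K. \<forall>a<K. nprod n A B a w = 0"
    by (intro exI[of _ "min K (L + of_int n - of_nat M)"]) simp
qed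

section \<open>The Jacobi identity for products of three fields\<close>

definition ops :: "(rat \<Rightarrow> 'w \<Rightarrow> 'w) \<Rightarrow> (rat \<Rightarrow> 'w \<Rightarrow> 'w) \<Rightarrow> (rat \<Rightarrow> 'w \<Rightarrow> 'w) \<Rightarrow> 'w
    \<Rightarrow> rat \<Rightarrow> rat \<Rightarrow> rat \<Rightarrow> 'w" where
  "ops A B C w = (\<lambda>a b c. A a (B b (C c w)))"

text \<open>Truncation of C on w bounds j + k, and for each remaining pair (j, k) truncation of B
  bounds i.\<close>

lemma tame_ops:
  assumes "is_field A" "is_field B" "is_field C"
  shows "tame (ops A B C w)"
  unfolding tame_def
proof (intro allI)
  fix a b c
  obtain M where M: "\<And>i. M \<le> i \<Longrightarrow> C (c - of_nat i) w = 0"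
    using field_bound[OF assms(3), of c w] by metis
  let ?f = "\<lambda>i j k. ops A B C w (a + of_nat i + of_nat j) (b - of_nat i + of_nat k)
      (c - of_nat j - of_nat k)"
  have zero: "j < M" "k < M" if "?f i j k \<noteq> 0" for i j k
  proof -
    have "C (c - of_nat (j + k)) w \<noteq> 0"
      using that by (auto simp: ops_def field_0 assms algebra_simps)
    then have "j + k < M"
      using M not_le by blast
    then show "j < M" "k < M"
      by simp_all
  qed
  have "finite {i. ?f i j k \<noteq> 0}" for j k
    by (rule finite_subset[OF _ field_finite[OF assms(2), of "b + of_nat k" "C (c - of_nat j - of_nat k) w"]])
      (auto simp: ops_def field_0 assms algebra_simps)
  then have "finite ((\<lambda>((j, k), i). (i, j, k)) ` Sigma ({..<M} \<times> {..<M}) (\<lambda>(j, k). {i. ?f i j k \<noteq> 0}))"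
    by (intro finite_imageI finite_SigmaI) (auto split: prod.splits)
  moreover have "{(i, j, k). ?f i j k \<noteq> 0}
      \<subseteq> (\<lambda>((j, k), i). (i, j, k)) ` Sigma ({..<M} \<times> {..<M}) (\<lambda>(j, k). {i. ?f i j k \<noteq> 0})"
    using zero by force
  ultimately show "finite {(i, j, k). ?f i j k \<noteq> 0}"
    by (rule rev_finite_subset)
qed

lemma res3_commute12:
  assumes "is_field A" "is_field B" "is_field C" "local_fields k A B" "l \<ge> k"
  shows "res3 (ops A B C w) l p q = alt l (res3 (ops B A C w) l q p)"
  by (intro res3_swap12 tame_ops assms) (simp add: ops_def local_commute[OF assms(4,5)])

lemma res3_commute23:
  assumes "is_field A" "is_field B" "is_field C" "local_fields k B C" "q \<ge> k"
  shows "res3 (ops A B C w) l p q = alt q (res3 (ops A C B w) p l q)"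
proof (intro res3_swap23 tame_ops assms)
  fix a b c
  have "A a (dsum q (\<lambda>i. B (b - of_int q + of_nat i) (C (c - of_nat i) w)))
    = A a (alt q (dsum q (\<lambda>i. C (c - of_int q + of_nat i) (B (b - of_nat i) w))))"
    by (simp only: local_commute[OF assms(4,5)])
  then show "dsum q (\<lambda>k. ops A B C w a (b - of_int q + of_nat k) (c - of_nat k))
      = alt q (dsum q (\<lambda>k. ops A C B w a (c - of_int q + of_nat k) (b - of_nat k)))"
    by (simp add: ops_def field_alt field_dsum finite_nprod assms)
qed

text \<open>
  With f = (x - t)^p (y - t)^q (x - y)^n, these are the coefficients of t^c in the residues in
  x and y of [A(x), [B(y), C(t)]] f and [[A(x), B(y)], C(t)] f, where f is expanded
  according to the order of the operators in each of the four terms.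
\<close>

definition right_comm where
  "right_comm A B C c w p q n = (let C' = shift (- c - 1) C in
    res3 (ops A B C' w) n p q - alt q (res3 (ops A C' B w) p n q)
    - alt (p + n) (res3 (ops B C' A w) q n p) + alt (p + q + n) (res3 (ops C' B A w) q p n))"

definition left_comm where
  "left_comm A B C c w p q n = (let C' = shift (- c - 1) C in
    res3 (ops A B C' w) n p q - alt n (res3 (ops B A C' w) n q p)
    - alt (p + q) (res3 (ops C' A B w) p q n) + alt (p + q + n) (res3 (ops C' B A w) q p n))"

text \<open>The ordered products occur with the same expansion of f on both sides, so the operator
  identity holds term by term; the two products with C in the middle cancel.\<close>

lemma left_comm_eq:
  "left_comm A B C c w p q n
    = right_comm A B C c w p q n - alt n (right_comm B A C c w q p n)"
  by (cases "even p"; cases "even q"; cases "even n")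
    (simp_all add: left_comm_def right_comm_def Let_def alt_def)

text \<open>Locality of A and B is recorded in both orders, which makes the notion invariant under
  exchanging them.\<close>

definition triple where
  "triple k A B C \<longleftrightarrow> is_field A \<and> is_field B \<and> is_field C \<and> local_fields k A B \<and> local_fields k B A
    \<and> local_fields k A C \<and> local_fields k B C"

lemma triple_commute: "triple k A B C \<Longrightarrow> triple k B A C"
  by (simp add: triple_def)

lemma tripleD:
  assumes "triple k A B C"
  shows "is_field A" "is_field B" "is_field C" "is_field (shift e C)"
    "local_fields k A B" "local_fields k B A" "local_fields k A C" "local_fields k B C"
    "local_fields k A (shift e C)" "local_fields k B (shift e C)"
  using assms by (simp_all add: triple_def is_field_shift local_shift)

lemma triple_shift:
  assumes "triple k A B C"
  shows "triple k (shift a A) (shift b B) (shift c C)"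
  using assms by (simp add: triple_def is_field_shift local_shift)

text \<open>In each ordered product \<open>res3_rec\<close> relates the three differences, the
  middle exponent belonging to the two outer operators. The signs in front of the products turn the
  four relations into the same recursion.\<close>

lemma right_comm_rec:
  assumes "triple k A B C"
  shows "right_comm A B C c w (p + 1) q n = right_comm A B C c w p (q + 1) n + right_comm A B C c w p q (n + 1)"
proof -
  note rec = res3_rec[OF tame_ops]
  show ?thesis
    unfolding right_comm_def Let_def
    using rec[OF tripleD(1,2,4)[OF assms], of "-c-1" w n p q] rec[OF tripleD(1,4,2)[OF assms], of "-c-1" w p n q]
     rec[OF tripleD(2,4,1)[OF assms], of "-c-1" w q n p] rec[OF tripleD(4,2,1)[OF assms], of "-c-1" w q p n]
    by (cases "even p"; cases "even q"; cases "even n") (simp_all add: alt_def algebra_simps)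
qed

lemma left_comm_rec:
  assumes "triple k A B C"
  shows "left_comm A B C c w (p + 1) q n = left_comm A B C c w p (q + 1) n + left_comm A B C c w p q (n + 1)"
  unfolding left_comm_eq right_comm_rec[OF assms]
  using right_comm_rec[OF triple_commute[OF assms], of c w q p n]
  by (simp add: alt_add alt_add1 algebra_simps)

text \<open>Enough factors y - t let B and C commute, and the four products cancel in pairs.\<close>

lemma right_comm_vanish_q:
  assumes "triple k A B C" "q \<ge> k"
  shows "right_comm A B C c w p q n = 0"
  unfolding right_comm_def Let_def
  using res3_commute23[OF tripleD(1,2,4,10)[OF assms(1)] assms(2)]
    res3_commute12[OF tripleD(2,4,1,10)[OF assms(1)] assms(2)]
  by (simp add: alt_alt add_ac)

text \<open>Enough factors x - t and x - y let A pass both B and C, so ABC cancels against BCA and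
  ACB against CBA.\<close>

lemma right_comm_vanish_pn:
  assumes "triple k A B C" "p \<ge> k" "n \<ge> k"
  shows "right_comm A B C c w p q n = 0"
  unfolding right_comm_def Let_def
  using res3_commute12[OF tripleD(1,2,4,5)[OF assms(1)] assms(3)]
    res3_commute23[OF tripleD(2,1,4,9)[OF assms(1)] assms(2)]
    res3_commute12[OF tripleD(1,4,2,9)[OF assms(1)] assms(2)]
    res3_commute23[OF tripleD(4,1,2,5)[OF assms(1)] assms(3)]
  by (simp add: alt_alt add_ac)

lemma left_comm_vanish_n:
  assumes "triple k A B C" "n \<ge> k"
  shows "left_comm A B C c w p q n = 0"
  unfolding left_comm_def Let_def
  using res3_commute12[OF tripleD(1,2,4,5)[OF assms(1)] assms(2)]
    res3_commute23[OF tripleD(4,1,2,5)[OF assms(1)] assms(2)]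
  by (simp add: alt_alt add_ac)

lemma left_comm_vanish_pq:
  assumes "triple k A B C" "p \<ge> k" "q \<ge> k"
  shows "left_comm A B C c w p q n = 0"
  unfolding left_comm_def Let_def
  using res3_commute23[OF tripleD(1,2,4,10)[OF assms(1)] assms(3)]
    res3_commute12[OF tripleD(1,4,2,9)[OF assms(1)] assms(2)]
    res3_commute23[OF tripleD(2,1,4,9)[OF assms(1)] assms(2)]
    res3_commute12[OF tripleD(2,4,1,10)[OF assms(1)] assms(3)]
  by (simp add: alt_alt add_ac)

text \<open>With q and n fixed, large p alone suffices, because the recursion trades p for q or n.
  Together with vanishing for large q this makes the double sums over the twisting indices
  finite.\<close>

lemma right_comm_vanish:
  assumes "triple k A B C" "p \<ge> k + \<bar>k - n\<bar> + \<bar>k - q\<bar>"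
  shows "right_comm A B C c w p q n = 0"
  by (rule recursion_vanish[where F = "\<lambda>p n q. right_comm A B C c w p q n" and k = k])
    (use right_comm_vanish_q[OF assms(1)] right_comm_vanish_pn[OF assms(1)]
      right_comm_rec[OF assms(1)] assms(2) in auto)

text \<open>At p = 0 this will become the locality of the product of A and B with C.\<close>

lemma left_comm_vanish:
  assumes "triple k A B C" "q \<ge> k + \<bar>k - p\<bar> + \<bar>k - n\<bar>"
  shows "left_comm A B C c w p q n = 0"
proof (rule recursion_vanish[where F = "\<lambda>q p n. left_comm A B C c w p q n" and k = k])
  fix q p n
  assume "left_comm A B C c w (p + 1) q n = 0" "left_comm A B C c w p q (n + 1) = 0"
  then show "left_comm A B C c w p (q + 1) n = 0"
    using left_comm_rec[OF assms(1)] by (metis add_cancel_right_right)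
qed (use left_comm_vanish_n[OF assms(1)] left_comm_vanish_pq[OF assms(1)] assms(2) in auto)


section \<open>Iterated products as special values of the double commutators\<close>

lemma dsum2_diff:
  assumes "finite {(i, j). G i j \<noteq> 0}" "finite {(i, j). H i j \<noteq> 0}"
  shows "dsum p (\<lambda>i. dsum q (G i) - alt r (dsum q (H i)))
    = dsum p (\<lambda>i. dsum q (G i)) - alt r (dsum p (\<lambda>i. dsum q (H i)))"
proof -
  have "finite {i. alt r (dsum q (H i)) \<noteq> 0}"
    using finite_dsum_rows[OF assms(2)] by simp
  then show ?thesis
    by (simp add: dsum_diff finite_dsum_rows[OF assms(1)] dsum_alt)
qed

text \<open>With n = 0 the factor f is (x - t)^p (y - t)^q, so the residues in y and in x can be
  taken one after the other, t being the variable of the inner product.\<close>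

lemma nprod_nprod_right:
  assumes "is_field A" "is_field B" "is_field C"
  shows "nprod p A (nprod q B C) c w = right_comm A B C c w p q 0"
proof -
  define C' where "C' = shift (- c - 1) C"
  have C: "C x = C' (x - c - 1)" for x
    by (simp add: C'_def shift_def)
  have fC: "is_field C'"
    unfolding C'_def by (rule is_field_shift[OF assms(3)])
  \<comment> \<open>\<open>t1\<close> to \<open>t4\<close> are the products ABC, ACB, BCA and CBA at
    the exponents at which \<open>res3\<close> reads them.\<close>
  define t1 where "t1 i j = A (-1 - of_int p + of_nat i) (B (-1 - of_int q + of_nat j)
    (C' (-1 - of_nat i - of_nat j) w))" for i j :: nat
  define t2 where "t2 i j = A (-1 - of_int p + of_nat i) (C' (-1 - of_int q - of_nat i + of_nat j)
    (B (-1 - of_nat j) w))" for i j :: nat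
  define t3 where "t3 i j = B (-1 - of_int q + of_nat j) (C' (-1 - of_int p - of_nat j + of_nat i)
    (A (-1 - of_nat i) w))" for i j :: nat
  define t4 where "t4 i j = C' (-1 - of_int q - of_int p + of_nat j + of_nat i) (B (-1 - of_nat j)
    (A (-1 - of_nat i) w))" for i j :: nat
  have fin1: "finite {(i, j). t1 i j \<noteq> 0}"
    using tame_finite2(1)[OF tame_ops[OF assms(1,2) fC]] by (simp add: t1_def ops_def)
  have fin2: "finite {(i, j). t2 i j \<noteq> 0}"
    using tame_finite2(2)[OF tame_ops[OF assms(1) fC assms(2)]] by (simp add: t2_def ops_def)
  have fin3': "finite {(j, i). t3 i j \<noteq> 0}"
    using tame_finite2(2)[OF tame_ops[OF assms(2) fC assms(1)]] by (simp add: t3_def ops_def)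
  note fin3 = finite2_flip[OF fin3']
  have fin4': "finite {(j, i). t4 i j \<noteq> 0}"
    using tame_finite2(3)[OF tame_ops[OF fC assms(2,1)]] by (simp add: t4_def ops_def)
  note fin4 = finite2_flip[OF fin4']
  have "nprod p A (nprod q B C) c w
    = dsum p (\<lambda>i. dsum q (\<lambda>j. A (-1 - of_int p + of_nat i) (B (-1 - of_int q + of_nat j)
          (C (c - of_nat i - of_nat j) w)))
        - alt q (dsum q (\<lambda>j. A (-1 - of_int p + of_nat i) (C (c - of_nat i - of_int q + of_nat j)
          (B (-1 - of_nat j) w)))))
      - alt p (dsum p (\<lambda>i. dsum q (\<lambda>j. B (-1 - of_int q + of_nat j)
          (C (c - of_int p + of_nat i - of_nat j) (A (-1 - of_nat i) w)))
        - alt q (dsum q (\<lambda>j. C (c - of_int p + of_nat i - of_int q + of_nat j)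
          (B (-1 - of_nat j) (A (-1 - of_nat i) w))))))"
    unfolding nprod_def
    by (simp only: field_diff[OF assms(1)] field_alt[OF assms(1)]
        field_dsum[OF assms(1) finite_nprod(1)[OF assms(2,3)]]
        field_dsum[OF assms(1) finite_nprod(2)[OF assms(2,3)]])
  also have "\<dots> = dsum p (\<lambda>i. dsum q (t1 i) - alt q (dsum q (t2 i)))
      - alt p (dsum p (\<lambda>i. dsum q (t3 i) - alt q (dsum q (t4 i))))"
    unfolding C t1_def[abs_def] t2_def[abs_def] t3_def[abs_def] t4_def[abs_def]
    by (simp add: algebra_simps, simp only: diff_conv_add_uminus minus_add_distrib add_ac)
  also have "\<dots> = (dsum p (\<lambda>i. dsum q (t1 i)) - alt q (dsum p (\<lambda>i. dsum q (t2 i))))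
      - alt p (dsum p (\<lambda>i. dsum q (t3 i)) - alt q (dsum p (\<lambda>i. dsum q (t4 i))))"
    by (simp only: dsum2_diff[OF fin1 fin2] dsum2_diff[OF fin3 fin4])
  also have "\<dots> = (dsum p (\<lambda>i. dsum q (t1 i)) - alt q (dsum p (\<lambda>i. dsum q (t2 i))))
      - alt p (dsum q (\<lambda>j. dsum p (\<lambda>i. t3 i j)) - alt q (dsum q (\<lambda>j. dsum p (\<lambda>i. t4 i j))))"
    by (simp only: dsum_swap[OF fin3] dsum_swap[OF fin4])
  also have "\<dots> = right_comm A B C c w p q 0"
    unfolding right_comm_def Let_def C'_def[symmetric]
    by (simp add: res3_def ops_def t1_def[abs_def] t2_def[abs_def] t3_def[abs_def] t4_def[abs_def] alt_diff alt_alt)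
  finally show ?thesis .
qed

text \<open>With p = 0 the residue in x against (x - y)^n gives the product of A and B as a field in
  y, and the residue in y against (y - t)^q is taken afterwards.\<close>

lemma nprod_nprod_left:
  assumes "is_field A" "is_field B" "is_field C"
  shows "nprod q (nprod n A B) C c w = left_comm A B C c w 0 q n"
proof -
  define C' where "C' = shift (- c - 1) C"
  have C: "C x = C' (x - c - 1)" for x
    by (simp add: C'_def shift_def)
  have fC: "is_field C'"
    unfolding C'_def by (rule is_field_shift[OF assms(3)])
  define t1 where "t1 i j = A (-1 - of_int n + of_nat j) (B (-1 - of_int q - of_nat j + of_nat i)
    (C' (-1 - of_nat i) w))" for i j :: nat
  define t2 where "t2 i j = B (-1 - of_int n - of_int q + of_nat j + of_nat i) (A (-1 - of_nat j)
    (C' (-1 - of_nat i) w))" for i j :: nat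
  define t3 where "t3 i j = C' (-1 - of_int q + of_nat i) (A (-1 - of_int n + of_nat j)
    (B (-1 - of_nat i - of_nat j) w))" for i j :: nat
  define t4 where "t4 i j = C' (-1 - of_int q + of_nat i) (B (-1 - of_int n - of_nat i + of_nat j)
    (A (-1 - of_nat j) w))" for i j :: nat
  have fin1': "finite {(j, i). t1 i j \<noteq> 0}"
    using tame_finite2(2)[OF tame_ops[OF assms(1,2) fC]] by (simp add: t1_def ops_def)
  note fin1 = finite2_flip[OF fin1']
  have fin2': "finite {(j, i). t2 i j \<noteq> 0}"
    using tame_finite2(3)[OF tame_ops[OF assms(2,1) fC]] by (simp add: t2_def ops_def)
  note fin2 = finite2_flip[OF fin2']
  have fin3: "finite {(i, j). t3 i j \<noteq> 0}"
    using tame_finite2(1)[OF tame_ops[OF fC assms(1,2)]] by (simp add: t3_def ops_def)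
  have fin4: "finite {(i, j). t4 i j \<noteq> 0}"
    using tame_finite2(2)[OF tame_ops[OF fC assms(2,1)]] by (simp add: t4_def ops_def)
  have "nprod q (nprod n A B) C c w
    = dsum q (\<lambda>i. dsum n (\<lambda>j. A (-1 - of_int n + of_nat j)
          (B (-1 - of_int q + of_nat i - of_nat j) (C (c - of_nat i) w)))
        - alt n (dsum n (\<lambda>j. B (-1 - of_int q + of_nat i - of_int n + of_nat j)
          (A (-1 - of_nat j) (C (c - of_nat i) w)))))
      - alt q (dsum q (\<lambda>i. dsum n (\<lambda>j. C (c - of_int q + of_nat i) (A (-1 - of_int n + of_nat j)
          (B (-1 - of_nat i - of_nat j) w)))
        - alt n (dsum n (\<lambda>j. C (c - of_int q + of_nat i) (B (-1 - of_nat i - of_int n + of_nat j)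
          (A (-1 - of_nat j) w))))))"
    unfolding nprod_def
    by (simp only: field_diff[OF assms(3)] field_alt[OF assms(3)]
        field_dsum[OF assms(3) finite_nprod(1)[OF assms(1,2)]]
        field_dsum[OF assms(3) finite_nprod(2)[OF assms(1,2)]])
  also have "\<dots> = dsum q (\<lambda>i. dsum n (t1 i) - alt n (dsum n (t2 i)))
      - alt q (dsum q (\<lambda>i. dsum n (t3 i) - alt n (dsum n (t4 i))))"
    unfolding C t1_def[abs_def] t2_def[abs_def] t3_def[abs_def] t4_def[abs_def]
    by (simp add: algebra_simps, simp only: diff_conv_add_uminus minus_add_distrib add_ac)
  also have "\<dots> = (dsum q (\<lambda>i. dsum n (t1 i)) - alt n (dsum q (\<lambda>i. dsum n (t2 i))))
      - alt q (dsum q (\<lambda>i. dsum n (t3 i)) - alt n (dsum q (\<lambda>i. dsum n (t4 i))))"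
    by (simp only: dsum2_diff[OF fin1 fin2] dsum2_diff[OF fin3 fin4])
  also have "\<dots> = (dsum n (\<lambda>j. dsum q (\<lambda>i. t1 i j)) - alt n (dsum n (\<lambda>j. dsum q (\<lambda>i. t2 i j))))
      - alt q (dsum q (\<lambda>i. dsum n (t3 i)) - alt n (dsum q (\<lambda>i. dsum n (t4 i))))"
    by (simp only: dsum_swap[OF fin1] dsum_swap[OF fin2])
  also have "\<dots> = left_comm A B C c w 0 q n"
    unfolding left_comm_def Let_def C'_def[symmetric]
    by (simp add: res3_def ops_def t1_def[abs_def] t2_def[abs_def] t3_def[abs_def] t4_def[abs_def] alt_diff alt_alt)
  finally show ?thesis .
qed

text \<open>Dong's lemma\<close>

lemma local_nprod_left:
  assumes "triple k A B C"
  shows "local_fields (k + \<bar>k\<bar> + \<bar>k - n\<bar>) (nprod n A B) C"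
  unfolding local_fields_def
proof (intro allI impI)
  fix q e c w assume "k + \<bar>k\<bar> + \<bar>k - n\<bar> \<le> q"
  \<comment> \<open>A power of the variable of the product can be put on B, so every shift is
    covered by a left commutator at p = 0.\<close>
  moreover have "triple k A (shift e B) C"
    using triple_shift[OF assms, of 0 e 0] by simp
  ultimately show "nprod q (shift e (nprod n A B)) C c w = 0"
    using left_comm_vanish[of k A "shift e B" C 0 n q]
    by (simp add: shift_nprod nprod_nprod_left triple_def)
qed

text \<open>x = t + (x - t) under the residue, with t acting as a shift of the exponent c.\<close>

lemma nprod_rec:
  assumes "is_field A" "is_field B"
  shows "nprod n (shift 1 A) B c w = nprod n A B (c - 1) w + nprod (n + 1) A B c w"
proof -
  define G where "G i = A (-1 - of_int (n + 1) + of_nat i) (B (c - of_nat i) w)" for i :: nat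
  define H where "H i = B (c - of_int (n + 1) + of_nat i) (A (-1 - of_nat i) w)" for i :: nat
  have fin: "finite {i. G i \<noteq> 0}" "finite {i. H i \<noteq> 0}"
    unfolding G_def H_def by (rule finite_nprod[OF assms])+
  note fin' = fin[THEN finite_shift]
  have "nprod (n + 1) A B c w = dsum (n + 1) G + alt n (dsum (n + 1) H)"
    unfolding nprod_def G_def[abs_def] H_def[abs_def] alt_add1 diff_minus_eq_add ..
  also have "\<dots> = dsum n G - dsum n (\<lambda>i. G (Suc i)) + alt n (dsum n H) - alt n (dsum n (\<lambda>i. H (Suc i)))"
    by (simp only: dsum_pascal[OF fin(1)] dsum_pascal[OF fin(2)] dsum_diff[OF fin(1) fin'(1)]
        dsum_diff[OF fin(2) fin'(2)] alt_diff add_diff_eq)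
  finally have "nprod (n + 1) A B c w = dsum n G - dsum n (\<lambda>i. G (Suc i)) + alt n (dsum n H)
    - alt n (dsum n (\<lambda>i. H (Suc i)))" .
  moreover have "nprod n (shift 1 A) B c w = dsum n G - alt n (dsum n (\<lambda>i. H (Suc i)))"
    unfolding nprod_def shift_def G_def[abs_def] H_def[abs_def] by (simp add: algebra_simps)
  moreover have "nprod n A B (c - 1) w = dsum n (\<lambda>i. G (Suc i)) - alt n (dsum n H)"
    unfolding nprod_def G_def[abs_def] H_def[abs_def] by (simp add: algebra_simps)
  ultimately show ?thesis
    by simp
qed

text \<open>x^e = (t + (x - t))^e, expanded in nonnegative powers of x - t. For negative e the sum
  is finite by locality, and it is correct because it solves the recursion of
  \<open>nprod_rec\<close>.\<close>

lemma nprod_int_shift: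
  assumes "is_field A" "is_field B" "local_fields k A B"
  shows "nprod n (shift (of_int e) A) B c w
    = bsum (of_int e) (\<lambda>i. nprod (n + int i) A B (c - of_int e + of_nat i) w)"
proof -
  define H where "H n q = nprod n A B (c - of_int q) w" for n q
  define E where "E p q n = nprod n (shift (of_int p) A) B (c - of_int q) w" for p q n
  have "bsum (of_int e) (\<lambda>i. H (n + int i) (0 + e - int i)) = E e 0 n"
  proof (rule bsum_unique[where k = k])
    fix p q n
    show "E (p + 1) q n = E p (q + 1) n + E p q (n + 1)"
      using nprod_rec[OF is_field_shift[OF assms(1)] assms(2), of n "of_int p" "c - of_int q" w]
      by (simp add: E_def shift_shift add.commute diff_diff_eq)
  next
    show "H n q = 0" if "k \<le> n" for n q
      by (simp add: H_def local_nprod[OF assms(3) that])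
    show "E p q n = 0" if "k \<le> n" for p q n
      by (simp add: E_def local_nprod[OF local_shift(1)[OF assms(3)] that])
  qed (simp add: E_def H_def)
  then show ?thesis
    by (simp add: H_def E_def algebra_simps)
qed

lemma nprod_bsum_right:
  assumes A: "is_field A" and E: "\<And>l. is_field (E l)" and zero: "\<And>l c w. L \<le> l \<Longrightarrow> E l c w = 0"
  shows "nprod n A (\<lambda>c w. bsum b (\<lambda>l. E l c w)) c w = bsum b (\<lambda>l. nprod n A (E l) c w)"
proof -
  have fin: "finite {l. E l c w \<noteq> 0}" for c w
    by (rule finite_support_bound[of L]) (use zero in auto)
  have fin1: "finite {(l, i). A (-1 - of_int n + of_nat i) (E l (c - of_nat i) w) \<noteq> 0}"
    by (rule finite2_bounded_rows[of L]) (simp_all add: zero field_0 A finite_nprod E)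
  have fin2: "finite {(l, i). E l (c - of_int n + of_nat i) (A (-1 - of_nat i) w) \<noteq> 0}"
    by (rule finite2_bounded_rows[of L]) (simp_all add: zero finite_nprod E A)
  have "nprod n A (\<lambda>c w. bsum b (\<lambda>l. E l c w)) c w
    = bsum b (\<lambda>l. dsum n (\<lambda>i. A (-1 - of_int n + of_nat i) (E l (c - of_nat i) w)))
      - alt n (bsum b (\<lambda>l. dsum n (\<lambda>i. E l (c - of_int n + of_nat i) (A (-1 - of_nat i) w))))"
    unfolding nprod_def field_bsum[OF A fin]
    by (simp only: dsum_bsum_swap[OF finite2_flip[OF fin1]] dsum_bsum_swap[OF finite2_flip[OF fin2]])
  also have "\<dots> = bsum b (\<lambda>l. nprod n A (E l) c w)"
    unfolding nprod_def using finite_dsum_rows[OF fin1] finite_dsum_rows[OF fin2]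
    by (simp add: bsum_diff bsum_alt)
  finally show ?thesis .
qed

lemma nprod_bsum_left:
  assumes C: "is_field C" and E: "\<And>l. is_field (E l)" and zero: "\<And>l c w. L \<le> l \<Longrightarrow> E l c w = 0"
  shows "nprod n (\<lambda>c w. bsum b (\<lambda>l. E l c w)) C c w = bsum b (\<lambda>l. nprod n (E l) C c w)"
proof -
  have fin: "finite {l. E l c w \<noteq> 0}" for c w
    by (rule finite_support_bound[of L]) (use zero in auto)
  have fin1: "finite {(l, i). E l (-1 - of_int n + of_nat i) (C (c - of_nat i) w) \<noteq> 0}"
    by (rule finite2_bounded_rows[of L]) (simp_all add: zero finite_nprod E C)
  have fin2: "finite {(l, i). C (c - of_int n + of_nat i) (E l (-1 - of_nat i) w) \<noteq> 0}"
    by (rule finite2_bounded_rows[of L]) (simp_all add: zero field_0 C finite_nprod E)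
  have "nprod n (\<lambda>c w. bsum b (\<lambda>l. E l c w)) C c w
    = bsum b (\<lambda>l. dsum n (\<lambda>i. E l (-1 - of_int n + of_nat i) (C (c - of_nat i) w)))
      - alt n (bsum b (\<lambda>l. dsum n (\<lambda>i. C (c - of_int n + of_nat i) (E l (-1 - of_nat i) w))))"
    unfolding nprod_def field_bsum[OF C fin]
    by (simp only: dsum_bsum_swap[OF finite2_flip[OF fin1]] dsum_bsum_swap[OF finite2_flip[OF fin2]])
  also have "\<dots> = bsum b (\<lambda>l. nprod n (E l) C c w)"
    unfolding nprod_def using finite_dsum_rows[OF fin1] finite_dsum_rows[OF fin2]
    by (simp add: bsum_diff bsum_alt)
  finally show ?thesis .
qed

section \<open>Twisted products\<close>

text \<open>
  For a field A of degree j put \<alpha> = j/N.  Then shift \<alpha> A is x^\<alpha> A(x), which has integral exponents,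
  and the twisted products of A are obtained from the untwisted products of x^\<alpha> A(x) by the factor
  (1 + z/y)^(-\<alpha>) y^(-\<alpha>).
\<close>

definition tw_prod where
  "tw_prod \<alpha> n A B = (\<lambda>c w. bsum (- of_rat \<alpha>)
    (\<lambda>m. nprod (n + int m) (shift \<alpha> A) B (c + \<alpha> + of_nat m) w))"


lemma finite2_boundI:
  assumes "\<And>i j. M \<le> i \<Longrightarrow> G i j = 0" "\<And>i j. M \<le> j \<Longrightarrow> G i j = 0"
  shows "finite {(i::nat, j::nat). G i j \<noteq> 0}"
  using assms(1) by (rule finite2_bounded_rows) (use finite_support_bound[OF assms(2)] in auto)

lemma bsum2_add:
  assumes "finite {(i, j). G i j \<noteq> 0}" "finite {(i, j). H i j \<noteq> 0}"
  shows "bsum a (\<lambda>i. bsum b (\<lambda>j. G i j + H i j)) = bsum a (\<lambda>i. bsum b (G i)) + bsum a (\<lambda>i. bsum b (H i))"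
  by (simp only: bsum_add[OF finite2_row[OF assms(1)] finite2_row[OF assms(2)]]
      bsum_add[OF finite_bsum_rows[OF assms(1)] finite_bsum_rows[OF assms(2)]])

lemma bsum2_diff:
  assumes "finite {(i, j). G i j \<noteq> 0}" "finite {(i, j). H i j \<noteq> 0}"
  shows "bsum a (\<lambda>i. bsum b (\<lambda>j. G i j - H i j)) = bsum a (\<lambda>i. bsum b (G i)) - bsum a (\<lambda>i. bsum b (H i))"
  by (simp only: bsum_diff[OF finite2_row[OF assms(1)] finite2_row[OF assms(2)]]
      bsum_diff[OF finite_bsum_rows[OF assms(1)] finite_bsum_rows[OF assms(2)]])

lemma bsum_of_nat_cong:
  assumes "\<And>i. i \<le> n \<Longrightarrow> G i = H i"
  shows "bsum (of_nat n) G = bsum (of_nat n) H"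
  using assms by (simp add: bsum_of_nat)

text \<open>In terms of the shifts S and T of the two indices, both sides are (1 + T)^b (1 + S +
  T)^a, the second factor being expanded in powers of S + T on the left and in powers of S on the
  right.\<close>

lemma bsum_trinomial2:
  assumes "finite {(i, j). Q i j \<noteq> 0}"
  shows "bsum a (\<lambda>m. bsum b (\<lambda>l. bsum (of_nat m) (\<lambda>i. Q i (l + (m - i)))))
    = bsum a (\<lambda>e. bsum (b + (a - of_nat e)) (Q e))"
proof -
  obtain M where M: "\<And>i j. M \<le> i \<Longrightarrow> Q i j = 0" "\<And>i j. M \<le> j \<Longrightarrow> Q i j = 0"
    using finite2_bound[OF assms] by metis
  have zero: "Q i (l + (m - i)) = 0" if "2 * M \<le> m \<or> 2 * M \<le> l" for m l i
    using that by (cases "M \<le> i") (auto simp: M)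
  have fin: "finite {(m, l). bsum (of_nat m) (\<lambda>i. Q i (l + (m - i))) \<noteq> 0}"
    by (rule finite2_boundI[of "2 * M"]) (simp_all add: zero)
  have finl: "finite {(i, j). Q i (l + j) \<noteq> 0}" for l
    by (rule finite2_boundI[of M]) (simp_all add: M)
  have fin': "finite {(l, e). bsum (a - of_nat e) (\<lambda>j. Q e (l + j)) \<noteq> 0}"
    by (rule finite2_boundI[of M]) (simp_all add: M)
  have "bsum a (\<lambda>m. bsum b (\<lambda>l. bsum (of_nat m) (\<lambda>i. Q i (l + (m - i)))))
    = bsum b (\<lambda>l. bsum a (\<lambda>m. bsum (of_nat m) (\<lambda>i. Q i (l + (m - i)))))"
    by (rule bsum_swap[OF fin])
  also have "\<dots> = bsum b (\<lambda>l. bsum a (\<lambda>e. bsum (a - of_nat e) (\<lambda>j. Q e (l + j))))"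
    by (rule bsum_cong, rule bsum_trinomial[OF finl])
  also have "\<dots> = bsum a (\<lambda>e. bsum b (\<lambda>l. bsum (a - of_nat e) (\<lambda>j. Q e (l + j))))"
    by (rule bsum_swap[OF fin'])
  also have "\<dots> = bsum a (\<lambda>e. bsum (b + (a - of_nat e)) (Q e))"
    by (rule bsum_cong, rule bsum_vandermonde[OF finite2_row[OF assms]])
  finally show ?thesis .
qed

lemma right_comm_finite:
  assumes "triple k A B C"
  shows "finite {(m, l). right_comm A B C (c m l) w (p + int m) (q + int l) n \<noteq> 0}"
proof (rule finite2_flip, rule finite2_bounded_rows)
  show "right_comm A B C (c m l) w (p + int m) (q + int l) n = 0" if "nat (k - q) \<le> l" for l m
    using that by (intro right_comm_vanish_q[OF assms]) auto
  show "finite {m. right_comm A B C (c m l) w (p + int m) (q + int l) n \<noteq> 0}" for l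
    by (rule finite_support_bound[of "nat (k + \<bar>k - n\<bar> + \<bar>k - (q + int l)\<bar> - p)"])
      (auto intro!: right_comm_vanish[OF assms])
qed

lemma left_comm_finite:
  assumes "triple k A B C"
  shows "finite {(m, l). left_comm A B C (c m l) w (p + int m) (q + int l) n \<noteq> 0}"
proof (rule finite_subset)
  show "{(m, l). left_comm A B C (c m l) w (p + int m) (q + int l) n \<noteq> 0}
    \<subseteq> {(m, l). right_comm A B C (c m l) w (p + int m) (q + int l) n \<noteq> 0}
      \<union> {(m, l). right_comm B A C (c m l) w (q + int l) (p + int m) n \<noteq> 0}"
    by (auto simp: left_comm_eq)
  show "finite \<dots>"
    using right_comm_finite[OF assms]
      finite2_flip[OF right_comm_finite[OF triple_commute[OF assms], of "\<lambda>l m. c m l"]]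
    by simp
qed

lemma left_comm_expand:
  assumes "triple k A B C"
  shows "left_comm A B C c w p q n
    = bsum (of_int p) (\<lambda>i. left_comm A B C c w 0 (q + p - int i) (n + int i))"
  by (rule bsum_unique[where k = k and E = "left_comm A B C c w", symmetric])
    (simp_all add: left_comm_vanish_n[OF assms] left_comm_rec[OF assms])

text \<open>The twisting factors contribute powers of t only; they pass through the outer product as
  shifts and leave a double binomial sum of untwisted iterated products.\<close>

lemma tw_prod_tw_prod_right:
  assumes "triple k A B C"
  shows "tw_prod \<alpha> p A (tw_prod \<beta> q B C) c w
    = bsum (- of_rat \<alpha>) (\<lambda>m. bsum (- of_rat \<beta>) (\<lambda>l.
      right_comm (shift \<alpha> A) (shift \<beta> B) C (c + \<alpha> + \<beta> + of_nat m + of_nat l) w (p + int m) (q + int l) 0))"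
proof -
  let ?A = "shift \<alpha> A" and ?B = "shift \<beta> B"
  have tri: "triple k ?A ?B C"
    using triple_shift[OF assms, of \<alpha> \<beta> 0] by simp
  note f = tripleD(1-3)[OF tri] and loc = tripleD(8)[OF tri]
  define E where "E l = shift (- \<beta> - of_nat l) (nprod (q + int l) ?B C)" for l
  have fE: "is_field (E l)" for l
    unfolding E_def by (intro is_field_shift is_field_nprod f)
  have zero: "E l c w = 0" if "nat (k - q) \<le> l" for l c w
    using that by (simp add: E_def shift_apply local_nprod[OF loc])
  have D: "tw_prod \<beta> q B C = (\<lambda>c w. bsum (- of_rat \<beta>) (\<lambda>l. E l c w))"
    by (simp add: tw_prod_def E_def shift_apply algebra_simps)
  have R: "nprod n ?A (\<lambda>c w. bsum b (\<lambda>l. E l c w)) c w = bsum b (\<lambda>l. nprod n ?A (E l) c w)" for n b c w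
    by (rule nprod_bsum_right[OF f(1) fE zero])
  show ?thesis
    unfolding D unfolding tw_prod_def R
    by (simp add: E_def nprod_shift nprod_nprod_right f algebra_simps)
qed

text \<open>The binomial coefficients of the twisting do not involve p, q and n, so the double sum
  inherits the recursion of \<open>right_comm\<close> and is determined by its values at n =
  0.\<close>

lemma dsum_tw_prod:
  assumes "triple k A B C"
  shows "dsum n (\<lambda>i. tw_prod \<alpha> (p + n - int i) A (tw_prod \<beta> (q + int i) B C) c w)
    = bsum (- of_rat \<alpha>) (\<lambda>m. bsum (- of_rat \<beta>) (\<lambda>l.
      right_comm (shift \<alpha> A) (shift \<beta> B) C (c + \<alpha> + \<beta> + of_nat m + of_nat l) w (p + int m) (q + int l) n))"
proof -
  have tri: "triple k (shift \<alpha> A) (shift \<beta> B) C"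
    using triple_shift[OF assms, of \<alpha> \<beta> 0] by simp
  define E where "E p q n = bsum (- of_rat \<alpha>) (\<lambda>m. bsum (- of_rat \<beta>) (\<lambda>l.
      right_comm (shift \<alpha> A) (shift \<beta> B) C (c + \<alpha> + \<beta> + of_nat m + of_nat l) w (p + int m) (q + int l) n))"
    for p q n
  have "dsum n (\<lambda>i. tw_prod \<alpha> (p + n - int i) A (tw_prod \<beta> (q + int i) B C) c w) = E p q n"
  proof (rule dsum_unique[where k = k and H = "\<lambda>p q. tw_prod \<alpha> p A (tw_prod \<beta> q B C) c w"])
    show "tw_prod \<alpha> p A (tw_prod \<beta> q B C) c w = 0" if "k \<le> q" for p q
      using that by (simp add: tw_prod_tw_prod_right[OF assms] right_comm_vanish_q[OF tri])
    show "E p q n = 0" if "k \<le> q" for p q n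
      using that by (simp add: E_def right_comm_vanish_q[OF tri])
    show "E p q 0 = tw_prod \<alpha> p A (tw_prod \<beta> q B C) c w" for p q
      by (simp add: E_def tw_prod_tw_prod_right[OF assms])
    have "right_comm (shift \<alpha> A) (shift \<beta> B) C x w (p + 1 + int m) (q + int l) n
      = right_comm (shift \<alpha> A) (shift \<beta> B) C x w (p + int m) (q + 1 + int l) n
        + right_comm (shift \<alpha> A) (shift \<beta> B) C x w (p + int m) (q + int l) (n + 1)" for x p q n m l
      using right_comm_rec[OF tri, of x w "p + int m" "q + int l" n] by (simp add: add_ac)
    then show "E (p + 1) q n = E p (q + 1) n + E p q (n + 1)" for p q n
      unfolding E_def bsum2_add[OF right_comm_finite[OF tri] right_comm_finite[OF tri], symmetric]
      by simp
  qed
  then show ?thesis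
    by (simp add: E_def)
qed

text \<open>The twisting sums are symmetric under exchanging the two fields, so
  \<open>left_comm_eq\<close> applies inside them.\<close>

lemma tw_prod_commutator:
  assumes "triple k A B C"
  shows "dsum n (\<lambda>i. tw_prod \<alpha> (p + n - int i) A (tw_prod \<beta> (q + int i) B C) c w)
      - alt n (dsum n (\<lambda>i. tw_prod \<beta> (q + n - int i) B (tw_prod \<alpha> (p + int i) A C) c w))
    = bsum (- of_rat \<alpha>) (\<lambda>m. bsum (- of_rat \<beta>) (\<lambda>l.
      left_comm (shift \<alpha> A) (shift \<beta> B) C (c + \<alpha> + \<beta> + of_nat m + of_nat l) w (p + int m) (q + int l) n))"
proof -
  let ?A = "shift \<alpha> A" and ?B = "shift \<beta> B" and ?c = "\<lambda>m l. c + \<alpha> + \<beta> + of_nat m + of_nat l"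
  have tri: "triple k ?A ?B C"
    using triple_shift[OF assms, of \<alpha> \<beta> 0] by simp
  define G where "G l m = right_comm ?B ?A C (?c m l) w (q + int l) (p + int m) n" for l m
  have fin: "finite {(l, m). G l m \<noteq> 0}"
    unfolding G_def by (rule right_comm_finite[OF triple_commute[OF tri]])
  have fin': "finite {(m, l). alt n (G l m) \<noteq> 0}"
    using finite2_flip[OF fin] by simp
  have "alt n (dsum n (\<lambda>i. tw_prod \<beta> (q + n - int i) B (tw_prod \<alpha> (p + int i) A C) c w))
    = alt n (bsum (- of_rat \<beta>) (\<lambda>l. bsum (- of_rat \<alpha>) (G l)))"
    unfolding dsum_tw_prod[OF triple_commute[OF assms]] G_def[abs_def] by (simp add: add_ac)
  also have "\<dots> = bsum (- of_rat \<alpha>) (\<lambda>m. bsum (- of_rat \<beta>) (\<lambda>l. alt n (G l m)))"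
    by (simp only: bsum_swap[OF fin] bsum_alt)
  finally show ?thesis
    unfolding dsum_tw_prod[OF assms] left_comm_eq bsum2_diff[OF right_comm_finite[OF tri] fin'[unfolded G_def]]
    by (simp add: G_def)
qed

text \<open>Multiplied by y^\<delta>, the inner product becomes a sum of untwisted products of the
  shifted fields times y^(e - m). This integral power is expanded around t and merged with the outer
  twisting factor: the exponents -\<delta> and e - m add up to -\<alpha> - \<beta> - m, so e
  disappears.\<close>

lemma tw_prod_tw_prod_left:
  assumes "triple k A B C" and \<delta>: "\<delta> - \<alpha> - \<beta> = of_int e"
  shows "tw_prod \<delta> q (tw_prod \<alpha> n A B) C c w
    = bsum (- of_rat \<alpha>) (\<lambda>m. bsum (- of_rat \<beta>) (\<lambda>l.
      left_comm (shift \<alpha> A) (shift \<beta> B) C (c + \<alpha> + \<beta> + of_nat m + of_nat l) w (int m) (q + int l) n))"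
proof -
  let ?A = "shift \<alpha> A" and ?B = "shift \<beta> B"
  have tri: "triple k ?A ?B C"
    using triple_shift[OF assms(1), of \<alpha> \<beta> 0] by simp
  note f = tripleD(1-3)[OF tri] and loc = tripleD(5)[OF tri]
  define F where "F m = nprod (n + int m) ?A ?B" for m
  define E where "E m = shift (of_int (e - int m)) (F m)" for m
  define Q where "Q m j = left_comm ?A ?B C (c + \<alpha> + \<beta> + of_nat m + of_nat j) w 0 (q + int j) (n + int m)"
    for m j :: nat
  have finQ: "finite {(m, j). Q m j \<noteq> 0}"
  proof (rule finite2_bounded_rows)
    show "Q m j = 0" if "nat (k - n) \<le> m" for m j
      using that by (simp add: Q_def left_comm_vanish_n[OF tri])
    show "finite {j. Q m j \<noteq> 0}" for m
      by (rule finite_support_bound[of "nat (k + \<bar>k\<bar> + \<bar>k - (n + int m)\<bar> - q)"])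
        (auto simp: Q_def intro!: left_comm_vanish[OF tri])
  qed
  have fF: "is_field (F m)" and fE: "is_field (E m)" for m
    unfolding E_def F_def by (intro is_field_shift is_field_nprod f)+
  have zero: "E m c w = 0" if "nat (k - n) \<le> m" for m c w
    using that by (simp add: E_def F_def shift_apply local_nprod[OF loc])
  have D: "shift \<delta> (tw_prod \<alpha> n A B) = (\<lambda>c w. bsum (- of_rat \<alpha>) (\<lambda>m. E m c w))"
  proof (intro ext)
    fix c w
    have B: "nprod (n + int m) ?A B x = F m (x + \<beta>)" for m x
      by (simp add: F_def nprod_shift)
    have eq: "c - \<delta> + \<alpha> + of_nat m + \<beta> = c - of_int (e - int m)" for m
      using \<delta> by (simp add: algebra_simps)
    show "shift \<delta> (tw_prod \<alpha> n A B) c w = bsum (- of_rat \<alpha>) (\<lambda>m. E m c w)"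
      by (simp only: tw_prod_def B shift_apply E_def eq)
  qed
  have R: "nprod n (\<lambda>c w. bsum b (\<lambda>m. E m c w)) C c w = bsum b (\<lambda>m. nprod n (E m) C c w)" for n b c w
    by (rule nprod_bsum_left[OF f(3) fE zero])
  have "tw_prod \<delta> q (tw_prod \<alpha> n A B) C c w
    = bsum (- of_rat \<delta>) (\<lambda>l. bsum (- of_rat \<alpha>) (\<lambda>m. nprod (q + int l) (E m) C (c + \<delta> + of_nat l) w))"
    unfolding tw_prod_def[of \<delta>] D R ..
  also have "\<dots> = bsum (- of_rat \<delta>) (\<lambda>l. bsum (- of_rat \<alpha>) (\<lambda>m.
      bsum (of_int (e - int m)) (\<lambda>i. Q m (l + i))))"
  proof (intro bsum_cong)
    fix l m
    have eq: "c + \<delta> + of_nat l - of_int (e - int m) + of_nat i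
      = c + \<alpha> + \<beta> + of_nat m + of_nat (l + i)" for i
      using \<delta> by (simp add: algebra_simps)
    \<comment> \<open>Dong's lemma makes the product local to C, so multiplication by the power y^(e
      - m) can be expanded around t.\<close>
    have "local_fields (k + \<bar>k\<bar> + \<bar>k - (n + int m)\<bar>) (F m) C"
      unfolding F_def by (rule local_nprod_left[OF tri])
    then have "nprod (q + int l) (E m) C (c + \<delta> + of_nat l) w
      = bsum (of_int (e - int m)) (\<lambda>i. nprod (q + int l + int i) (F m) C
          (c + \<alpha> + \<beta> + of_nat m + of_nat (l + i)) w)"
      unfolding E_def eq[symmetric] by (rule nprod_int_shift[OF fF f(3)])
    also have "\<dots> = bsum (of_int (e - int m)) (\<lambda>i. Q m (l + i))"
      by (simp add: F_def nprod_nprod_left f Q_def add_ac)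
    finally show "nprod (q + int l) (E m) C (c + \<delta> + of_nat l) w
      = bsum (of_int (e - int m)) (\<lambda>i. Q m (l + i))" .
  qed
  also have "\<dots> = bsum (- of_rat \<alpha>) (\<lambda>m. bsum (- of_rat \<delta>) (\<lambda>l.
      bsum (of_int (e - int m)) (\<lambda>i. Q m (l + i))))"
  proof (rule bsum_swap)
    obtain M where M: "\<And>i j. M \<le> i \<Longrightarrow> Q i j = 0" "\<And>i j. M \<le> j \<Longrightarrow> Q i j = 0"
      using finite2_bound[OF finQ] by metis
    show "finite {(l, m). bsum (of_int (e - int m)) (\<lambda>i. Q m (l + i)) \<noteq> 0}"
      by (rule finite2_boundI[of M]) (simp_all add: M)
  qed
  also have "\<dots> = bsum (- of_rat \<alpha>) (\<lambda>m. bsum (- of_rat \<delta> + of_int (e - int m)) (Q m))"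
    by (rule bsum_cong, rule bsum_vandermonde[OF finite2_row[OF finQ]])
  also have "\<dots> = bsum (- of_rat \<alpha>) (\<lambda>m. bsum (- of_rat \<beta> + (- of_rat \<alpha> - of_nat m)) (Q m))"
  proof -
    have "\<delta> = \<alpha> + \<beta> + of_int e"
      using \<delta> by (simp add: algebra_simps)
    then have "- of_rat \<delta> + of_int (e - int m)
      = (- of_rat \<beta> + (- of_rat \<alpha> - of_nat m) :: complex)" for m
      by (simp add: of_rat_add)
    then show ?thesis
      by (simp only:)
  qed
  also have "\<dots> = bsum (- of_rat \<alpha>) (\<lambda>m. bsum (- of_rat \<beta>) (\<lambda>l.
      bsum (of_nat m) (\<lambda>i. Q i (l + (m - i)))))"
    by (rule bsum_trinomial2[OF finQ, symmetric])
  also have "\<dots> = bsum (- of_rat \<alpha>) (\<lambda>m. bsum (- of_rat \<beta>) (\<lambda>l.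
      left_comm ?A ?B C (c + \<alpha> + \<beta> + of_nat m + of_nat l) w (int m) (q + int l) n))"
  proof (intro bsum_cong)
    fix m l
    \<comment> \<open>The sum over i reassembles (x - t)^m = ((y - t) + (x - y))^m, which leads from
      the values at p = 0 to the value at p = m.\<close>
    have "bsum (of_nat m) (\<lambda>i. Q i (l + (m - i)))
      = bsum (of_nat m) (\<lambda>i. left_comm ?A ?B C (c + \<alpha> + \<beta> + of_nat m + of_nat l) w 0
          (q + int l + int m - int i) (n + int i))"
      by (rule bsum_of_nat_cong) (simp add: Q_def of_nat_diff algebra_simps)
    then show "bsum (of_nat m) (\<lambda>i. Q i (l + (m - i)))
      = left_comm ?A ?B C (c + \<alpha> + \<beta> + of_nat m + of_nat l) w (int m) (q + int l) n"
      using left_comm_expand[OF tri, of _ w "int m" "q + int l" n] by simp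
  qed
  finally show ?thesis .
qed

text \<open>Both sides are the same twisted double sum of \<open>left_comm\<close>: the left by the
  operator identity, the right by solving the recursion in p from p = 0, where the double sum is the
  iterated product.\<close>

lemma tw_prod_jacobi:
  assumes "triple k A B C" and \<delta>: "\<delta> - \<alpha> - \<beta> \<in> \<int>"
  shows "dsum n (\<lambda>i. tw_prod \<alpha> (p + n - int i) A (tw_prod \<beta> (q + int i) B C) c w)
      - alt n (dsum n (\<lambda>i. tw_prod \<beta> (q + n - int i) B (tw_prod \<alpha> (p + int i) A C) c w))
    = bsum (of_int p) (\<lambda>i. tw_prod \<delta> (q + p - int i) (tw_prod \<alpha> (n + int i) A B) C c w)"
proof -
  obtain e where e: "\<delta> - \<alpha> - \<beta> = of_int e"
    using \<delta> by (rule Ints_cases)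
  have tri: "triple k (shift \<alpha> A) (shift \<beta> B) C"
    using triple_shift[OF assms(1), of \<alpha> \<beta> 0] by simp
  define E where "E p q n = bsum (- of_rat \<alpha>) (\<lambda>m. bsum (- of_rat \<beta>) (\<lambda>l.
      left_comm (shift \<alpha> A) (shift \<beta> B) C (c + \<alpha> + \<beta> + of_nat m + of_nat l) w (p + int m) (q + int l) n))"
    for p q n
  have "bsum (of_int p) (\<lambda>i. tw_prod \<delta> (q + p - int i) (tw_prod \<alpha> (n + int i) A B) C c w) = E p q n"
  proof (rule bsum_unique[where k = k and H = "\<lambda>n q. tw_prod \<delta> q (tw_prod \<alpha> n A B) C c w"])
    show "tw_prod \<delta> q (tw_prod \<alpha> n A B) C c w = 0" if "k \<le> n" for n q
      using that by (simp add: tw_prod_tw_prod_left[OF assms(1) e] left_comm_vanish_n[OF tri])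
    show "E p q n = 0" if "k \<le> n" for p q n
      using that by (simp add: E_def left_comm_vanish_n[OF tri])
    show "E 0 q n = tw_prod \<delta> q (tw_prod \<alpha> n A B) C c w" for q n
      by (simp add: E_def tw_prod_tw_prod_left[OF assms(1) e])
    have "left_comm (shift \<alpha> A) (shift \<beta> B) C x w (p + 1 + int m) (q + int l) n
      = left_comm (shift \<alpha> A) (shift \<beta> B) C x w (p + int m) (q + 1 + int l) n
        + left_comm (shift \<alpha> A) (shift \<beta> B) C x w (p + int m) (q + int l) (n + 1)" for x p q n m l
      using left_comm_rec[OF tri, of x w "p + int m" "q + int l" n] by (simp add: add_ac)
    then show "E (p + 1) q n = E p (q + 1) n + E p q (n + 1)" for p q n
      unfolding E_def bsum2_add[OF left_comm_finite[OF tri] left_comm_finite[OF tri], symmetric]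
      by simp
  qed
  then show ?thesis
    by (simp add: tw_prod_commutator[OF assms(1)] E_def)
qed

section \<open>Passing between twisted and untwisted products\<close>

lemma nprod_shift_finite:
  assumes "local_fields k A B"
  shows "finite {j. nprod (n + int j) (shift \<alpha> A) B (c j) w \<noteq> 0}"
  by (rule finite_support_bound[of "nat (k - n)"]) (auto intro!: local_nprod[OF local_shift(1)[OF assms]])

text \<open>As p + \<alpha> is an integer, the binomial exponents -p - 1 and -\<alpha> add up to an
  integer, and the sum expands an integral power of x; this undoes the twisting. It will evaluate
  the right-hand side of the twisted Jacobi identity at x0^p.\<close>

lemma bsum_tw_prod:
  assumes "is_field A" "is_field B" "local_fields k A B" and p: "p + \<alpha> \<in> \<int>"
  shows "bsum (of_rat (- p - 1)) (\<lambda>i. tw_prod \<alpha> (n + int i) A B (q + p + 1 + of_nat i) w)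
    = nprod n (shift (- 1 - p) A) B q w"
proof -
  obtain d where d: "p + \<alpha> = of_int d"
    using p by (rule Ints_cases)
  have e: "- 1 - p = of_int (- d - 1) + \<alpha>"
    using d by simp
  define Q where "Q j = nprod (n + int j) (shift \<alpha> A) B (q - of_int (- d - 1) + of_nat j) w" for j
  have "bsum (of_rat (- p - 1)) (\<lambda>i. tw_prod \<alpha> (n + int i) A B (q + p + 1 + of_nat i) w)
    = bsum (of_rat (- p - 1)) (\<lambda>i. bsum (- of_rat \<alpha>) (\<lambda>m. Q (i + m)))"
  proof (intro bsum_cong)
    have eq: "q + p + 1 + of_nat i + \<alpha> + of_nat m = q - of_int (- d - 1) + of_nat (i + m)" for i m
      using d by (simp add: algebra_simps)
    then show "tw_prod \<alpha> (n + int i) A B (q + p + 1 + of_nat i) w = bsum (- of_rat \<alpha>) (\<lambda>m. Q (i + m))" for i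
      unfolding tw_prod_def Q_def eq by (simp add: add.assoc)
  qed
  also have "\<dots> = bsum (of_rat (- p - 1) + - of_rat \<alpha>) Q"
    by (rule bsum_vandermonde) (simp add: Q_def nprod_shift_finite[OF assms(3)])
  also have "of_rat (- p - 1) + - of_rat \<alpha> = (of_int (- d - 1) :: complex)"
  proof -
    have "of_rat (- p - 1) + - of_rat \<alpha> = (of_rat (- (p + \<alpha>) - 1) :: complex)"
      by (simp add: of_rat_add of_rat_diff of_rat_minus)
    then show ?thesis
      unfolding d by (simp add: of_rat_diff of_rat_minus)
  qed
  also have "bsum (of_int (- d - 1)) Q = nprod n (shift (of_int (- d - 1)) (shift \<alpha> A)) B q w"
    unfolding Q_def
    by (rule nprod_int_shift[OF is_field_shift[OF assms(1)] assms(2) local_shift(1)[OF assms(3)], symmetric])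
  finally show ?thesis
    by (simp only: shift_shift e)
qed

text \<open>The right-hand side is the defining residue, with (x - z)^\<alpha> expanded in powers of
  z. Under the residue x stands for y + z, and \<open>bsum_neg\<close> is the identity (1 - z/(y +
  z))^\<alpha> = (1 + z/y)^(-\<alpha>).\<close>

lemma tw_prod_eq:
  assumes "is_field A" "is_field B" "local_fields k A B"
  shows "tw_prod \<alpha> n A B c w
    = bsum (of_rat \<alpha>) (\<lambda>i. alt (int i) (nprod (n + int i) (shift (\<alpha> - of_nat i) A) B (c + \<alpha>) w))"
proof -
  define Q where "Q j = nprod (n + int j) (shift \<alpha> A) B (c + \<alpha> + of_nat j) w" for j
  have "nprod (n + int i) (shift (\<alpha> - of_nat i) A) B (c + \<alpha>) w
    = bsum (- of_nat i) (\<lambda>j. Q (i + j))" for i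
    using nprod_int_shift[OF is_field_shift[OF assms(1)] assms(2) local_shift(1)[OF assms(3)],
        of "n + int i" "- int i" \<alpha> "c + \<alpha>" w]
    by (simp add: Q_def shift_shift add_ac)
  then have "bsum (of_rat \<alpha>) (\<lambda>i. alt (int i) (nprod (n + int i) (shift (\<alpha> - of_nat i) A) B (c + \<alpha>) w))
    = bsum (of_rat \<alpha>) (\<lambda>i. alt (int i) (bsum (- of_nat i) (\<lambda>j. Q (i + j))))"
    by simp
  also have "\<dots> = bsum (- of_rat \<alpha>) Q"
    by (rule bsum_neg) (simp add: Q_def nprod_shift_finite[OF assms(3)])
  finally show ?thesis
    by (simp add: tw_prod_def Q_def[abs_def])
qed

end

section \<open>Coefficients of the delta function products\<close>

lemma Sum_any_reindex_inj:
  assumes "inj g" and "\<And>d. d \<notin> range g \<Longrightarrow> F d = 0"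
  shows "Sum_any F = Sum_any (\<lambda>i. F (g i))"
proof -
  have "{d. F d \<noteq> 0} = g ` {i. F (g i) \<noteq> 0}"
  proof (intro set_eqI iffI)
    fix d assume d: "d \<in> {d. F d \<noteq> 0}"
    then obtain i where "d = g i"
      using assms(2)[of d] by auto
    with d show "d \<in> g ` {i. F (g i) \<noteq> 0}"
      by simp
  qed auto
  moreover have "inj_on g {i. F (g i) \<noteq> 0}"
    using assms(1) by (rule inj_on_subset) simp
  ultimately show ?thesis
    unfolding Sum_any.expand_set by (simp only: sum.reindex o_def)
qed

lemma binom_exp_at: "binom_exp \<alpha> (\<alpha> - of_nat i) (of_nat i) = (-1) ^ i * (of_rat \<alpha> gchoose i)"
proof -
  have "{k. \<alpha> - of_nat i = \<alpha> - of_nat k \<and> (of_nat i :: rat) = of_nat k} = {i}"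
    by auto
  then show ?thesis
    by (simp add: binom_exp_def)
qed

lemma binom_exp_zero:
  assumes "\<And>i. p = \<alpha> - of_nat i \<Longrightarrow> q \<noteq> of_nat i"
  shows "binom_exp \<alpha> p q = 0"
proof -
  have "{i. p = \<alpha> - of_nat i \<and> q = of_nat i} = {}"
    using assms by auto
  then show ?thesis
    unfolding binom_exp_def by (simp only: sum.empty)
qed

lemma single_index: "{k::int. - of_int n - 1 = - of_int k - (1::rat)} = {n}"
  by auto

lemma no_index:
  assumes "c \<notin> \<int>"
  shows "{k::int. (c::rat) = - of_int k - 1} = {}"
proof -
  have "- of_int k - (1::rat) \<in> \<int>" for k :: int
    by simp
  then show ?thesis
    using assms by fastforce
qed

lemma delta_at:
  "delta_xy (- of_int n - 1, p, q) = binom_exp (of_int n) p q"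
  "delta_yx (- of_int n - 1, p, q) = (-1) powi n * binom_exp (of_int n) q p"
  "delta_xz (p, q, - of_int n - 1) = binom_exp (of_int n) q p"
  by (simp_all only: delta_xy_def delta_yx_def delta_xz_def prod.case single_index
      sum.insert sum.empty finite.intros empty_iff simp_thms add_0_right)

lemma delta_zero:
  assumes "c \<notin> \<int>"
  shows "delta_xy (c, p, q) = 0" "delta_yx (c, p, q) = 0" "delta_xz (p, q, c) = 0"
  by (simp_all only: delta_xy_def delta_yx_def delta_xz_def prod.case no_index[OF assms] sum.empty)

lemma delta_root_at:
  assumes "N > 0"
  shows "delta_xz_root N j (p, q, - (of_int n / of_nat N) - 1)
    = (omega N ^ j) powi n * binom_exp (of_int n / of_nat N) q p"
proof -
  have "{k::int. - (of_int n / of_nat N) - 1 = - (of_int k / of_nat N) - (1::rat)} = {n}"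
    using assms by (auto simp: field_simps)
  then show ?thesis
    by (simp only: delta_xz_root_def prod.case sum.insert sum.empty finite.intros empty_iff
        simp_thms add_0_right)
qed

lemma delta_root_zero:
  assumes "\<And>n::int. c \<noteq> - (of_int n / of_nat N) - 1"
  shows "delta_xz_root N j (p, q, c) = 0"
proof -
  have "{k::int. c = - (of_int k / of_nat N) - 1} = {}"
    using assms by auto
  then show ?thesis
    by (simp only: delta_xz_root_def prod.case sum.empty)
qed

lemma omega_power:
  assumes "N > 0"
  shows "omega N ^ N = 1"
proof -
  have "omega N ^ N = exp (of_nat N * (2 * of_real pi * \<i> / of_nat N))"
    by (simp only: omega_def exp_of_nat_mult)
  also have "of_nat N * (2 * of_real pi * \<i> / of_nat N) = 2 * of_real pi * \<i>"
    using assms by simp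
  finally show ?thesis
    by simp
qed

context complex_space
begin

text \<open>For a fixed coefficient, the monomials of the scalar series that can meet a nonzero
  coefficient of F form a family parametrized by \<open>g\<close>. In the applications below its
  index is the power of the second variable of a binomial.\<close>

lemma series_mult_reindex:
  assumes "inj g" and "\<And>d. d \<notin> range g \<Longrightarrow> f d = 0 \<or> F (e - d) m l w = 0"
  shows "series_mult s f F e m l w = Sum_any (\<lambda>i. s (f (g i)) (F (e - g i) m l w))"
  unfolding series_mult_def
  by (rule Sum_any_reindex_inj) (use assms in auto)

lemma series_mult_delta_xy:
  assumes "\<And>c p q. c \<noteq> 0 \<Longrightarrow> F (c, p, q) m l w = 0"
  shows "series_mult s delta_xy F (- of_int n - 1, p, q) m l w
    = dsum n (\<lambda>i. F (0, p - of_int n + of_nat i, q - of_nat i) m l w)"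
proof -
  define g where "g i = (- of_int n - 1 :: rat, of_int n - of_nat i :: rat, of_nat i :: rat)" for i :: nat
  have zero: "delta_xy d = 0 \<or> F ((- of_int n - 1, p, q) - d) m l w = 0" if "d \<notin> range g" for d
  proof -
    obtain c1 p1 q1 where d: "d = (c1, p1, q1)"
      by (rule prod_cases3)
    show ?thesis
    proof (cases "c1 = - of_int n - 1")
      case True
      have "binom_exp (of_int n) p1 q1 = 0"
        by (rule binom_exp_zero) (use that d True in \<open>auto simp: g_def\<close>)
      then show ?thesis
        by (simp only: d True delta_at simp_thms)
    next
      case False
      then show ?thesis
        by (simp add: d assms)
    qed
  qed
  have "inj g"
    by (auto simp: g_def inj_def)
  then have "series_mult s delta_xy F (- of_int n - 1, p, q) m l w
    = Sum_any (\<lambda>i. s (delta_xy (g i)) (F ((- of_int n - 1, p, q) - g i) m l w))"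
    using zero by (rule series_mult_reindex)
  also have "\<dots> = dsum n (\<lambda>i. F (0, p - of_int n + of_nat i, q - of_nat i) m l w)"
    unfolding dsum_def bsum_def g_def delta_at binom_exp_at
    by (simp add: alt_scale mult_ac diff_diff_eq2 add_diff_eq diff_add_eq)
  finally show ?thesis .
qed

lemma series_mult_delta_yx:
  assumes "\<And>c p q. c \<noteq> 0 \<Longrightarrow> F (c, p, q) m l w = 0"
  shows "series_mult s delta_yx F (- of_int n - 1, p, q) m l w
    = alt n (dsum n (\<lambda>i. F (0, p - of_nat i, q - of_int n + of_nat i) m l w))"
proof -
  define g where "g i = (- of_int n - 1 :: rat, of_nat i :: rat, of_int n - of_nat i :: rat)" for i :: nat
  have zero: "delta_yx d = 0 \<or> F ((- of_int n - 1, p, q) - d) m l w = 0" if "d \<notin> range g" for d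
  proof -
    obtain c1 p1 q1 where d: "d = (c1, p1, q1)"
      by (rule prod_cases3)
    show ?thesis
    proof (cases "c1 = - of_int n - 1")
      case True
      have "binom_exp (of_int n) q1 p1 = 0"
        by (rule binom_exp_zero) (use that d True in \<open>auto simp: g_def\<close>)
      then show ?thesis
        by (simp only: d True delta_at mult_zero_right simp_thms)
    next
      case False
      then show ?thesis
        by (simp add: d assms)
    qed
  qed
  have "inj g"
    by (auto simp: g_def inj_def)
  then have "series_mult s delta_yx F (- of_int n - 1, p, q) m l w
    = Sum_any (\<lambda>i. s (delta_yx (g i)) (F ((- of_int n - 1, p, q) - g i) m l w))"
    using zero by (rule series_mult_reindex)
  also have "\<dots> = dsum n (\<lambda>i. alt n (F (0, p - of_nat i, q - of_int n + of_nat i) m l w))"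
    unfolding dsum_def bsum_def g_def delta_at binom_exp_at
    by (simp add: alt_scale mult_ac diff_diff_eq2 add_diff_eq diff_add_eq)
  finally show ?thesis
    by (simp add: dsum_alt)
qed

lemma series_mult_zero:
  assumes "\<And>d. f d = 0 \<or> F (e - d) m l w = 0"
  shows "series_mult s f F e m l w = 0"
proof -
  have zero: "s (f d) (F (e - d) m l w) = 0" for d
    using assms[of d] by auto
  show ?thesis
    unfolding series_mult_def zero by simp
qed

lemma jacobi_lhs_int:
  "jacobi_lhs s a b (- of_int n - 1, p, q) m l w
    = dsum n (\<lambda>i. a (p - of_int n + of_nat i) m (b (q - of_nat i) (l - m) w))
      - alt n (dsum n (\<lambda>i. b (q - of_int n + of_nat i) (l - m) (a (p - of_nat i) m w)))"
  unfolding jacobi_lhs_def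
  by (simp add: series_mult_delta_xy series_mult_delta_yx prod_series_def prod_series_op_def)

lemma series_mult_nonint:
  assumes "c \<notin> \<int>" and f: "\<And>x y z. x \<notin> \<int> \<Longrightarrow> f (x, y, z) = 0"
    and F: "\<And>x y z. x \<noteq> 0 \<Longrightarrow> F (x, y, z) m l w = 0"
  shows "series_mult s f F (c, p, q) m l w = 0"
proof (rule series_mult_zero)
  fix d :: "rat \<times> rat \<times> rat"
  obtain x y z where d: "d = (x, y, z)"
    by (rule prod_cases3)
  show "f d = 0 \<or> F ((c, p, q) - d) m l w = 0"
  proof (cases "x = c")
    case True
    then show ?thesis
      using assms(1) f by (simp add: d)
  next
    case False
    then show ?thesis
      using F by (simp add: d)
  qed
qed

lemma jacobi_lhs_nonint:
  assumes "c \<notin> \<int>"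
  shows "jacobi_lhs s a b (c, p, q) m l w = 0"
  unfolding jacobi_lhs_def
  by (simp add: series_mult_nonint[OF assms] delta_zero prod_series_def prod_series_op_def)

text \<open>The iterate is free of x0, so the delta function must supply x0^p: the i-th term takes i
  powers of z0 from (x0 - z0)^(p + i), which comes with y0^(-p - i - 1).\<close>

lemma series_mult_delta_xz:
  "series_mult s delta_xz (iterate_series Y' Yuv) (c, of_int p, q) m l w
    = bsum (of_int (- p - 1)) (\<lambda>i. Y' (Yuv (c - of_nat i) m) (q + of_int p + 1 + of_nat i) l w)"
proof -
  let ?F = "iterate_series Y' Yuv"
  define g where "g i = (of_nat i :: rat, of_int p :: rat, - of_int (p + int i) - 1 :: rat)" for i :: nat
  have zero: "delta_xz d = 0 \<or> ?F ((c, of_int p, q) - d) m l w = 0" if "d \<notin> range g" for d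
  proof -
    obtain c1 p1 q1 where d: "d = (c1, p1, q1)"
      by (rule prod_cases3)
    show ?thesis
    proof (cases "p1 = of_int p")
      case True
      show ?thesis
      proof (cases "q1 \<in> \<int>")
        case int: True
        then obtain k where k: "q1 = of_int k"
          by (rule Ints_cases)
        then have q1: "q1 = - of_int (- k - 1) - 1"
          by simp
        have "binom_exp (of_int (- k - 1)) p1 c1 = 0"
        proof (rule binom_exp_zero)
          fix i assume "p1 = of_int (- k - 1) - of_nat i"
          then have "of_int (- k - 1) = (of_int (p + int i) :: rat)"
            using True by simp
          then have "- k - 1 = p + int i"
            by (simp only: of_int_eq_iff)
          then have "d = g i" if "c1 = of_nat i"
            using that True q1 by (simp add: d g_def)
          then show "c1 \<noteq> of_nat i"
            using that by blast
        qed
        then show ?thesis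
          by (simp only: d q1 delta_at simp_thms)
      qed (simp add: d delta_zero)
    next
      case False
      then show ?thesis
        by (simp add: d iterate_series_def)
    qed
  qed
  have "inj g"
    by (auto simp: g_def inj_def)
  then have "series_mult s delta_xz ?F (c, of_int p, q) m l w
    = Sum_any (\<lambda>i. s (delta_xz (g i)) (?F ((c, of_int p, q) - g i) m l w))"
    using zero by (rule series_mult_reindex)
  also have "\<dots> = bsum (of_int (- p - 1)) (\<lambda>i. Y' (Yuv (c - of_nat i) m) (q + of_int p + 1 + of_nat i) l w)"
    unfolding bsum_def
  proof (rule Sum_any.cong)
    fix i
    have "delta_xz (g i) = binom_exp (of_int (p + int i)) (of_int (p + int i) - of_nat i) (of_nat i)"
      unfolding g_def delta_at by simp
    \<comment> \<open>Upper negation: (-1)^i binom(p + i, i) = binom(-p - 1, i).\<close>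
    also have "\<dots> = (of_int (- p - 1) gchoose i)"
      unfolding binom_exp_at by (subst gbinomial_negated_upper[of "of_int (- p - 1)"]) (simp add: add.commute of_rat_add)
    finally have "delta_xz (g i) = (of_int (- p - 1) gchoose i)" .
    then show "s (delta_xz (g i)) (?F ((c, of_int p, q) - g i) m l w)
      = s (of_int (- p - 1) gchoose i) (Y' (Yuv (c - of_nat i) m) (q + of_int p + 1 + of_nat i) l w)"
      by (simp add: g_def iterate_series_def algebra_simps)
  qed
  finally show ?thesis .
qed

lemma series_mult_delta_xz_nonint:
  assumes "p \<notin> \<int>"
  shows "series_mult s delta_xz (iterate_series Y' Yuv) (c, p, q) m l w = 0"
proof (rule series_mult_zero)
  fix d :: "rat \<times> rat \<times> rat"
  obtain c1 p1 q1 where d: "d = (c1, p1, q1)"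
    by (rule prod_cases3)
  show "delta_xz d = 0 \<or> iterate_series Y' Yuv ((c, p, q) - d) m l w = 0"
  proof (cases "p1 = p \<and> q1 \<in> \<int>")
    case True
    then obtain k where k: "q1 = of_int k"
      by (meson Ints_cases)
    then have q1: "q1 = - of_int (- k - 1) - 1"
      by simp
    have "binom_exp (of_int (- k - 1)) p1 c1 = 0"
      by (rule binom_exp_zero) (use True assms in auto)
    then show ?thesis
      by (simp only: d q1 delta_at simp_thms)
  qed (auto simp: d delta_zero iterate_series_def)
qed

lemma series_mult_ratio_power:
  "series_mult s (ratio_power \<alpha>) F (c, p, q) m l w
    = bsum (of_rat \<alpha>) (\<lambda>i. alt (int i) (F (c - of_nat i, p - \<alpha> + of_nat i, q + \<alpha>) m l w))"
proof -
  define g where "g i = (of_nat i :: rat, \<alpha> - of_nat i, - \<alpha>)" for i :: nat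
  have zero: "ratio_power \<alpha> d = 0 \<or> F ((c, p, q) - d) m l w = 0" if "d \<notin> range g" for d
  proof -
    obtain c1 p1 q1 where d: "d = (c1, p1, q1)"
      by (rule prod_cases3)
    have "binom_exp \<alpha> p1 c1 = 0" if "q1 = - \<alpha>"
      by (rule binom_exp_zero) (use that d \<open>d \<notin> range g\<close> in \<open>auto simp: g_def\<close>)
    then show ?thesis
      by (simp add: d ratio_power_def)
  qed
  have "inj g"
    by (auto simp: g_def inj_def)
  then have "series_mult s (ratio_power \<alpha>) F (c, p, q) m l w
    = Sum_any (\<lambda>i. s (ratio_power \<alpha> (g i)) (F ((c, p, q) - g i) m l w))"
    using zero by (rule series_mult_reindex)
  also have "\<dots> = bsum (of_rat \<alpha>) (\<lambda>i. alt (int i) (F (c - of_nat i, p - \<alpha> + of_nat i, q + \<alpha>) m l w))"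
    unfolding bsum_def g_def ratio_power_def
    by (simp add: binom_exp_at alt_scale mult_ac diff_diff_eq2 add_diff_eq diff_add_eq)
  finally show ?thesis .
qed

lemma series_mult_diff_power:
  assumes "\<And>c p q. c \<noteq> 0 \<Longrightarrow> F (c, p, q) m l w = 0"
  shows "series_mult s (diff_power k) F (0, p, q) m l w
    = dsum (int k) (\<lambda>i. F (0, p - of_nat k + of_nat i, q - of_nat i) m l w)"
proof -
  define g where "g i = (0 :: rat, of_nat k - of_nat i :: rat, of_nat i :: rat)" for i :: nat
  have zero: "diff_power k d = 0 \<or> F ((0, p, q) - d) m l w = 0" if "d \<notin> range g" for d
  proof -
    obtain c1 p1 q1 where d: "d = (c1, p1, q1)"
      by (rule prod_cases3)
    have "binom_exp (of_nat k) p1 q1 = 0" if "c1 = 0"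
      by (rule binom_exp_zero) (use that d \<open>d \<notin> range g\<close> in \<open>auto simp: g_def\<close>)
    then show ?thesis
      by (auto simp: d diff_power_def)
  qed
  have "inj g"
    by (auto simp: g_def inj_def)
  then have "series_mult s (diff_power k) F (0, p, q) m l w
    = Sum_any (\<lambda>i. s (diff_power k (g i)) (F ((0, p, q) - g i) m l w))"
    using zero by (rule series_mult_reindex)
  also have "\<dots> = dsum (int k) (\<lambda>i. F (0, p - of_nat k + of_nat i, q - of_nat i) m l w)"
    unfolding dsum_def bsum_def g_def diff_power_def
    by (simp add: binom_exp_at alt_scale mult_ac diff_diff_eq2 add_diff_eq diff_add_eq)
  finally show ?thesis .
qed

text \<open>As for the ordinary delta function, with n = P + N i in the defining sum. The root of
  unity is raised to this power, and the part N i contributes 1.\<close>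

lemma series_mult_delta_root:
  assumes "N > 0" and p: "of_nat N * p = of_int P"
  shows "series_mult s (delta_xz_root N j) (iterate_series Y' Yuv) (c, p, q) m l w
    = bsum (of_rat (- p - 1)) (\<lambda>i. s ((omega N ^ j) powi P)
        (Y' (Yuv (c - of_nat i) m) (q + p + 1 + of_nat i) l w))"
proof -
  let ?F = "iterate_series Y' Yuv"
  define g where "g i = (of_nat i :: rat, p, - (of_int (P + int N * int i) / of_nat N) - 1 :: rat)" for i :: nat
  have frac: "of_int (P + int N * int i) / of_nat N = p + of_nat i" for i
    using assms(1) by (simp add: add_divide_distrib p[symmetric])
  have zero: "delta_xz_root N j d = 0 \<or> ?F ((c, p, q) - d) m l w = 0" if "d \<notin> range g" for d
  proof -
    obtain c1 p1 q1 where d: "d = (c1, p1, q1)"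
      by (rule prod_cases3)
    show ?thesis
    proof (cases "p1 = p \<and> (\<exists>n::int. q1 = - (of_int n / of_nat N) - 1)")
      case True
      then obtain n :: int where q1: "q1 = - (of_int n / of_nat N) - 1" and p1: "p1 = p"
        by blast
      have "binom_exp (of_int n / of_nat N) p1 c1 = 0"
      proof (rule binom_exp_zero)
        fix i assume "p1 = of_int n / of_nat N - of_nat i"
        then have "q1 = - (of_int (P + int N * int i) / of_nat N) - 1"
          unfolding frac q1 p1 by simp
        then show "c1 \<noteq> of_nat i"
          using that p1 by (auto simp: d g_def)
      qed
      then show ?thesis
        by (simp only: d q1 delta_root_at[OF assms(1)] mult_zero_right simp_thms)
    qed (auto simp: d delta_root_zero iterate_series_def)
  qed
  have "inj g"
    by (auto simp: g_def inj_def)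
  then have "series_mult s (delta_xz_root N j) ?F (c, p, q) m l w
    = Sum_any (\<lambda>i. s (delta_xz_root N j (g i)) (?F ((c, p, q) - g i) m l w))"
    using zero by (rule series_mult_reindex)
  also have "\<dots> = bsum (of_rat (- p - 1)) (\<lambda>i. s ((omega N ^ j) powi P)
      (Y' (Yuv (c - of_nat i) m) (q + p + 1 + of_nat i) l w))"
    unfolding bsum_def
  proof (rule Sum_any.cong)
    fix i
    have "omega N \<noteq> 0"
      by (simp add: omega_def)
    moreover have "(omega N ^ j) powi (int N * int i) = 1"
      using omega_power[OF assms(1)]
      by (simp add: power_int_mult power_int_of_nat flip: power_mult) (simp add: mult.commute[of j] power_mult)
    ultimately have w: "(omega N ^ j) powi (P + int N * int i) = (omega N ^ j) powi P"
      by (simp add: power_int_add)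
    have "binom_exp (p + of_nat i) p (of_nat i) = binom_exp (p + of_nat i) (p + of_nat i - of_nat i) (of_nat i)"
      by simp
    also have "\<dots> = (of_rat (- p - 1) gchoose i)"
      unfolding binom_exp_at
      by (subst gbinomial_negated_upper[of "of_rat (- p - 1)"]) (simp add: of_rat_add of_rat_diff of_rat_minus add.commute)
    finally have b: "binom_exp (p + of_nat i) p (of_nat i) = (of_rat (- p - 1) gchoose i)" .
    have "delta_xz_root N j (g i) = (omega N ^ j) powi (P + int N * int i)
        * binom_exp (of_int (P + int N * int i) / of_nat N) p (of_nat i)"
      unfolding g_def by (rule delta_root_at[OF assms(1)])
    then have "delta_xz_root N j (g i) = (omega N ^ j) powi P * (of_rat (- p - 1) gchoose i)"
      unfolding frac w b .
    then show "s (delta_xz_root N j (g i)) (?F ((c, p, q) - g i) m l w)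
      = s (of_rat (- p - 1) gchoose i) (s ((omega N ^ j) powi P)
          (Y' (Yuv (c - of_nat i) m) (q + p + 1 + of_nat i) l w))"
      unfolding g_def frac by (simp add: iterate_series_def algebra_simps)
  qed
  finally show ?thesis .
qed

lemma series_mult_delta_root_zero:
  assumes "N > 0" and "of_nat N * p \<notin> \<int>"
  shows "series_mult s (delta_xz_root N j) (iterate_series Y' Yuv) (c, p, q) m l w = 0"
proof (rule series_mult_zero)
  fix d :: "rat \<times> rat \<times> rat"
  obtain c1 p1 q1 where d: "d = (c1, p1, q1)"
    by (rule prod_cases3)
  show "delta_xz_root N j d = 0 \<or> iterate_series Y' Yuv ((c, p, q) - d) m l w = 0"
  proof (cases "p1 = p \<and> (\<exists>n::int. q1 = - (of_int n / of_nat N) - 1)")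
    case True
    then obtain n :: int where q1: "q1 = - (of_int n / of_nat N) - 1" and p1: "p1 = p"
      by blast
    have "binom_exp (of_int n / of_nat N) p1 c1 = 0"
    proof (rule binom_exp_zero)
      fix i assume "p1 = of_int n / of_nat N - of_nat i"
      then have "of_nat N * p = of_nat N * (of_int n / of_nat N - of_nat i)"
        by (simp only: p1)
      also have "\<dots> = of_int (n - int N * int i)"
        using assms(1) by (simp add: right_diff_distrib)
      finally have "of_nat N * p = of_int (n - int N * int i)" .
      then have "of_nat N * p \<in> \<int>"
        by (metis Ints_of_int)
      then show "c1 \<noteq> of_nat i"
        using assms(2) by contradiction
    qed
    then show ?thesis
      by (simp only: d q1 delta_root_at[OF assms(1)] mult_zero_right simp_thms)
  qed (auto simp: d delta_root_zero iterate_series_def)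
qed

section \<open>From toroidal series to their one-variable components\<close>

definition component :: "('r, 'w) op_series \<Rightarrow> int ^ 'r \<Rightarrow> rat \<Rightarrow> 'w \<Rightarrow> 'w" where
  "component a m = (\<lambda>q. a q m)"

lemma is_field_component:
  assumes "a \<in> field_space s UNIV N"
  shows "is_field (component a m)"
proof -
  have lin: "linear_map_on s UNIV s (a q m)" for q
    using assms by (auto simp: field_space_def)
  have "\<exists>K. \<forall>q<K. \<forall>m. a q m w = 0" for w
    using assms by (simp add: field_space_def)
  then have "\<exists>K. \<forall>q<K. a q m w = 0" for w
    by metis
  with lin show ?thesis
    by (simp add: is_field_def component_def linear_map_on_def)
qed

text \<open>For a nonnegative exponent the expansion of (x - y)^n is finite and can be read from
  either variable. This relates the commutator form of locality, with one expansion for both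
  products, to \<open>nprod\<close>, where the second product has its own.\<close>

lemma dsum_reverse: "dsum (int n) G = alt (int n) (dsum (int n) (\<lambda>i. G (n - i)))"
proof -
  have "(\<Sum>i\<le>n. s (of_nat (n choose i)) (alt (int i) (G i)))
    = (\<Sum>i\<le>n. s (of_nat (n choose i)) (alt (int n) (alt (int i) (G (n - i)))))"
  proof (rule sum.reindex_bij_witness[of _ "\<lambda>i. n - i" "\<lambda>i. n - i"])
    fix i assume "i \<in> {..n}"
    then have "i \<le> n" and "n choose (n - i) = n choose i"
      by (simp_all add: binomial_symmetric[symmetric])
    then show "s (of_nat (n choose (n - i))) (alt (int n) (alt (int (n - i)) (G (n - (n - i)))))
        = s (of_nat (n choose i)) (alt (int i) (G i))"
      by (simp add: alt_def of_nat_diff)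
  qed auto
  moreover have "alt (int n) (dsum (int n) (\<lambda>i. G (n - i)))
    = bsum (of_nat n) (\<lambda>i. alt (int n) (alt (int i) (G (n - i))))"
    unfolding dsum_def bsum_alt of_int_of_nat_eq ..
  ultimately show ?thesis
    by (simp only: dsum_def of_int_of_nat_eq bsum_of_nat)
qed

lemma local_fieldsI:
  assumes "is_field A" "is_field B" and "\<And>e c w. nprod k (shift e A) B c w = 0"
  shows "local_fields k A B"
proof -
  have "nprod (k + int d) (shift e A) B c w = 0" for d e c w
  proof (induction d arbitrary: e c w)
    case (Suc d)
    then show ?case
      using nprod_rec[OF is_field_shift[OF assms(1), of e] assms(2), of "k + int d" c w]
      by (simp add: shift_shift add_ac)
  qed (simp add: assms(3))
  note * = this
  show ?thesis
    unfolding local_fields_def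
  proof (intro allI impI)
    fix n e c w assume "k \<le> n"
    then show "nprod n (shift e A) B c w = 0"
      using *[of "nat (n - k)" e c w] by simp
  qed
qed

text \<open>One power of x0 - y0 serves all toroidal exponents, and k inherits this uniformity;
  truncation of the vertex operators has to be uniform in them too.\<close>

lemma local_component:
  assumes "a \<in> field_space s UNIV N" "b \<in> field_space s UNIV N" and "mutually_local s a b"
  shows "\<exists>k. \<forall>m l. local_fields k (component a m) (component b l)"
proof -
  obtain k where k: "series_mult s (diff_power k) (commutator_series a b) = (\<lambda>e m l w. 0)"
    using assms(3) unfolding mutually_local_def by blast
  have "local_fields (int k) (component a m) (component b l)" for m l
  proof (rule local_fieldsI)
    show "is_field (component a m)" "is_field (component b l)"
      using assms by (auto intro: is_field_component)
    fix e c :: rat and w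
    let ?p = "- 1 - e"
    let ?G = "\<lambda>i. a (?p - of_nat k + of_nat i) m (b (c - of_nat i) l w)"
    let ?H = "\<lambda>i. b (c - of_nat i) l (a (?p - of_nat k + of_nat i) m w)"
    have "0 = series_mult s (diff_power k) (commutator_series a b) (0, ?p, c) m l w"
      by (simp add: k)
    also have "\<dots> = dsum (int k) (\<lambda>i. ?G i - ?H i)"
      by (subst series_mult_diff_power) (simp_all add: commutator_series_def)
    also have "\<dots> = dsum (int k) ?G - dsum (int k) ?H"
      by (simp add: dsum_def bsum_of_nat alt_diff scale_right_diff_distrib sum_subtractf)
    also have "dsum (int k) ?H = alt (int k) (dsum (int k) (\<lambda>i. b (c - of_nat k + of_nat i) l (a (?p - of_nat i) m w)))"
      by (subst dsum_reverse) (simp add: dsum_def bsum_of_nat of_nat_diff algebra_simps)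
    finally show "nprod (int k) (shift e (component a m)) (component b l) c w = 0"
      by (simp add: nprod_def shift_def component_def algebra_simps)
  qed
  then show ?thesis
    by blast
qed

lemma jacobi_lhs_nprod:
  "jacobi_lhs s a b (- of_int n - 1, p, q) m l w
    = nprod n (shift (- 1 - p) (component a m)) (component b (l - m)) q w"
  unfolding jacobi_lhs_int nprod_def shift_def component_def by (simp add: algebra_simps)

lemma Y_E_homogeneous_int:
  assumes "is_field (component a m)" "is_field (component b (l - m))" "local_fields k (component a m) (component b (l - m))"
  shows "Y_E_homogeneous s N j a (- of_int n - 1) m b t l w
    = tw_prod (of_nat j / of_nat N) n (component a m) (component b (l - m)) t w"
proof -
  have "- of_int n - 1 - of_nat i = - of_int (n + int i) - (1 :: rat)" for i
    by simp
  then show ?thesis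
    unfolding Y_E_homogeneous_def series_mult_ratio_power tw_prod_eq[OF assms]
    by (simp only: jacobi_lhs_nprod) (simp add: algebra_simps)
qed

lemma Y_E_homogeneous_nonint:
  assumes "c \<notin> \<int>"
  shows "Y_E_homogeneous s N j a c m b t l w = 0"
proof -
  have "c - of_nat i \<notin> \<int>" for i
    using assms by (metis Ints_add Ints_of_nat diff_add_cancel)
  then show ?thesis
    by (simp add: Y_E_homogeneous_def series_mult_ratio_power jacobi_lhs_nonint)
qed

end

section \<open>Linearity of the twisted products\<close>

context complex_space
begin

lemma nprod_add_left:
  assumes "is_field A" "is_field A'" "is_field B"
  shows "nprod n (\<lambda>c w. A c w + A' c w) B c w = nprod n A B c w + nprod n A' B c w"
  unfolding nprod_def field_add[OF assms(3)]
  by (simp only: dsum_add[OF finite_nprod(1)[OF assms(1,3)] finite_nprod(1)[OF assms(2,3)]]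
      dsum_add[OF finite_nprod(2)[OF assms(1,3)] finite_nprod(2)[OF assms(2,3)]] alt_add add_diff_add)

lemma nprod_add_right:
  assumes "is_field A" "is_field B" "is_field B'"
  shows "nprod n A (\<lambda>c w. B c w + B' c w) c w = nprod n A B c w + nprod n A B' c w"
  unfolding nprod_def field_add[OF assms(1)]
  by (simp only: dsum_add[OF finite_nprod(1)[OF assms(1,2)] finite_nprod(1)[OF assms(1,3)]]
      dsum_add[OF finite_nprod(2)[OF assms(1,2)] finite_nprod(2)[OF assms(1,3)]] alt_add add_diff_add)

lemma nprod_scale_left:
  assumes "is_field A" "is_field B"
  shows "nprod n (\<lambda>c w. s x (A c w)) B c w = s x (nprod n A B c w)"
  unfolding nprod_def field_scale[OF assms(2)]
  by (simp only: dsum_scale[OF finite_nprod(1)[OF assms]] dsum_scale[OF finite_nprod(2)[OF assms]]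
      alt_scale_commute scale_right_diff_distrib)

lemma nprod_scale_right:
  assumes "is_field A" "is_field B"
  shows "nprod n A (\<lambda>c w. s x (B c w)) c w = s x (nprod n A B c w)"
  unfolding nprod_def field_scale[OF assms(1)]
  by (simp only: dsum_scale[OF finite_nprod(1)[OF assms]] dsum_scale[OF finite_nprod(2)[OF assms]]
      alt_scale_commute scale_right_diff_distrib)

lemma shift_add: "shift e (\<lambda>c w. A c w + A' c w) = (\<lambda>c w. shift e A c w + shift e A' c w)"
  and shift_scale: "shift e (\<lambda>c w. s x (A c w)) = (\<lambda>c w. s x (shift e A c w))"
  by (simp_all add: shift_def)

lemma tw_prod_add_left:
  assumes "is_field A" "is_field A'" "is_field B" "local_fields k A B" "local_fields k' A' B"
  shows "tw_prod \<alpha> n (\<lambda>c w. A c w + A' c w) B c w = tw_prod \<alpha> n A B c w + tw_prod \<alpha> n A' B c w"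
  unfolding tw_prod_def shift_add
  by (simp only: nprod_add_left[OF is_field_shift[OF assms(1)] is_field_shift[OF assms(2)] assms(3)]
      bsum_add[OF nprod_shift_finite[OF assms(4)] nprod_shift_finite[OF assms(5)]])

lemma tw_prod_add_right:
  assumes "is_field A" "is_field B" "is_field B'" "local_fields k A B" "local_fields k' A B'"
  shows "tw_prod \<alpha> n A (\<lambda>c w. B c w + B' c w) c w = tw_prod \<alpha> n A B c w + tw_prod \<alpha> n A B' c w"
  unfolding tw_prod_def
  by (simp only: nprod_add_right[OF is_field_shift[OF assms(1)] assms(2,3)]
      bsum_add[OF nprod_shift_finite[OF assms(4)] nprod_shift_finite[OF assms(5)]])

lemma tw_prod_scale_left:
  assumes "is_field A" "is_field B" "local_fields k A B"
  shows "tw_prod \<alpha> n (\<lambda>c w. s x (A c w)) B c w = s x (tw_prod \<alpha> n A B c w)"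
  unfolding tw_prod_def shift_scale
  by (simp only: nprod_scale_left[OF is_field_shift[OF assms(1)] assms(2)]
      bsum_scale[OF nprod_shift_finite[OF assms(3)]])

lemma tw_prod_scale_right:
  assumes "is_field A" "is_field B" "local_fields k A B"
  shows "tw_prod \<alpha> n A (\<lambda>c w. s x (B c w)) c w = s x (tw_prod \<alpha> n A B c w)"
  unfolding tw_prod_def
  by (simp only: nprod_scale_right[OF is_field_shift[OF assms(1)] assms(2)]
      bsum_scale[OF nprod_shift_finite[OF assms(3)]])

lemma tw_prod_zero_left:
  assumes "is_field B"
  shows "tw_prod \<alpha> n (\<lambda>c w. 0) B c w = 0"
  by (simp add: tw_prod_def nprod_def shift_def field_0[OF assms])

lemma tw_prod_vanish:
  assumes "local_fields k A B" "n \<ge> k"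
  shows "tw_prod \<alpha> n A B c w = 0"
  unfolding tw_prod_def using assms by (simp add: local_nprod[OF local_shift(1)[OF assms(1)]])

text \<open>In each term B is taken at an exponent that differs from t + \<alpha> by an
  integer.\<close>

lemma tw_prod_support:
  assumes "is_field A" and B: "\<And>q w. q + \<beta> \<notin> \<int> \<Longrightarrow> B q w = 0" and t: "t + \<alpha> + \<beta> \<notin> \<int>"
  shows "tw_prod \<alpha> n A B t w = 0"
proof -
  have "B (t + \<alpha> + of_int k) w = 0" for k w
  proof (rule B)
    have "t + \<alpha> + \<beta> = (t + \<alpha> + of_int k + \<beta>) - of_int k"
      by simp
    then show "t + \<alpha> + of_int k + \<beta> \<notin> \<int>"
      using t by (metis Ints_diff Ints_of_int)
  qed
  from this[of "int m - int i" for m i] this[of "int m - n + int i" for m n i]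
  have "B (t + \<alpha> + of_nat m - of_nat i) w = 0" "B (t + \<alpha> + of_nat m - of_int n + of_nat i) w = 0" for m i n w
    by (simp_all add: algebra_simps)
  then show ?thesis
    by (simp add: tw_prod_def nprod_def field_0[OF is_field_shift[OF assms(1)]] del: of_int_add)
qed

lemma component_add: "component (a + b) m = (\<lambda>c w. component a m c w + component b m c w)"
  and component_scale: "component (op_scale s x a) m = (\<lambda>c w. s x (component a m c w))"
  and component_zero: "component (\<lambda>q m w. 0) m = (\<lambda>c w. 0)" "component 0 m = (\<lambda>c w. 0)"
  by (simp_all add: component_def op_scale_def fun_eq_iff)

lemma nprod_one_left:
  assumes "is_field B"
  shows "nprod n (component one_series m) B c w = (if n = -1 \<and> m = 0 then B c w else 0)"
proof (cases "m = 0")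
  case False
  then show ?thesis
    by (simp add: nprod_def component_def one_series_def field_0[OF assms])
next
  case True
  have 1: "nprod n (component one_series m) B c w
    = dsum n (\<lambda>i. if - 1 - of_int n + of_nat i = (0::rat) then B (c - of_nat i) w else 0)"
  proof -
    \<comment> \<open>The second product uses only negative exponents of the first field, where the
      identity has no coefficient.\<close>
    have "- 1 - of_nat i \<noteq> (0::rat)" for i
    proof -
      have "(0::rat) \<le> of_nat i"
        by simp
      then show ?thesis
        by linarith
    qed
    then show ?thesis
      by (simp add: nprod_def component_def one_series_def True field_0[OF assms])
  qed
  have 2: "- 1 - of_int n + of_nat i = (0::rat) \<longleftrightarrow> int i = n + 1" for i
  proof -
    have "- 1 - of_int n + of_nat i = (of_int (int i - n - 1) :: rat)"
      by simp
    then show ?thesis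
      by (simp only: of_int_eq_0_iff) auto
  qed
  show ?thesis
  proof (cases "n = -1")
    case n: True
    show ?thesis
      unfolding 1 2 by (simp add: n True dsum_def bsum_eq_sum[of 1])
  next
    case False
    show ?thesis
    proof (cases "n \<ge> 0")
      \<comment> \<open>The only candidate is i = n + 1, for which the binomial coefficient of n and
        i is 0.\<close>
      case pos: True
      then show ?thesis
        unfolding 1 2 using False by (auto simp: dsum_def bsum_nonneg intro!: sum.neutral)
    next
      case neg: False
      then have "int i \<noteq> n + 1" for i
        using False by linarith
      then show ?thesis
        unfolding 1 2 using False by simp
    qed
  qed
qed

text \<open>A(x) commutes with the identity, and for n \<ge> 0 both products use the same finite
  expansion of (x - t)^n.\<close>

lemma nprod_one_right:
  assumes "is_field A" "n \<ge> 0"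
  shows "nprod n A (component one_series m) c w = 0"
proof -
  obtain k where n: "n = int k"
    using assms(2) by (metis nonneg_int_cases)
  let ?G = "\<lambda>i. A (- 1 - of_nat k + of_nat i) (component one_series m (c - of_nat i) w)"
  have "bsum (of_nat k) (\<lambda>i. alt (int i) (?G (k - i)))
    = bsum (of_nat k) (\<lambda>i. alt (int i) (component one_series m (c - of_nat k + of_nat i) (A (- 1 - of_nat i) w)))"
    by (rule bsum_of_nat_cong)
      (auto simp: of_nat_diff component_def one_series_def field_0[OF assms(1)] algebra_simps)
  then show ?thesis
    unfolding nprod_def n of_int_of_nat_eq by (subst dsum_reverse) (simp add: dsum_def)
qed

end

lemma sum_root_of_unity:
  assumes "N > 0"
  shows "(\<Sum>j<N. (omega N powi K) ^ j) = (if int N dvd K then of_nat N else 0)"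
proof -
  have nz: "omega N \<noteq> 0"
    by (simp add: omega_def)
  have powN: "omega N powi (int N * k) = 1" for k
    by (simp only: power_int_mult power_int_of_nat omega_power[OF assms] power_int_1_left)
  show ?thesis
  proof (cases "int N dvd K")
    case True
    then show ?thesis
      using powN by (auto elim: dvdE)
  next
    case False
    have "omega N powi K \<noteq> 1"
    proof
      assume "omega N powi K = 1"
      moreover have "omega N powi K = exp (of_int K * (2 * of_real pi * \<i> / of_nat N))"
        by (simp add: omega_def exp_power_int mult.commute)
      ultimately have "exp (of_int K * (2 * of_real pi * \<i> / of_nat N)) = 1"
        by simp
      then obtain k :: int where "Im (of_int K * (2 * of_real pi * \<i> / of_nat N)) = of_int (2 * k) * pi"
        unfolding exp_eq_1 by blast
      then have "of_int K * (2 * pi) / of_nat N = of_int (2 * k) * pi"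
        by simp
      then have "(of_int K :: real) = of_int (int N * k)"
        using assms by (simp add: field_simps)
      then have "K = int N * k"
        by (simp only: of_int_eq_iff)
      with False show False
        by simp
    qed
    moreover have "(omega N powi K) ^ N = 1"
      using powN[of K] nz by (simp flip: power_int_of_nat add: power_int_mult[symmetric] mult.commute)
    ultimately show ?thesis
      using False by (simp add: geometric_sum)
  qed
qed

section \<open>The structure on a closed space of fields\<close>

lemma sum_series_apply: "(\<Sum>j\<in>J. f j) q m w = (\<Sum>j\<in>J. f j q m w)"
  for f :: "'j \<Rightarrow> ('r, 'w::ab_group_add) op_series"
  by (induction J rule: infinite_finite_induct) simp_all

lemma grade_part_add: "grade_part N j (a + b) = grade_part N j a + grade_part N j b"
  for a b :: "('r, 'w::ab_group_add) op_series"
  by (simp add: grade_part_def fun_eq_iff)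

lemma grade_part_sum: "grade_part N j (\<Sum>i\<in>I. f i) = (\<Sum>i\<in>I. grade_part N j (f i))"
  for f :: "'i \<Rightarrow> ('r, 'w::ab_group_add) op_series"
proof -
  have "grade_part N j (0 :: ('r, 'w) op_series) = 0"
    by (simp add: grade_part_def fun_eq_iff)
  then show ?thesis
    by (induction I rule: infinite_finite_induct) (simp_all add: grade_part_add)
qed

lemma grade_support:
  assumes "a \<in> grade s N j" and "q + of_nat j / of_nat N \<notin> \<int>"
  shows "a q m w = 0"
proof -
  have "(\<lambda>q. a (q - of_nat j / of_nat N)) \<in> field_space s UNIV 1"
    using assms(1) by (simp add: mem_grade_iff)
  then have "\<forall>q. q \<notin> \<int> \<longrightarrow> (\<forall>m w. a (q - of_nat j / of_nat N) m w = 0)"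
    by (simp add: field_space_def)
  from this[rule_format, OF assms(2)] show ?thesis
    by simp
qed

lemma gradeI:
  assumes "vector_space s" "a \<in> field_space s UNIV N"
    and "\<And>q m w. q + of_nat j / of_nat N \<notin> \<int> \<Longrightarrow> a q m w = 0"
  shows "a \<in> grade s N j"
proof -
  have "grade_part N j a = a"
    using assms(3) by (auto simp: grade_part_def fun_eq_iff)
  then show ?thesis
    using grade_part_in_grade[OF assms(1,2), of j] by simp
qed

section \<open>The closed space and its homogeneous elements\<close>

locale closed_fields = complex_space s
  for s :: "complex \<Rightarrow> 'w::ab_group_add \<Rightarrow> 'w" +
  fixes N :: nat and V :: "('r::finite, 'w) op_series set"
  assumes N: "N > 0"
    and graded: "graded_subspace s N V"
    and loc: "local_set s V"
    and closed: "closed_subspace s N V"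
begin

text \<open>The binomial sums are needed a second time with series as values, for the Jacobi
  identity on V; \<open>op_bsum_apply\<close> and \<open>op_dsum_apply\<close> reduce them to sums
  of coefficients.\<close>

sublocale op: complex_space "op_scale s :: complex \<Rightarrow> ('r, 'w) op_series \<Rightarrow> ('r, 'w) op_series"
  by (rule complex_space.intro, rule vector_space_op_scale) unfold_locales

lemma vs: "vector_space s"
  by unfold_locales

lemma V_field: "a \<in> V \<Longrightarrow> a \<in> field_space s UNIV N"
  using graded by (auto simp: graded_subspace_def)

lemma V_subspace: "op.subspace V"
  using graded by (simp add: graded_subspace_def)

lemmas V_add = op.subspace_add[OF V_subspace]
  and V_scale = op.subspace_scale[OF V_subspace]
  and V_zero = op.subspace_0[OF V_subspace]
  and V_sum = op.subspace_sum[OF V_subspace]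

lemma V_component: "a \<in> V \<Longrightarrow> is_field (component a m)"
  by (rule is_field_component[OF V_field])

lemma V_local:
  assumes "a \<in> V" "b \<in> V"
  obtains k where "\<And>m l. local_fields k (component a m) (component b l)"
proof -
  have "mutually_local s a b"
    using loc assms by (simp add: local_set_def)
  from local_component[OF assms[THEN V_field] this] show ?thesis
    using that by blast
qed

lemma V_triple:
  assumes "u \<in> V" "v \<in> V" "w \<in> V"
  obtains k where "\<And>m l n. triple k (component u m) (component v l) (component w n)"
proof -
  obtain k1 where 1: "\<And>m l. local_fields k1 (component u m) (component v l)"
    using V_local[OF assms(1,2)] by metis
  obtain k2 where 2: "\<And>m l. local_fields k2 (component v m) (component u l)"
    using V_local[OF assms(2,1)] by metis
  obtain k3 where 3: "\<And>m l. local_fields k3 (component u m) (component w l)"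
    using V_local[OF assms(1,3)] by metis
  obtain k4 where 4: "\<And>m l. local_fields k4 (component v m) (component w l)"
    using V_local[OF assms(2,3)] by metis
  define k where "k = max (max k1 k2) (max k3 k4)"
  have "k1 \<le> k" "k2 \<le> k" "k3 \<le> k" "k4 \<le> k"
    by (auto simp: k_def)
  then have "triple k (component u m) (component v l) (component w n)" for m l n
    using local_mono[OF 1] local_mono[OF 2] local_mono[OF 3] local_mono[OF 4]
    by (simp add: triple_def V_component assms)
  then show ?thesis
    by (rule that)
qed

text \<open>Projection to degree j kills all but one summand of the homogeneous decomposition inside
  V that gradedness provides.\<close>

lemma grade_part_V:
  assumes "a \<in> V" "j < N"
  shows "grade_part N j a \<in> V"
proof -
  obtain f where f: "f \<in> (\<Pi>\<^sub>E j\<in>{..<N}. V \<inter> grade s N j)" "a = (\<Sum>j<N. f j)"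
    using graded assms(1) unfolding graded_subspace_def by blast
  have fi: "f i \<in> V" "f i \<in> grade s N i" if "i < N" for i
    using f(1) that by (auto dest: PiE_mem)
  have "grade_part N j a = (\<Sum>i<N. if i = j then f i else 0)"
    unfolding f(2) grade_part_sum
  proof (intro sum.cong refl)
    fix i assume "i \<in> {..<N}"
    then have "grade_part N j (f i) = (if i = j then f i else (\<lambda>q m w. 0))"
      by (intro grade_part_grade[OF N _ assms(2) fi(2)]) auto
    then show "grade_part N j (f i) = (if i = j then f i else 0)"
      by (simp add: zero_fun_def)
  qed
  also have "\<dots> = f j"
    using assms(2) by simp
  finally show ?thesis
    using fi assms(2) by simp
qed

lemma grade_part_homogeneous:
  assumes "a \<in> V" "j < N"
  shows "grade_part N j a \<in> V \<inter> grade s N j"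
  using grade_part_V[OF assms] grade_part_in_grade[OF vs V_field[OF assms(1)]] by simp

lemma V_sum_grade_part: "a \<in> V \<Longrightarrow> (\<Sum>j<N. grade_part N j a) = a"
  by (rule sum_grade_part[OF N V_field])

lemma grade_induct [consumes 1, case_names homogeneous add]:
  assumes "a \<in> V"
    and hom: "\<And>j b. j < N \<Longrightarrow> b \<in> V \<inter> grade s N j \<Longrightarrow> P b"
    and add: "\<And>b b'. b \<in> V \<Longrightarrow> b' \<in> V \<Longrightarrow> P b \<Longrightarrow> P b' \<Longrightarrow> P (b + b')"
  shows "P a"
proof -
  \<comment> \<open>Partial sums with at least one summand are used, so that P need not be known for
    the zero series.\<close>
  have "P (\<Sum>j<Suc n. grade_part N j a) \<and> (\<Sum>j<Suc n. grade_part N j a) \<in> V" if "Suc n \<le> N" for n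
    using that
  proof (induction n)
    case 0
    then show ?case
      using hom[of 0] grade_part_homogeneous[OF assms(1), of 0] by simp
  next
    case (Suc n)
    then have lt: "Suc n < N"
      by simp
    then have "Suc n \<le> N"
      by simp
    note IH = Suc.IH[OF this, THEN conjunct1] Suc.IH[OF this, THEN conjunct2]
    have h: "grade_part N (Suc n) a \<in> V \<inter> grade s N (Suc n)"
      by (rule grade_part_homogeneous[OF assms(1) lt])
    have e: "(\<Sum>j<Suc (Suc n). grade_part N j a) = (\<Sum>j<Suc n. grade_part N j a) + grade_part N (Suc n) a"
      by (rule sum.lessThan_Suc)
    show ?case
      unfolding e using add[OF IH(2) _ IH(1) hom[OF lt h]] V_add[OF IH(2)] h by blast
  qed
  from this[of "N - 1"] show ?thesis
    using N by (simp add: V_sum_grade_part[OF assms(1)] del: sum.lessThan_Suc)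
qed

section \<open>The vertex operator map on the closed space\<close>

abbreviation Y :: "('r, 'w) op_series \<Rightarrow> ('r, ('r, 'w) op_series) op_series" where "Y \<equiv> Y_E s N"

abbreviation deg :: "nat \<Rightarrow> rat" where "deg j \<equiv> of_nat j / of_nat N"

lemma Y_eq_sum:
  assumes "a \<in> V" "b \<in> V"
  shows "Y a (- of_int n - 1) m b t l w
    = (\<Sum>j<N. tw_prod (deg j) n (component (grade_part N j a) m) (component b (l - m)) t w)"
proof -
  have "Y_E_homogeneous s N j (grade_part N j a) (- of_int n - 1) m b t l w
    = tw_prod (deg j) n (component (grade_part N j a) m) (component b (l - m)) t w" if "j < N" for j
  proof -
    note V = grade_part_V[OF assms(1) that]
    obtain k where "\<And>m l. local_fields k (component (grade_part N j a) m) (component b l)"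
      using V_local[OF V assms(2)] by metis
    then show ?thesis
      by (intro Y_E_homogeneous_int V_component V assms)
  qed
  then show ?thesis
    by (simp add: Y_E_def sum_series_apply)
qed

lemma Y_nonint: "c \<notin> \<int> \<Longrightarrow> Y a c m b = 0"
  by (simp add: Y_E_def Y_E_homogeneous_nonint fun_eq_iff sum_series_apply)

lemma Y_homogeneous:
  assumes "a \<in> V \<inter> grade s N j" "j < N" "b \<in> V"
  shows "Y a (- of_int n - 1) m b t l w = tw_prod (deg j) n (component a m) (component b (l - m)) t w"
proof -
  have "Y a (- of_int n - 1) m b t l w
    = (\<Sum>i<N. if i = j then tw_prod (deg i) n (component a m) (component b (l - m)) t w else 0)"
    unfolding Y_eq_sum[OF IntD1[OF assms(1)] assms(3)]
  proof (intro sum.cong refl)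
    fix i assume "i \<in> {..<N}"
    then show "tw_prod (deg i) n (component (grade_part N i a) m) (component b (l - m)) t w
      = (if i = j then tw_prod (deg i) n (component a m) (component b (l - m)) t w else 0)"
      using grade_part_grade[OF N assms(2) _ IntD2[OF assms(1)], of i]
      by (auto simp: component_zero tw_prod_zero_left V_component assms(3))
  qed
  then show ?thesis
    using assms(2) by simp
qed

lemma int_cases_mode:
  fixes c :: rat
  obtains "c \<notin> \<int>" | n where "c = - of_int n - 1"
proof (cases "c \<in> \<int>")
  case True
  then obtain k where "c = of_int k"
    by (rule Ints_cases)
  then have "c = - of_int (- k - 1) - 1"
    by simp
  then show ?thesis
    by (rule that(2))
qed (rule that(1))

lemma Y_closed:
  assumes "a \<in> V" "b \<in> V"
  shows "Y a c m b \<in> V"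
proof (cases c rule: int_cases_mode)
  case 1
  then show ?thesis
    by (simp add: Y_nonint V_zero)
next
  case (2 n)
  then have "Y a c m b = mode Y a n (- m) b"
    by (simp add: mode_def)
  then show ?thesis
    using closed assms by (simp add: closed_subspace_def)
qed

text \<open>The locality bounds are uniform in the toroidal exponents and only N degrees occur, so
  the largest bound works for all m at once.\<close>

lemma Y_vanish:
  assumes "a \<in> V" "b \<in> V"
  obtains k where "\<And>n m. n \<ge> k \<Longrightarrow> Y a (- of_int n - 1) m b = 0"
proof -
  have "\<exists>k. \<forall>m l. local_fields k (component (grade_part N j a) m) (component b l)" if "j < N" for j
    using V_local[OF grade_part_V[OF assms(1) that] assms(2)] by metis
  then obtain k where k: "\<And>j m l. j < N \<Longrightarrow> local_fields (k j) (component (grade_part N j a) m) (component b l)"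
    by metis
  define K where "K = Max (k ` {..<N})"
  have "k j \<le> K" if "j < N" for j
    unfolding K_def using that by (intro Max_ge) auto
  then have "Y a (- of_int n - 1) m b = 0" if "n \<ge> K" for n m
    using that k
    by (auto simp: fun_eq_iff Y_eq_sum[OF assms] intro!: sum.neutral tw_prod_vanish intro: order_trans)
  then show ?thesis
    using that by blast
qed

lemma Y_add_left:
  assumes "a \<in> V" "a' \<in> V" "b \<in> V"
  shows "Y (a + a') c m b = Y a c m b + Y a' c m b"
proof (cases c rule: int_cases_mode)
  case (2 n)
  have "tw_prod (deg j) n (component (grade_part N j (a + a')) m) (component b l) t w
    = tw_prod (deg j) n (component (grade_part N j a) m) (component b l) t w
      + tw_prod (deg j) n (component (grade_part N j a') m) (component b l) t w"
    if "j < N" for j t l w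
  proof -
    note V = grade_part_V[OF assms(1) that] grade_part_V[OF assms(2) that]
    obtain k where k: "\<And>m l. local_fields k (component (grade_part N j a) m) (component b l)"
      using V_local[OF V(1) assms(3)] by metis
    obtain k' where k': "\<And>m l. local_fields k' (component (grade_part N j a') m) (component b l)"
      using V_local[OF V(2) assms(3)] by metis
    show ?thesis
      unfolding grade_part_add component_add
      by (rule tw_prod_add_left[OF V_component V_component V_component k k']) (use V assms in auto)
  qed
  then show ?thesis
    by (simp add: 2 fun_eq_iff Y_eq_sum assms V_add sum.distrib)
qed (simp add: Y_nonint)

lemma Y_add_right:
  assumes "a \<in> V" "b \<in> V" "b' \<in> V"
  shows "Y a c m (b + b') = Y a c m b + Y a c m b'"
proof (cases c rule: int_cases_mode)
  case (2 n)
  have "tw_prod (deg j) n (component (grade_part N j a) m) (component (b + b') l) t w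
    = tw_prod (deg j) n (component (grade_part N j a) m) (component b l) t w
      + tw_prod (deg j) n (component (grade_part N j a) m) (component b' l) t w"
    if "j < N" for j t l w
  proof -
    note V = grade_part_V[OF assms(1) that]
    obtain k where k: "\<And>m l. local_fields k (component (grade_part N j a) m) (component b l)"
      using V_local[OF V assms(2)] by metis
    obtain k' where k': "\<And>m l. local_fields k' (component (grade_part N j a) m) (component b' l)"
      using V_local[OF V assms(3)] by metis
    show ?thesis
      unfolding component_add
      by (rule tw_prod_add_right[OF V_component V_component V_component k k']) (use V assms in auto)
  qed
  then show ?thesis
    by (simp add: 2 fun_eq_iff Y_eq_sum assms V_add sum.distrib)
qed (simp add: Y_nonint)

lemma Y_scale_left:
  assumes "a \<in> V" "b \<in> V"
  shows "Y (op_scale s x a) c m b = op_scale s x (Y a c m b)"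
proof (cases c rule: int_cases_mode)
  case (2 n)
  have "tw_prod (deg j) n (component (grade_part N j (op_scale s x a)) m) (component b l) t w
    = s x (tw_prod (deg j) n (component (grade_part N j a) m) (component b l) t w)"
    if "j < N" for j t l w
  proof -
    note V = grade_part_V[OF assms(1) that]
    obtain k where k: "\<And>m l. local_fields k (component (grade_part N j a) m) (component b l)"
      using V_local[OF V assms(2)] by metis
    have "grade_part N j (op_scale s x a) = op_scale s x (grade_part N j a)"
      by (simp add: grade_part_def op_scale_def fun_eq_iff)
    then show ?thesis
      by (simp only: component_scale tw_prod_scale_left[OF V_component[OF V] V_component[OF assms(2)] k])
  qed
  then show ?thesis
    by (simp add: 2 fun_eq_iff Y_eq_sum assms V_scale op_scale_def[of s x "Y a c m b" for a c m b] scale_sum_right)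
qed (simp add: Y_nonint)

lemma Y_scale_right:
  assumes "a \<in> V" "b \<in> V"
  shows "Y a c m (op_scale s x b) = op_scale s x (Y a c m b)"
proof (cases c rule: int_cases_mode)
  case (2 n)
  have "tw_prod (deg j) n (component (grade_part N j a) m) (component (op_scale s x b) l) t w
    = s x (tw_prod (deg j) n (component (grade_part N j a) m) (component b l) t w)"
    if "j < N" for j t l w
  proof -
    note V = grade_part_V[OF assms(1) that]
    obtain k where k: "\<And>m l. local_fields k (component (grade_part N j a) m) (component b l)"
      using V_local[OF V assms(2)] by metis
    then show ?thesis
      by (simp only: component_scale tw_prod_scale_right[OF V_component[OF V] V_component[OF assms(2)] k])
  qed
  then show ?thesis
    by (simp add: 2 fun_eq_iff Y_eq_sum assms V_scale op_scale_def[of s x "Y a c m b" for a c m b] scale_sum_right)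
qed (simp add: Y_nonint)

lemma Y_zero_right: "a \<in> V \<Longrightarrow> Y a c m 0 = 0"
  using Y_scale_right[of a 0 c m 0] by (simp add: V_zero)

lemma Y_zero_left: "b \<in> V \<Longrightarrow> Y 0 c m b = 0"
  using Y_scale_left[of 0 b 0 c m] by (simp add: V_zero)

lemma deg_mod: "deg (k mod N) = deg k - of_nat (k div N)"
proof -
  have "(of_nat k :: rat) = of_nat N * of_nat (k div N) + of_nat (k mod N)"
    by (metis mult_div_mod_eq of_nat_add of_nat_mult)
  then show ?thesis
    using N by (simp add: field_simps)
qed

text \<open>The exponents of the product differ from -j/N - i/N by integers, and reducing j + i
  modulo N changes the degree by an integral exponent only.\<close>

lemma Y_grade:
  assumes "u \<in> V \<inter> grade s N j" "v \<in> V \<inter> grade s N i" "j < N"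
  shows "Y u c m v \<in> V \<inter> grade s N ((j + i) mod N)"
proof
  note V = IntD1[OF assms(1)] IntD1[OF assms(2)]
  show "Y u c m v \<in> V"
    using Y_closed V by blast
  show "Y u c m v \<in> grade s N ((j + i) mod N)"
  proof (cases c rule: int_cases_mode)
    case 1
    then show ?thesis
      using gradeI[OF vs V_field[OF V_zero]] by (simp add: Y_nonint)
  next
    case (2 n)
    show ?thesis
    proof (rule gradeI[OF vs V_field[OF Y_closed[OF V]]])
      fix t l w assume t: "t + deg ((j + i) mod N) \<notin> \<int>"
      have "t + deg j + deg i = t + deg ((j + i) mod N) + of_nat ((j + i) div N)"
        by (simp add: deg_mod add_divide_distrib)
      then have "t + deg ((j + i) mod N) = (t + deg j + deg i) - of_nat ((j + i) div N)"
        by simp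
      then have "t + deg j + deg i \<notin> \<int>"
        using t by (metis Ints_diff Ints_of_nat)
      then have "tw_prod (deg j) n (component u m) (component v (l - m)) t w = 0"
        by (rule tw_prod_support[OF V_component[OF V(1)], rotated])
          (use grade_support[OF IntD2[OF assms(2)]] in \<open>simp add: component_def\<close>)
      then show "Y u c m v t l w = 0"
        by (simp add: 2 Y_homogeneous[OF assms(1,3) V(2)])
    qed
  qed
qed


lemma op_bsum_apply:
  assumes "finite {i. G i \<noteq> 0}"
  shows "op.bsum a G t l x = bsum a (\<lambda>i. G i t l x)"
proof -
  obtain M where M: "\<And>i. M \<le> i \<Longrightarrow> G i = 0"
    using finite1_bound[OF assms] by metis
  show ?thesis
    by (simp add: op.bsum_eq_sum[of M] bsum_eq_sum[of M] M sum_series_apply op_scale_def)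
qed

lemma op_alt_apply: "op.alt n a t l x = alt n (a t l x)"
  by (simp add: op.alt_def alt_def)

lemma op_dsum_apply:
  assumes "finite {i. G i \<noteq> 0}"
  shows "op.dsum n G t l x = dsum n (\<lambda>i. G i t l x)"
  unfolding op.dsum_def dsum_def
  by (subst op_bsum_apply) (simp_all add: assms op_alt_apply)

section \<open>The Jacobi identity in modes\<close>

abbreviation vmode where "vmode u n m \<equiv> Y u (- of_int n - 1) m"

text \<open>Borcherds' identity: the coefficient of z0^(-n-1) x0^(-p-1) y0^(-q-1) z^m y^l in the
  Jacobi identity.\<close>

definition jacobi_modes where
  "jacobi_modes u v w \<longleftrightarrow> (\<forall>n p q m l.
    op.dsum n (\<lambda>i. vmode u (p + n - int i) m (vmode v (q + int i) (l - m) w))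
      - op.alt n (op.dsum n (\<lambda>i. vmode v (q + n - int i) (l - m) (vmode u (p + int i) m w)))
    = op.bsum (of_int p) (\<lambda>i. vmode (vmode u (n + int i) m v) (q + p - int i) l w))"

lemma vmode_finite:
  assumes "v \<in> V" "w \<in> V"
  shows "finite {i. vmode v (q + int i) l w \<noteq> 0}"
proof -
  obtain k where *: "\<And>n m. n \<ge> k \<Longrightarrow> vmode v n m w = 0"
    using Y_vanish[OF assms] by metis
  have "vmode v (q + int i) l w = 0" if "nat (k - q) \<le> i" for i
  proof -
    have "k \<le> q + int i"
      using that by linarith
    then show ?thesis
      by (rule *)
  qed
  then show ?thesis
    by (rule finite_support_bound)
qed

lemma vmode_vmode_finite:
  assumes "u \<in> V" "v \<in> V" "w \<in> V"
  shows "finite {i. vmode u (p - int i) m (vmode v (q + int i) l w) \<noteq> 0}"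
    and "finite {i. vmode (vmode u (n + int i) m v) (p - int i) l w \<noteq> 0}"
  by (rule finite_subset[OF _ vmode_finite[OF assms(2,3), of q l]];
      use Y_zero_right[OF assms(1)] in force)
    (rule finite_subset[OF _ vmode_finite[OF assms(1,2), of n m]];
      use Y_zero_left[OF assms(3)] in force)

lemma jacobi_modes_homogeneous:
  assumes u: "u \<in> V \<inter> grade s N j" "j < N" and v: "v \<in> V \<inter> grade s N i" "i < N" and w: "w \<in> V"
  shows "jacobi_modes u v w"
  unfolding jacobi_modes_def
proof (intro allI ext)
  fix n p q m l t l' x
  note V = IntD1[OF u(1)] IntD1[OF v(1)] w
  \<comment> \<open>The toroidal exponents m, l - m and l' - l of the three fields add up to l', in
    whichever order the products are formed.\<close>
  let ?A = "component u m" and ?B = "component v (l - m)" and ?C = "component w (l' - l)"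
  let ?h = "(j + i) mod N"
  obtain k where "triple k ?A ?B ?C"
    using V_triple[OF V] by metis
  \<comment> \<open>Reducing j + i modulo N subtracts the integer (j + i) div N from the sum of the
    two exponents.\<close>
  moreover have "deg ?h - deg j - deg i \<in> \<int>"
    unfolding deg_mod by (simp add: add_divide_distrib)
  ultimately have main: "dsum n (\<lambda>i'. tw_prod (deg j) (p + n - int i') ?A (tw_prod (deg i) (q + int i') ?B ?C) t x)
      - alt n (dsum n (\<lambda>i'. tw_prod (deg i) (q + n - int i') ?B (tw_prod (deg j) (p + int i') ?A ?C) t x))
    = bsum (of_int p) (\<lambda>i'. tw_prod (deg ?h) (q + p - int i') (tw_prod (deg j) (n + int i') ?A ?B) ?C t x)"
    by (rule tw_prod_jacobi)
  have cu: "component (vmode u a m b) d = tw_prod (deg j) a ?A (component b (d - m))" if "b \<in> V" for a b d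
    using Y_homogeneous[OF u that] by (simp add: component_def fun_eq_iff)
  have cv: "component (vmode v a (l - m) b) d = tw_prod (deg i) a ?B (component b (d - (l - m)))" if "b \<in> V" for a b d
    using Y_homogeneous[OF v that] by (simp add: component_def fun_eq_iff)
  have e1: "l' - m - (l - m) = l' - l" and e2: "l' - (l - m) - m = l' - l"
    by (simp_all add: algebra_simps)
  have t1: "vmode u a m (vmode v b (l - m) w) t l' x = tw_prod (deg j) a ?A (tw_prod (deg i) b ?B ?C) t x" for a b
    unfolding Y_homogeneous[OF u Y_closed[OF V(2,3)]] cv[OF w] e1 ..
  have t2: "vmode v b (l - m) (vmode u a m w) t l' x = tw_prod (deg i) b ?B (tw_prod (deg j) a ?A ?C) t x" for a b
    unfolding Y_homogeneous[OF v Y_closed[OF V(1,3)]] cu[OF w] e2 ..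
  have t3: "vmode (vmode u a m v) b l w t l' x = tw_prod (deg ?h) b (tw_prod (deg j) a ?A ?B) ?C t x" for a b
    using Y_homogeneous[OF Y_grade[OF u(1) v(1) u(2)] _ w] N by (simp add: cu[OF V(2)])
  have fin1: "finite {i. vmode u (p + n - int i) m (vmode v (q + int i) (l - m) w) \<noteq> 0}"
    and fin2: "finite {i. vmode v (q + n - int i) (l - m) (vmode u (p + int i) m w) \<noteq> 0}"
    and fin3: "finite {i. vmode (vmode u (n + int i) m v) (q + p - int i) l w \<noteq> 0}"
    using vmode_vmode_finite[OF V] vmode_vmode_finite(1)[OF V(2,1,3)] by blast+
  show "(op.dsum n (\<lambda>i. vmode u (p + n - int i) m (vmode v (q + int i) (l - m) w))
      - op.alt n (op.dsum n (\<lambda>i. vmode v (q + n - int i) (l - m) (vmode u (p + int i) m w)))) t l' x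
    = op.bsum (of_int p) (\<lambda>i. vmode (vmode u (n + int i) m v) (q + p - int i) l w) t l' x"
    by (simp only: minus_apply op_alt_apply op_dsum_apply[OF fin1] op_dsum_apply[OF fin2]
        op_bsum_apply[OF fin3] t1 t2 t3 main)
qed

lemma jacobi_modes_add_left:
  assumes V: "u \<in> V" "u' \<in> V" "v \<in> V" "w \<in> V" and "jacobi_modes u v w" "jacobi_modes u' v w"
  shows "jacobi_modes (u + u') v w"
  unfolding jacobi_modes_def
proof (intro allI)
  fix n p q m l
  note Yc = Y_closed[OF V(1,4)] Y_closed[OF V(2,4)] Y_closed[OF V(3,4)] Y_closed[OF V(1,3)] Y_closed[OF V(2,3)]
  note fin1 = vmode_vmode_finite(1)[OF V(1,3,4)] vmode_vmode_finite(1)[OF V(2,3,4)]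
  note fin2 = vmode_vmode_finite(1)[OF V(3,1,4)] vmode_vmode_finite(1)[OF V(3,2,4)]
  note fin3 = vmode_vmode_finite(2)[OF V(1,3,4)] vmode_vmode_finite(2)[OF V(2,3,4)]
  have j: "op.dsum n (\<lambda>i. vmode u (p + n - int i) m (vmode v (q + int i) (l - m) w))
      - op.alt n (op.dsum n (\<lambda>i. vmode v (q + n - int i) (l - m) (vmode u (p + int i) m w)))
    = op.bsum (of_int p) (\<lambda>i. vmode (vmode u (n + int i) m v) (q + p - int i) l w)"
    using assms(5) by (simp only: jacobi_modes_def)
  have j': "op.dsum n (\<lambda>i. vmode u' (p + n - int i) m (vmode v (q + int i) (l - m) w))
      - op.alt n (op.dsum n (\<lambda>i. vmode v (q + n - int i) (l - m) (vmode u' (p + int i) m w)))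
    = op.bsum (of_int p) (\<lambda>i. vmode (vmode u' (n + int i) m v) (q + p - int i) l w)"
    using assms(6) by (simp only: jacobi_modes_def)
  show "op.dsum n (\<lambda>i. vmode (u + u') (p + n - int i) m (vmode v (q + int i) (l - m) w))
      - op.alt n (op.dsum n (\<lambda>i. vmode v (q + n - int i) (l - m) (vmode (u + u') (p + int i) m w)))
    = op.bsum (of_int p) (\<lambda>i. vmode (vmode (u + u') (n + int i) m v) (q + p - int i) l w)"
    by (simp only: Y_add_left[OF V(1,2) Yc(3)] Y_add_left[OF V(1,2,4)] Y_add_left[OF V(1,2,3)]
        Y_add_right[OF V(3) Yc(1,2)] Y_add_left[OF Yc(4,5) V(4)]
        op.dsum_add[OF fin1] op.dsum_add[OF fin2] op.bsum_add[OF fin3] op.alt_add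
        add_diff_add j j')
qed

lemma jacobi_modes_add_right:
  assumes V: "u \<in> V" "v \<in> V" "v' \<in> V" "w \<in> V" and "jacobi_modes u v w" "jacobi_modes u v' w"
  shows "jacobi_modes u (v + v') w"
  unfolding jacobi_modes_def
proof (intro allI)
  fix n p q m l
  note Yc = Y_closed[OF V(2,4)] Y_closed[OF V(3,4)] Y_closed[OF V(1,4)] Y_closed[OF V(1,2)] Y_closed[OF V(1,3)]
  note fin1 = vmode_vmode_finite(1)[OF V(1,2,4)] vmode_vmode_finite(1)[OF V(1,3,4)]
  note fin2 = vmode_vmode_finite(1)[OF V(2,1,4)] vmode_vmode_finite(1)[OF V(3,1,4)]
  note fin3 = vmode_vmode_finite(2)[OF V(1,2,4)] vmode_vmode_finite(2)[OF V(1,3,4)]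
  have j: "op.dsum n (\<lambda>i. vmode u (p + n - int i) m (vmode v (q + int i) (l - m) w))
      - op.alt n (op.dsum n (\<lambda>i. vmode v (q + n - int i) (l - m) (vmode u (p + int i) m w)))
    = op.bsum (of_int p) (\<lambda>i. vmode (vmode u (n + int i) m v) (q + p - int i) l w)"
    using assms(5) by (simp only: jacobi_modes_def)
  have j': "op.dsum n (\<lambda>i. vmode u (p + n - int i) m (vmode v' (q + int i) (l - m) w))
      - op.alt n (op.dsum n (\<lambda>i. vmode v' (q + n - int i) (l - m) (vmode u (p + int i) m w)))
    = op.bsum (of_int p) (\<lambda>i. vmode (vmode u (n + int i) m v') (q + p - int i) l w)"
    using assms(6) by (simp only: jacobi_modes_def)
  show "op.dsum n (\<lambda>i. vmode u (p + n - int i) m (vmode (v + v') (q + int i) (l - m) w))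
      - op.alt n (op.dsum n (\<lambda>i. vmode (v + v') (q + n - int i) (l - m) (vmode u (p + int i) m w)))
    = op.bsum (of_int p) (\<lambda>i. vmode (vmode u (n + int i) m (v + v')) (q + p - int i) l w)"
    by (simp only: Y_add_left[OF V(2,3) Yc(3)] Y_add_left[OF V(2,3,4)] Y_add_right[OF V(1,2,3)]
        Y_add_right[OF V(1) Yc(1,2)] Y_add_left[OF Yc(4,5) V(4)]
        op.dsum_add[OF fin1] op.dsum_add[OF fin2] op.bsum_add[OF fin3] op.alt_add
        add_diff_add j j')
qed

text \<open>The twisting exponents depend on u and v alone, so the induction over degrees runs over
  these two arguments.\<close>

lemma jacobi_modes_holds:
  assumes "u \<in> V" "v \<in> V" "w \<in> V"
  shows "jacobi_modes u v w"
  using assms(1)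
proof (induction u rule: grade_induct)
  case (homogeneous j u)
  show ?case
    using assms(2)
  proof (induction v rule: grade_induct)
    case (homogeneous i v)
    then show ?case
      using \<open>u \<in> V \<inter> grade s N j\<close> \<open>j < N\<close> assms(3) by (intro jacobi_modes_homogeneous)
  next
    case (add v v')
    then show ?case
      using homogeneous assms(3) by (intro jacobi_modes_add_right) auto
  qed
next
  case (add u u')
  then show ?case
    using assms by (intro jacobi_modes_add_left)
qed

text \<open>Coefficients with a nonintegral exponent vanish on both sides; the others are Borcherds'
  identity, with every exponent written as -n - 1.\<close>

lemma Y_jacobi:
  assumes V: "u \<in> V" "v \<in> V" "w \<in> V"
  shows "jacobi_lhs (op_scale s) (Y u) (Y v) e m l w
    = series_mult (op_scale s) delta_xz (iterate_series Y (\<lambda>c m. Y u c m v)) e m l w"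
proof -
  obtain c p q where e: "e = (c, p, q)"
    by (rule prod_cases3)
  have nonint: "x + of_int k \<notin> \<int>" if "x \<notin> \<int>" for x :: rat and k
    using that by (metis Ints_diff Ints_of_int add_diff_cancel_right')
  show ?thesis
  proof (cases c rule: int_cases_mode)
    case 1
    have "Y u (c - of_nat i) m v = 0" for i
      using nonint[OF 1, of "- int i"] by (simp add: Y_nonint)
    then have "series_mult (op_scale s) delta_xz (iterate_series Y (\<lambda>c m. Y u c m v)) (c, p, q) m l w = 0"
      by (cases "p \<in> \<int>")
        (auto elim!: Ints_cases simp: op.series_mult_delta_xz op.series_mult_delta_xz_nonint Y_zero_left V)
    then show ?thesis
      by (simp add: e op.jacobi_lhs_nonint[OF 1])
  next
    case c: (2 n)
    show ?thesis
    proof (cases p rule: int_cases_mode)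
      case 1
      have "Y u (p - of_int n + of_nat i) m b = 0" "Y u (p - of_nat i) m b = 0" for i b
        using nonint[OF 1, of "int i - n"] nonint[OF 1, of "- int i"] by (simp_all add: Y_nonint add_diff_eq diff_add_eq)
      then show ?thesis
        by (simp add: e c op.jacobi_lhs_int op.series_mult_delta_xz_nonint[OF 1] Y_zero_right V)
    next
      case p: (2 P)
      have pi: "p = of_int (- P - 1)"
        by (simp add: p)
      show ?thesis
      proof (cases q rule: int_cases_mode)
        case 1
        have "Y v (q - of_nat i) (l - m) b = 0" "Y v (q - of_int n + of_nat i) (l - m) b = 0" for i b
          using nonint[OF 1, of "int i - n"] nonint[OF 1, of "- int i"] by (simp_all add: Y_nonint add_diff_eq diff_add_eq)
        moreover have "Y b (q + of_int (- P - 1) + 1 + of_nat i) l w = 0" for i b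
          using nonint[OF 1, of "int i - P"] by (simp add: Y_nonint add_diff_eq diff_add_eq)
        ultimately show ?thesis
          unfolding e c pi op.jacobi_lhs_int op.series_mult_delta_xz
          by (simp add: Y_zero_right V del: of_int_minus of_int_diff)
      next
        case q: (2 Q)
        have 1: "p - of_int n + of_nat i = - of_int (P + n - int i) - 1"
          "p - of_nat i = - of_int (P + int i) - 1"
          "q - of_nat i = - of_int (Q + int i) - 1"
          "q - of_int n + of_nat i = - of_int (Q + n - int i) - 1"
          "- of_int n - 1 - of_nat i = - of_int (n + int i) - (1::rat)" for i
          by (simp_all add: p q)
        have 2: "q + of_int (- P - 1) + 1 + of_nat i = - of_int (Q + P - int i) - 1" for i
          by (simp add: q)
        have 3: "- (- P - 1) - 1 = P"
          by simp
        have "jacobi_lhs (op_scale s) (Y u) (Y v) e m l w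
          = op.dsum n (\<lambda>i. vmode u (P + n - int i) m (vmode v (Q + int i) (l - m) w))
            - op.alt n (op.dsum n (\<lambda>i. vmode v (Q + n - int i) (l - m) (vmode u (P + int i) m w)))"
          unfolding e c op.jacobi_lhs_int 1 ..
        moreover have "series_mult (op_scale s) delta_xz (iterate_series Y (\<lambda>c m. Y u c m v)) e m l w
          = op.bsum (of_int P) (\<lambda>i. vmode (vmode u (n + int i) m v) (Q + P - int i) l w)"
          unfolding e c pi op.series_mult_delta_xz 1 2 3 ..
        ultimately show ?thesis
          using jacobi_modes_holds[OF V] by (simp only: jacobi_modes_def)
      qed
    qed
  qed
qed

section \<open>Vacuum axioms and truncation\<close>

lemma one_in_V: "one_series \<in> V"
  using closed by (simp add: closed_subspace_def)

lemma one_homogeneous: "one_series \<in> V \<inter> grade s N 0"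
proof -
  have "(one_series :: ('r, 'w) op_series) \<in> grade s N 0"
    by (rule gradeI[OF vs V_field[OF one_in_V]]) (auto simp: one_series_def)
  then show ?thesis
    using one_in_V by simp
qed

lemma Y_one_left:
  assumes "v \<in> V"
  shows "Y one_series q m v = one_series q m v"
proof (cases q rule: int_cases_mode)
  case 1
  then show ?thesis
    by (auto simp: Y_nonint one_series_def)
next
  case (2 n)
  have eq: "q = 0 \<longleftrightarrow> n = -1"
  proof -
    have "q = of_int (- n - 1)"
      by (simp add: 2)
    then have "q = 0 \<longleftrightarrow> - n - 1 = 0"
      by (simp only: of_int_eq_0_iff)
    then show ?thesis
      by auto
  qed
  have "Y one_series q m v t l w = one_series q m v t l w" for t l w
  proof -
    have "Y one_series q m v t l w = nprod n (component one_series m) (component v (l - m)) t w"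
      unfolding 2 Y_homogeneous[OF one_homogeneous N assms] by (simp add: tw_prod_def)
    also have "\<dots> = (if n = -1 \<and> m = 0 then v t (l - m) w else 0)"
      by (simp add: nprod_one_left V_component assms) (simp add: component_def)
    also have "\<dots> = one_series q m v t l w"
      by (simp add: one_series_def eq)
    finally show ?thesis .
  qed
  then show ?thesis
    by (simp add: fun_eq_iff)
qed

lemma Y_one_right:
  assumes "v \<in> V" "q < 0"
  shows "Y v q m one_series = 0"
proof (cases q rule: int_cases_mode)
  case 1
  then show ?thesis
    by (simp add: Y_nonint)
next
  case (2 n)
  have "n \<ge> 0"
  proof -
    have "(of_int (- n - 1) :: rat) < of_int 0"
      using assms(2) by (simp add: 2)
    then have "- n - 1 < 0"
      by (simp only: of_int_less_iff)
    then show ?thesis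
      by simp
  qed
  then have "tw_prod \<alpha> n (component a m) (component one_series l) t w = 0" 
    if "a \<in> V" for \<alpha> a m t w and l :: "int ^ 'r"
    by (simp add: tw_prod_def nprod_one_right is_field_shift V_component that)
  then show ?thesis
    by (simp add: 2 fun_eq_iff Y_eq_sum assms one_in_V grade_part_V)
qed

lemma Y_field_space:
  assumes "v \<in> V"
  shows "Y v \<in> field_space (op_scale s) V 1"
  unfolding field_space_def
proof (intro CollectI conjI allI impI ballI)
  fix q :: rat and m :: "int ^ 'r"
  show "Y v q m ` V \<subseteq> V"
    using Y_closed assms by blast
  show "linear_map_on (op_scale s) V (op_scale s) (Y v q m)"
    by (simp add: linear_map_on_def Y_add_right Y_scale_right assms)
next
  fix q :: rat and m :: "int ^ 'r" and w assume "of_nat 1 * q \<notin> \<int>"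
  then show "Y v q m w = 0"
    by (simp add: Y_nonint)
next
  fix w assume w: "w \<in> V"
  obtain k where k: "\<And>n m. n \<ge> k \<Longrightarrow> vmode v n m w = 0"
    using Y_vanish[OF assms w] by metis
  have "Y v q m w = 0" if "q < - of_int k" for q and m :: "int ^ 'r"
  proof (cases q rule: int_cases_mode)
    case 1
    then show ?thesis
      by (simp add: Y_nonint)
  next
    case (2 n)
    then have "(of_int k :: rat) < of_int (n + 1)"
      using that by simp
    then have "k < n + 1"
      by (simp only: of_int_less_iff)
    then show ?thesis
      using k by (simp add: 2)
  qed
  then show "\<exists>K. \<forall>q<K. \<forall>m. Y v q m w = 0"
    by blast
qed

lemma tva: "toroidal_vertex_algebra (op_scale s) V Y one_series"
proof
  show "op.subspace V"
    by (rule V_subspace)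
  show "linear_map_on (op_scale s) V (op_scale s) (\<lambda>v. Y v q m w)" if "w \<in> V" for w q m
    by (simp add: linear_map_on_def Y_add_left Y_scale_left that)
  show "Y v \<in> field_space (op_scale s) V 1" if "v \<in> V" for v
    using that by (rule Y_field_space)
qed (simp_all add: one_in_V Y_one_left Y_one_right Y_jacobi)

section \<open>The automorphism given by the grading\<close>

abbreviation \<sigma> :: "('r, 'w) op_series \<Rightarrow> ('r, 'w) op_series" where "\<sigma> \<equiv> sigma_map s N"

lemma sigma_add: "\<sigma> (a + b) = \<sigma> a + \<sigma> b" for a b :: "('r, 'w) op_series"
  by (simp add: sigma_map_def grade_part_add op.scale_right_distrib sum.distrib)

lemma sigma_scale: "\<sigma> (op_scale s x a) = op_scale s x (\<sigma> a)" for a :: "('r, 'w) op_series"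
proof -
  have "grade_part N j (op_scale s x a) = op_scale s x (grade_part N j a)" for j
    by (simp add: grade_part_def op_scale_def fun_eq_iff)
  then show ?thesis
    by (simp add: sigma_map_def op.scale_sum_right mult.commute)
qed

lemma sigma_in_V: "a \<in> V \<Longrightarrow> \<sigma> a \<in> V"
  unfolding sigma_map_def by (intro V_sum V_scale grade_part_V) auto

lemma sigma_homogeneous: "a \<in> V \<inter> grade s N j \<Longrightarrow> j < N \<Longrightarrow> \<sigma> a = op_scale s (omega N ^ j) a"
  using sigma_map_grade[OF vs N] by blast

lemma sigma_pow_add: "(\<sigma> ^^ k) (a + b) = (\<sigma> ^^ k) a + (\<sigma> ^^ k) b" for a b :: "('r, 'w) op_series"
  by (induction k) (simp_all add: sigma_add del: plus_fun_apply)

lemma sigma_pow_in_V: "a \<in> V \<Longrightarrow> (\<sigma> ^^ k) a \<in> V"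
  by (induction k) (simp_all add: sigma_in_V)

lemma sigma_pow_homogeneous:
  assumes "a \<in> V \<inter> grade s N j" "j < N"
  shows "(\<sigma> ^^ k) a = op_scale s (omega N ^ (j * k)) a"
  by (induction k) (simp_all add: sigma_scale sigma_homogeneous[OF assms] power_add mult.commute)

lemma sigma_period: "a \<in> V \<Longrightarrow> (\<sigma> ^^ N) a = a"
proof (induction a rule: grade_induct)
  case (homogeneous j b)
  then show ?case
    by (simp add: sigma_pow_homogeneous[OF homogeneous(2,1)] mult.commute[of j] power_mult omega_power[OF N])
qed (simp only: sigma_pow_add)

lemma sigma_bij: "bij_betw \<sigma> V V"
proof (rule bij_betwI[where g = "\<sigma> ^^ (N - 1)"])
  obtain k where k: "N = Suc k"
    using N gr0_implies_Suc by blast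
  show "(\<sigma> ^^ (N - 1)) (\<sigma> a) = a" "\<sigma> ((\<sigma> ^^ (N - 1)) a) = a" if "a \<in> V" for a
    using sigma_period[OF that] by (simp_all add: k funpow_swap1)
qed (auto simp: sigma_in_V sigma_pow_in_V)

lemma omega_mod: "omega N ^ (k mod N) = omega N ^ k"
proof -
  have "omega N ^ k = omega N ^ (N * (k div N) + k mod N)"
    by simp
  also have "\<dots> = omega N ^ (k mod N)"
    by (simp only: power_add power_mult omega_power[OF N] power_one mult_1_left)
  finally show ?thesis ..
qed

text \<open>Degrees add modulo N, and the scalars multiply accordingly because the N-th power of
  \<open>omega N\<close> is 1.\<close>

lemma sigma_Y:
  assumes "u \<in> V" "v \<in> V"
  shows "\<sigma> (Y u q m v) = Y (\<sigma> u) q m (\<sigma> v)"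
  using assms(1)
proof (induction u rule: grade_induct)
  case u: (homogeneous j u)
  show ?case
    using assms(2)
  proof (induction v rule: grade_induct)
    case v: (homogeneous i v)
    note Y = Y_grade[OF u(2) v(2) u(1), of q m]
    have "Y (\<sigma> u) q m (\<sigma> v) = op_scale s (omega N ^ j) (op_scale s (omega N ^ i) (Y u q m v))"
      unfolding sigma_homogeneous[OF u(2,1)] sigma_homogeneous[OF v(2,1)]
      using u v by (simp add: Y_scale_left Y_scale_right V_scale)
    also have "\<dots> = op_scale s (omega N ^ ((j + i) mod N)) (Y u q m v)"
      by (simp add: omega_mod power_add)
    also have "\<dots> = \<sigma> (Y u q m v)"
      using sigma_homogeneous[OF Y] N by simp
    finally show ?case ..
  next
    case (add v v')
    then show ?case
      using u by (simp add: sigma_add Y_add_right sigma_in_V del: plus_fun_apply)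
  qed
next
  case (add u u')
  then show ?case
    using assms(2) by (simp add: sigma_add Y_add_left sigma_in_V del: plus_fun_apply)
qed

lemma automorphism: "tva_automorphism (op_scale s) V Y one_series \<sigma>"
proof -
  interpret toroidal_vertex_algebra "op_scale s" V Y one_series
    by (rule tva)
  show ?thesis
  proof
    show "bij_betw \<sigma> V V"
      by (rule sigma_bij)
    show "linear_map_on (op_scale s) V (op_scale s) \<sigma>"
      by (simp add: linear_map_on_def sigma_add sigma_scale)
    show "\<sigma> one_series = one_series"
      using sigma_homogeneous[OF one_homogeneous N] by simp
    show "\<sigma> (Y u q m v) = Y (\<sigma> u) q m (\<sigma> v)" if "u \<in> V" "v \<in> V" for u v q m
      using that by (rule sigma_Y)
  qed
qed

lemma period: "has_period V \<sigma> N"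
  by (simp add: has_period_def N sigma_period)


section \<open>The twisted module structure\<close>

definition twisted_jacobi_modes where
  "twisted_jacobi_modes u v \<longleftrightarrow> (\<forall>n p P q m l w. of_nat N * p = of_int P \<longrightarrow>
    nprod n (shift (- 1 - p) (component u m)) (component v (l - m)) q w
    = s (1 / of_nat N) (\<Sum>j<N. bsum (of_rat (- p - 1)) (\<lambda>i. s ((omega N ^ j) powi P)
        (vmode ((\<sigma> ^^ j) u) (n + int i) m v (q + p + 1 + of_nat i) l w))))"

text \<open>Summing over j tests whether N divides P + h, that is, whether the exponent p is allowed
  in degree h. If so, the factor N cancels 1/N and \<open>bsum_tw_prod\<close> undoes the twisting;
  if not, both sides are 0.\<close>

lemma twisted_jacobi_modes_homogeneous:
  assumes u: "u \<in> V \<inter> grade s N h" "h < N" and v: "v \<in> V"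
  shows "twisted_jacobi_modes u v"
  unfolding twisted_jacobi_modes_def
proof (intro allI impI)
  fix n q m l w and p :: rat and P :: int assume p: "of_nat N * p = of_int P"
  note V = IntD1[OF u(1)]
  let ?A = "component u m" and ?B = "component v (l - m)"
  define X where "X i = tw_prod (deg h) (n + int i) ?A ?B (q + p + 1 + of_nat i) w" for i
  define B where "B = bsum (of_rat (- p - 1)) X"
  obtain k where loc: "local_fields k ?A ?B"
    using V_local[OF V v] by metis
  have X: "finite {i. X i \<noteq> 0}"
    by (rule finite_support_bound[of "nat (k - n)"]) (auto simp: X_def intro!: tw_prod_vanish[OF loc])
  have "bsum (of_rat (- p - 1)) (\<lambda>i. s ((omega N ^ j) powi P)
      (vmode ((\<sigma> ^^ j) u) (n + int i) m v (q + p + 1 + of_nat i) l w))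
    = s ((omega N powi (P + int h)) ^ j) B" for j
  proof -
    have "omega N \<noteq> 0"
      by (simp add: omega_def)
    \<comment> \<open>The scalar omega^(j P) of the delta function and the eigenvalue omega^(h j) of
      the j-th power of the automorphism combine into a single j-th power.\<close>
    then have c: "(omega N ^ j) powi P * omega N ^ (h * j) = (omega N powi (P + int h)) ^ j"
      by (simp add: power_int_add power_mult_distrib power_int_power power_int_power' power_mult mult.commute)
    have "s ((omega N ^ j) powi P) (vmode ((\<sigma> ^^ j) u) (n + int i) m v (q + p + 1 + of_nat i) l w)
      = s ((omega N powi (P + int h)) ^ j) (X i)" for i
      unfolding sigma_pow_homogeneous[OF u] Y_scale_left[OF V v] X_def c[symmetric]
      by (simp only: op_scale_def Y_homogeneous[OF u v] scale_scale)
    then show ?thesis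
      by (simp only: B_def bsum_scale[OF X])
  qed
  then have "(\<Sum>j<N. bsum (of_rat (- p - 1)) (\<lambda>i. s ((omega N ^ j) powi P)
      (vmode ((\<sigma> ^^ j) u) (n + int i) m v (q + p + 1 + of_nat i) l w)))
    = s (\<Sum>j<N. (omega N powi (P + int h)) ^ j) B"
    by (simp only: scale_sum_left)
  moreover have "nprod n (shift (- 1 - p) ?A) ?B q w
    = s (1 / of_nat N) (s (\<Sum>j<N. (omega N powi (P + int h)) ^ j) B)"
  proof (cases "int N dvd P + int h")
    case True
    then obtain d where d: "P + int h = int N * d" ..
    have "of_nat N * (p + deg h) = of_int (P + int h)"
      using N p by (simp add: distrib_left)
    then have "p + deg h = of_int d"
      using N by (simp add: d)
    then have "B = nprod n (shift (- 1 - p) ?A) ?B q w"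
      unfolding B_def X_def by (intro bsum_tw_prod[OF V_component[OF V] V_component[OF v] loc]) simp
    then show ?thesis
      using True N by (simp add: sum_root_of_unity)
  next
    case False
    have "p + deg h \<notin> \<int>"
    proof
      assume "p + deg h \<in> \<int>"
      then obtain d where d: "p + deg h = of_int d"
        by (rule Ints_cases)
      have "(of_int (P + int h) :: rat) = of_nat N * (p + deg h)"
        using N p by (simp add: distrib_left)
      also have "\<dots> = of_int (int N * d)"
        by (simp add: d)
      finally have "P + int h = int N * d"
        by (simp only: of_int_eq_iff)
      with False show False
        by simp
    qed
    then have nonint: "p + of_int d + deg h \<notin> \<int>" for d
      by (metis Ints_diff Ints_of_int add.assoc add.commute add_diff_cancel_right')
    \<comment> \<open>The product reads u only at exponents that differ from p by integers, and none
      of these occur in degree h.\<close>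
    have "u (p - of_int n + of_nat i) m x = 0" "u (p - of_nat i) m x = 0" for i x
      using grade_support[OF IntD2[OF u(1)] nonint[of "int i - n"], of m x]
        grade_support[OF IntD2[OF u(1)] nonint[of "- int i"], of m x]
      by (simp_all add: add_diff_eq diff_add_eq)
    then have "nprod n (shift (- 1 - p) ?A) ?B q w = 0"
      by (simp add: nprod_def shift_def component_def[of u] field_0[OF V_component[OF v]] algebra_simps)
    then show ?thesis
      using False by (simp add: sum_root_of_unity N)
  qed
  ultimately show "nprod n (shift (- 1 - p) ?A) ?B q w
    = s (1 / of_nat N) (\<Sum>j<N. bsum (of_rat (- p - 1)) (\<lambda>i. s ((omega N ^ j) powi P)
        (vmode ((\<sigma> ^^ j) u) (n + int i) m v (q + p + 1 + of_nat i) l w)))"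
    by (simp only:)
qed

lemma twisted_jacobi_modes_add:
  assumes V: "u \<in> V" "u' \<in> V" "v \<in> V" and "twisted_jacobi_modes u v" "twisted_jacobi_modes u' v"
  shows "twisted_jacobi_modes (u + u') v"
  unfolding twisted_jacobi_modes_def
proof (intro allI impI)
  fix n q m l w and p :: rat and P :: int assume p: "of_nat N * p = of_int P"
  let ?t = "\<lambda>u j i. s ((omega N ^ j) powi P) (vmode ((\<sigma> ^^ j) u) (n + int i) m v (q + p + 1 + of_nat i) l w)"
  have fin: "finite {i. ?t a j i \<noteq> 0}" if "a \<in> V" for a j
    by (rule finite_subset[OF _ vmode_finite[OF sigma_pow_in_V[OF that] V(3), of j n m]]) auto
  have "?t (u + u') j i = ?t u j i + ?t u' j i" for i j
    unfolding sigma_pow_add Y_add_left[OF sigma_pow_in_V[OF V(1)] sigma_pow_in_V[OF V(2)] V(3)]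
    by (simp add: scale_right_distrib)
  then have "(\<Sum>j<N. bsum (of_rat (- p - 1)) (?t (u + u') j))
    = (\<Sum>j<N. bsum (of_rat (- p - 1)) (?t u j)) + (\<Sum>j<N. bsum (of_rat (- p - 1)) (?t u' j))"
    by (simp only: bsum_add[OF fin[OF V(1)] fin[OF V(2)]] sum.distrib)
  moreover have "nprod n (shift (- 1 - p) (component (u + u') m)) (component v (l - m)) q w
    = nprod n (shift (- 1 - p) (component u m)) (component v (l - m)) q w
      + nprod n (shift (- 1 - p) (component u' m)) (component v (l - m)) q w"
    unfolding component_add shift_add
    by (intro nprod_add_left is_field_shift V_component V)
  ultimately show "nprod n (shift (- 1 - p) (component (u + u') m)) (component v (l - m)) q w
    = s (1 / of_nat N) (\<Sum>j<N. bsum (of_rat (- p - 1)) (?t (u + u') j))"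
    using assms(4,5) p by (simp only: twisted_jacobi_modes_def scale_right_distrib)
qed

lemma twisted_jacobi_modes_holds:
  assumes "u \<in> V" "v \<in> V"
  shows "twisted_jacobi_modes u v"
  using assms(1)
proof (induction u rule: grade_induct)
  case (homogeneous j u)
  then show ?case
    using assms(2) by (intro twisted_jacobi_modes_homogeneous)
next
  case (add u u')
  then show ?case
    using assms(2) by (intro twisted_jacobi_modes_add)
qed

text \<open>\<open>twisted_jacobi_modes\<close> gives the coefficients of z0^(-n-1) x0^p y0^q z^m
  y^l with N p integral. The remaining ones, where N p or the exponent of z0 is not an integer,
  vanish on both sides.\<close>

lemma twisted_jacobi:
  assumes V: "u \<in> V" "v \<in> V"
  shows "jacobi_lhs s u v e m l w
    = s (1 / of_nat N) (\<Sum>j<N. series_mult s (delta_xz_root N j)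
        (iterate_series (\<lambda>a. a) (\<lambda>c m. Y ((\<sigma> ^^ j) u) c m v)) e m l w)"
proof -
  obtain c p q where e: "e = (c, p, q)"
    by (rule prod_cases3)
  show ?thesis
  proof (cases "of_nat N * p \<in> \<int>")
    case False
    have nonint: "of_nat N * (p + of_int k) \<notin> \<int>" for k
    proof
      assume "of_nat N * (p + of_int k) \<in> \<int>"
      then have "of_nat N * (p + of_int k) - of_int (int N * k) \<in> \<int>"
        by (intro Ints_diff Ints_of_int)
      then show False
        using False by (simp add: distrib_left)
    qed
    have z: "u x m y = 0" if "of_nat N * x \<notin> \<int>" for x m y
      using V_field[OF V(1)] that by (simp add: field_space_def)
    have "u (p - of_int n + of_nat i) m x = 0" "u (p - of_nat i) m x = 0" for i n x
      using z[OF nonint[of "int i - n"], of m x] z[OF nonint[of "- int i"], of m x]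
      by (simp_all add: add_diff_eq diff_add_eq)
    then have "jacobi_lhs s u v e m l w = 0"
      using field_0[OF V_component[OF V(2), of "l - m"]]
      by (cases c rule: int_cases_mode) (simp_all add: e jacobi_lhs_nonint jacobi_lhs_int component_def)
    then show ?thesis
      by (simp add: e series_mult_delta_root_zero[OF N False])
  next
    case True
    then obtain P where P: "of_nat N * p = of_int P"
      by (rule Ints_cases)
    show ?thesis
    proof (cases c rule: int_cases_mode)
      case 1
      have "c - of_nat i \<notin> \<int>" for i
        using 1 by (metis Ints_add Ints_of_nat diff_add_cancel)
      then show ?thesis
        by (simp add: e jacobi_lhs_nonint[OF 1] series_mult_delta_root[OF N P] Y_nonint)
    next
      case c: (2 n)
      have 1: "- of_int n - 1 - of_nat i = - of_int (n + int i) - (1::rat)" for i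
        by simp
      show ?thesis
        unfolding e c jacobi_lhs_nprod series_mult_delta_root[OF N P] 1
        using twisted_jacobi_modes_holds[OF V] P by (simp only: twisted_jacobi_modes_def)
    qed
  qed
qed

lemma faithful_module:
  "faithful_twisted_module (op_scale s) V Y one_series \<sigma> s N (\<lambda>a. a)"
proof -
  interpret tva_automorphism "op_scale s" V Y one_series \<sigma>
    by (rule automorphism)
  show ?thesis
  proof
    show "has_period V \<sigma> N"
      by (rule period)
    show "v \<in> field_space s UNIV N" if "v \<in> V" for v
      using that by (rule V_field)
    show "linear_map_on (op_scale s) V (op_scale s) (\<lambda>a. a)"
      by (simp add: linear_map_on_def)
    show "one_series = (one_series :: ('r, 'w) op_series)" ..
    show "jacobi_lhs s u v e m l w
      = s (1 / of_nat N) (\<Sum>j<N. series_mult s (delta_xz_root N j)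
          (iterate_series (\<lambda>a. a) (\<lambda>c m. Y ((\<sigma> ^^ j) u) c m v)) e m l w)"
      if "u \<in> V" "v \<in> V" for u v e m l w
      using that by (rule twisted_jacobi)
    show "inj_on (\<lambda>a. a) V"
      by simp
  qed
qed

end

theorem theorem3p5:
  fixes s :: "complex \<Rightarrow> 'w::ab_group_add \<Rightarrow> 'w"
    and N :: nat
    and V :: "('r::finite, 'w) op_series set"
  assumes "vector_space s"
    and "N > 0"
    and "graded_subspace s N V"
    and "local_set s V"
    and "closed_subspace s N V"
  shows "toroidal_vertex_algebra (op_scale s) V (Y_E s N) one_series
    \<and> tva_automorphism (op_scale s) V (Y_E s N) one_series (sigma_map s N)
    \<and> has_period V (sigma_map s N) N
    \<and> faithful_twisted_module (op_scale s) V (Y_E s N) one_series (sigma_map s N) s N (\<lambda>a. a)"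
proof -
  interpret vector_space s
    by fact
  interpret closed_fields s N V
    by unfold_locales fact+
  show ?thesis
    using tva automorphism period faithful_module by blast
qed

end
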